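(* Let $A$ be a finite alphabet and $r\in A^*$ a word. Then the one-relator monoid $\langle A\mid r=1\rangle$ is of type bi-$\mathrm{FP}_\infty$. Moreover, if $r$ is not a proper power then this monoid has Hochschild cohomological dimension at most $2$, while if $r$ is a proper power then it has infinite Hochschild cohomological dimension.
   Context: $\langle A\mid r=1\rangle$ denotes the monoid $A^*/{\sim}$, where $\sim$ is the congruence on the free monoid $A^*$ generated by the pair $(r,1)$. The word $r$ is a proper power if $r=s^m$ in $A^*$ for some nonempty word $s\in A^*$ and some integer $m\ge 2$. $M^{op}$ is the opposite monoid of a monoid $M$; $\mathbb{Z}M$ is a left $\mathbb{Z}[M\times M^{op}]$-module via left and right multiplication. $M$ is of type bi-$\mathrm{FP}_\infty$ if the left $\mathbb{Z}[M\times M^{op}]$-module $\mathbb{Z}M$ has a projective resolution that is finitely generated in every degree. The Hochschild cohomological dimension of $M$ is the projective dimension (possibly infinite) of $\mathbb{Z}M$ as a left $\mathbb{Z}[M\times M^{op}]$-module. *)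

theory Defs
  imports
    "HOL-Algebra.Module"
    "HOL-Library.Poly_Mapping"
    "HOL-Library.Extended_Nat"
    "HOL-Library.Infinite_Typeclass"
begin

section \<open>Presented monoids\<close>

inductive_set generated_congruence ::
    "'a set \<Rightarrow> ('a list \<times> 'a list) set \<Rightarrow> ('a list \<times> 'a list) set"
  for A :: "'a set" and S :: "('a list \<times> 'a list) set" where
  gen: "(u, v) \<in> S \<Longrightarrow> u \<in> lists A \<Longrightarrow> v \<in> lists A \<Longrightarrow> (u, v) \<in> generated_congruence A S"
| refl: "u \<in> lists A \<Longrightarrow> (u, u) \<in> generated_congruence A S"
| sym: "(u, v) \<in> generated_congruence A S \<Longrightarrow> (v, u) \<in> generated_congruence A S"
| trans: "(u, v) \<in> generated_congruence A S \<Longrightarrow> (v, w) \<in> generated_congruence A S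
    \<Longrightarrow> (u, w) \<in> generated_congruence A S"
| mult: "(u, v) \<in> generated_congruence A S \<Longrightarrow> (u', v') \<in> generated_congruence A S
    \<Longrightarrow> (u @ u', v @ v') \<in> generated_congruence A S"

definition presented_monoid :: "'a set \<Rightarrow> ('a list \<times> 'a list) set \<Rightarrow> 'a list set monoid" where
  "presented_monoid A S =
    \<lparr>carrier = lists A // generated_congruence A S,
     mult = (\<lambda>X Y. \<Union>u\<in>X. \<Union>v\<in>Y. generated_congruence A S `` {u @ v}),
     one = generated_congruence A S `` {[]}\<rparr>"

definition one_relator_monoid :: "'a set \<Rightarrow> 'a list \<Rightarrow> 'a list set monoid" where
  "one_relator_monoid A r = presented_monoid A {(r, [])}"

definition proper_power :: "'a list \<Rightarrow> bool" where
  "proper_power r \<longleftrightarrow> (\<exists>s m. s \<noteq> [] \<and> m \<ge> 2 \<and> r = concat (replicate m s))"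

lemma generated_congruence_equiv: "equiv (lists A) (generated_congruence A S)"
proof -
  have sub: "u \<in> lists A \<and> v \<in> lists A" if "(u, v) \<in> generated_congruence A S" for u v
    using that by induction auto
  show ?thesis
    by (rule equivI)
      (use sub in \<open>auto simp: refl_on_def sym_def trans_def
         intro: generated_congruence.refl generated_congruence.sym
         dest: generated_congruence.trans\<close>)
qed

lemma presented_monoid_mult_class:
  assumes "u \<in> lists A" "v \<in> lists A"
  shows "(generated_congruence A S `` {u}) \<otimes>\<^bsub>presented_monoid A S\<^esub> (generated_congruence A S `` {v})
    = generated_congruence A S `` {u @ v}"
proof -
  let ?E = "generated_congruence A S"
  have eq: "?E `` {u' @ v'} = ?E `` {u @ v}" if "(u, u') \<in> ?E" "(v, v') \<in> ?E" for u' v'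
    using equiv_class_eq[OF generated_congruence_equiv generated_congruence.mult[OF that]] by simp
  show ?thesis
    using eq assms by (auto simp: presented_monoid_def intro: generated_congruence.refl)
qed

lemma monoid_presented_monoid: "monoid (presented_monoid A S)"
proof -
  let ?E = "generated_congruence A S" and ?M = "presented_monoid A S"
  have carr: "carrier ?M = (\<lambda>u. ?E `` {u}) ` lists A" and one: "\<one>\<^bsub>?M\<^esub> = ?E `` {[]}"
    by (auto simp: presented_monoid_def quotient_def)
  show ?thesis
  proof (rule monoidI, unfold carr one)
    fix X Y Z
    assume "X \<in> (\<lambda>u. ?E `` {u}) ` lists A" "Y \<in> (\<lambda>u. ?E `` {u}) ` lists A"
      "Z \<in> (\<lambda>u. ?E `` {u}) ` lists A"
    then obtain u v w where uvw: "u \<in> lists A" "v \<in> lists A" "w \<in> lists A"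
      "X = ?E `` {u}" "Y = ?E `` {v}" "Z = ?E `` {w}"
      by (elim imageE)
    have uv: "u @ v \<in> lists A" "v @ w \<in> lists A"
      using uvw by simp_all
    show "X \<otimes>\<^bsub>?M\<^esub> Y \<otimes>\<^bsub>?M\<^esub> Z = X \<otimes>\<^bsub>?M\<^esub> (Y \<otimes>\<^bsub>?M\<^esub> Z)"
      using presented_monoid_mult_class[OF uv(1) uvw(3), where S = S]
        presented_monoid_mult_class[OF uvw(1) uv(2), where S = S]
      by (simp only: uvw presented_monoid_mult_class append_assoc)
  next
    fix X Y
    assume "X \<in> (\<lambda>u. ?E `` {u}) ` lists A" "Y \<in> (\<lambda>u. ?E `` {u}) ` lists A"
    then obtain u v where uv: "u \<in> lists A" "v \<in> lists A" "X = ?E `` {u}" "Y = ?E `` {v}"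
      by (elim imageE)
    then have "X \<otimes>\<^bsub>?M\<^esub> Y = ?E `` {u @ v}" "u @ v \<in> lists A"
      by (simp_all add: presented_monoid_mult_class)
    then show "X \<otimes>\<^bsub>?M\<^esub> Y \<in> (\<lambda>u. ?E `` {u}) ` lists A" by blast
  next
    fix X
    assume "X \<in> (\<lambda>u. ?E `` {u}) ` lists A"
    then obtain u where u: "u \<in> lists A" "X = ?E `` {u}"
      by (elim imageE)
    show "?E `` {[]} \<otimes>\<^bsub>?M\<^esub> X = X" "X \<otimes>\<^bsub>?M\<^esub> ?E `` {[]} = X"
      using presented_monoid_mult_class[OF lists.Nil u(1), where S = S]
        presented_monoid_mult_class[OF u(1) lists.Nil, where S = S] u(2) by simp_all
  qed (rule imageI, rule lists.Nil)
qed


section \<open>Integral monoid rings\<close>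

definition opposite_monoid :: "('m, 'b) monoid_scheme \<Rightarrow> 'm monoid" where
  "opposite_monoid M = \<lparr>carrier = carrier M, mult = (\<lambda>x y. y \<otimes>\<^bsub>M\<^esub> x), one = \<one>\<^bsub>M\<^esub>\<rparr>"

text \<open>\<^const>\<open>frag_extend\<close> extends a map on basis elements additively, so the product below is the
  biadditive extension of the multiplication of \<open>M\<close>.\<close>

definition monoid_ring :: "('m, 'b) monoid_scheme \<Rightarrow> ('m \<Rightarrow>\<^sub>0 int) ring" where
  "monoid_ring M =
    \<lparr>carrier = {c. Poly_Mapping.keys c \<subseteq> carrier M},
     mult = (\<lambda>c d. frag_extend (\<lambda>x. frag_extend (\<lambda>y. frag_of (x \<otimes>\<^bsub>M\<^esub> y)) d) c),
     one = frag_of \<one>\<^bsub>M\<^esub>,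
     zero = 0,
     add = (+)\<rparr>"

lemma frag_extend_fun_add: "frag_extend (\<lambda>x. f x + g x) c = frag_extend f c + frag_extend g c"
  by (simp add: frag_extend_def frag_cmul_distrib2 sum.distrib)

lemma keys_frag_extend_subset:
  assumes "\<And>x. x \<in> Poly_Mapping.keys c \<Longrightarrow> Poly_Mapping.keys (f x) \<subseteq> S"
  shows "Poly_Mapping.keys (frag_extend f c) \<subseteq> S"
  using keys_frag_extend[of f c] assms by fastforce

lemma abelian_group_fragments:
  assumes "carrier G = {c :: 'm \<Rightarrow>\<^sub>0 int. Poly_Mapping.keys c \<subseteq> S}" "add G = (+)" "zero G = 0"
  shows "abelian_group G"
proof (rule abelian_groupI)
  show "x \<oplus>\<^bsub>G\<^esub> y \<in> carrier G" if "x \<in> carrier G" "y \<in> carrier G" for x y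
    using that keys_add[of x y] by (auto simp: assms)
  show "\<exists>y\<in>carrier G. y \<oplus>\<^bsub>G\<^esub> x = \<zero>\<^bsub>G\<^esub>" if "x \<in> carrier G" for x
    using that by (intro bexI[of _ "- x"]) (auto simp: assms)
qed (auto simp: assms algebra_simps)

lemma ring_monoid_ring:
  assumes "monoid M"
  shows "ring (monoid_ring M)"
proof -
  interpret monoid M by fact
  let ?m = "\<lambda>c d. frag_extend (\<lambda>x. frag_extend (\<lambda>y. frag_of (x \<otimes>\<^bsub>M\<^esub> y)) d) c"
  have assoc: "?m (?m c d) e = ?m c (?m d e)"
    if c: "Poly_Mapping.keys c \<subseteq> carrier M" and d: "Poly_Mapping.keys d \<subseteq> carrier M"
      and e: "Poly_Mapping.keys e \<subseteq> carrier M" for c d e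
  proof (rule frag_induction[OF c])
    fix x assume x: "x \<in> carrier M"
    show "?m (?m (frag_of x) d) e = ?m (frag_of x) (?m d e)"
    proof (rule frag_induction[OF d])
      fix y assume y: "y \<in> carrier M"
      show "?m (?m (frag_of x) (frag_of y)) e = ?m (frag_of x) (?m (frag_of y) e)"
        by (rule frag_induction[OF e]) (simp_all add: frag_extend_diff m_assoc x y)
    qed (simp_all add: frag_extend_diff)
  qed (simp_all add: frag_extend_diff)
  have l_one: "?m (frag_of \<one>\<^bsub>M\<^esub>) c = c" if "Poly_Mapping.keys c \<subseteq> carrier M" for c
    by (rule frag_induction[OF that]) (simp_all add: frag_extend_diff)
  have r_one: "?m c (frag_of \<one>\<^bsub>M\<^esub>) = c" if "Poly_Mapping.keys c \<subseteq> carrier M" for c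
    by (rule frag_induction[OF that]) (simp_all add: frag_extend_diff)
  show ?thesis
  proof (rule ringI)
    show "abelian_group (monoid_ring M)"
      by (rule abelian_group_fragments[where S = "carrier M"]) (auto simp: monoid_ring_def)
    show "monoid (monoid_ring M)"
    proof (rule monoidI)
      show "x \<otimes>\<^bsub>monoid_ring M\<^esub> y \<in> carrier (monoid_ring M)"
        if "x \<in> carrier (monoid_ring M)" "y \<in> carrier (monoid_ring M)" for x y
        using that
        by (auto simp only: monoid_ring_def partial_object.simps monoid.simps mem_Collect_eq
            intro!: keys_frag_extend_subset) auto
    qed (auto simp: monoid_ring_def assoc l_one[simplified] r_one[simplified])
  qed (auto simp: monoid_ring_def frag_extend_add frag_extend_fun_add)
qed

lemma monoid_opposite_monoid:
  assumes "monoid M"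
  shows "monoid (opposite_monoid M)"
proof -
  interpret monoid M by fact
  show ?thesis
    by (rule monoidI) (auto simp: opposite_monoid_def m_assoc)
qed

abbreviation enveloping_ring :: "('m, 'b) monoid_scheme \<Rightarrow> ('m \<times> 'm \<Rightarrow>\<^sub>0 int) ring" where
  "enveloping_ring M \<equiv> monoid_ring (M \<times>\<times> opposite_monoid M)"

text \<open>\<open>\<int>M\<close> as a left module over \<open>\<int>[M \<times> M\<^sup>o\<^sup>p]\<close>: the basis element \<open>(m, n)\<close> maps
  \<open>x\<close> to \<open>mxn\<close>. The fields \<^const>\<open>monoid.mult\<close> and \<^const>\<open>monoid.one\<close> of a
  module record carry no meaning.\<close>

definition regular_bimodule ::
    "('m, 'b) monoid_scheme \<Rightarrow> ('m \<times> 'm \<Rightarrow>\<^sub>0 int, 'm \<Rightarrow>\<^sub>0 int) module" where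
  "regular_bimodule M =
    \<lparr>carrier = carrier (monoid_ring M),
     mult = mult (monoid_ring M),
     one = one (monoid_ring M),
     zero = zero (monoid_ring M),
     add = add (monoid_ring M),
     smult = (\<lambda>c x. frag_extend (\<lambda>(m, n). frag_extend (\<lambda>y. frag_of (m \<otimes>\<^bsub>M\<^esub> y \<otimes>\<^bsub>M\<^esub> n)) x) c)\<rparr>"


section \<open>Left modules over a ring that need not be commutative\<close>

text \<open>The library locale \<open>module\<close> requires a commutative ring of scalars.\<close>

locale left_module = R?: ring R + M?: abelian_group M
    for R :: "('r, 'c) ring_scheme" (structure) and M :: "('r, 'm, 'd) module_scheme" (structure) +
  assumes smult_closed [simp, intro]:
      "a \<in> carrier R \<Longrightarrow> x \<in> carrier M \<Longrightarrow> a \<odot>\<^bsub>M\<^esub> x \<in> carrier M"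
    and smult_l_distr:
      "a \<in> carrier R \<Longrightarrow> b \<in> carrier R \<Longrightarrow> x \<in> carrier M \<Longrightarrow>
       (a \<oplus> b) \<odot>\<^bsub>M\<^esub> x = a \<odot>\<^bsub>M\<^esub> x \<oplus>\<^bsub>M\<^esub> b \<odot>\<^bsub>M\<^esub> x"
    and smult_r_distr:
      "a \<in> carrier R \<Longrightarrow> x \<in> carrier M \<Longrightarrow> y \<in> carrier M \<Longrightarrow>
       a \<odot>\<^bsub>M\<^esub> (x \<oplus>\<^bsub>M\<^esub> y) = a \<odot>\<^bsub>M\<^esub> x \<oplus>\<^bsub>M\<^esub> a \<odot>\<^bsub>M\<^esub> y"
    and smult_assoc1:
      "a \<in> carrier R \<Longrightarrow> b \<in> carrier R \<Longrightarrow> x \<in> carrier M \<Longrightarrow>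
       (a \<otimes> b) \<odot>\<^bsub>M\<^esub> x = a \<odot>\<^bsub>M\<^esub> (b \<odot>\<^bsub>M\<^esub> x)"
    and smult_one [simp]:
      "x \<in> carrier M \<Longrightarrow> \<one> \<odot>\<^bsub>M\<^esub> x = x"

lemma left_module_regular_bimodule:
  assumes "monoid M"
  shows "left_module (enveloping_ring M) (regular_bimodule M)"
proof -
  interpret monoid M by fact
  let ?E = "enveloping_ring M" and ?S = "carrier M \<times> carrier M"
  let ?s = "\<lambda>c x. frag_extend (\<lambda>(m, n). frag_extend (\<lambda>y. frag_of (m \<otimes>\<^bsub>M\<^esub> y \<otimes>\<^bsub>M\<^esub> n)) x) c"
  let ?m = "mult ?E"
  have carrE: "carrier ?E = {c. Poly_Mapping.keys c \<subseteq> ?S}"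
    by (simp add: monoid_ring_def opposite_monoid_def)
  have mE: "?m c d = frag_extend (\<lambda>(m, n). frag_extend (\<lambda>(m', n').
      frag_of (m \<otimes>\<^bsub>M\<^esub> m', n' \<otimes>\<^bsub>M\<^esub> n)) d) c" for c d
    by (simp add: monoid_ring_def opposite_monoid_def DirProd_def case_prod_unfold)
  have assoc: "?s (?m c d) x = ?s c (?s d x)"
    if c: "Poly_Mapping.keys c \<subseteq> ?S" and d: "Poly_Mapping.keys d \<subseteq> ?S"
      and x: "Poly_Mapping.keys x \<subseteq> carrier M" for c d x
    unfolding mE
  proof (rule frag_induction[OF c])
    fix p assume p: "p \<in> ?S"
    show "?s (frag_extend (\<lambda>(m, n). frag_extend (\<lambda>(m', n').
      frag_of (m \<otimes>\<^bsub>M\<^esub> m', n' \<otimes>\<^bsub>M\<^esub> n)) d) (frag_of p)) x = ?s (frag_of p) (?s d x)"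
    proof (rule frag_induction[OF d])
      fix q assume q: "q \<in> ?S"
      show "?s (frag_extend (\<lambda>(m, n). frag_extend (\<lambda>(m', n').
        frag_of (m \<otimes>\<^bsub>M\<^esub> m', n' \<otimes>\<^bsub>M\<^esub> n)) (frag_of q)) (frag_of p)) x
          = ?s (frag_of p) (?s (frag_of q) x)"
        by (rule frag_induction[OF x])
          (use p q in \<open>auto simp: frag_extend_diff m_assoc case_prod_unfold\<close>)
    qed (auto simp: frag_extend_diff case_prod_unfold)
  qed (auto simp: frag_extend_diff case_prod_unfold)
  have one: "?s (frag_of (\<one>\<^bsub>M\<^esub>, \<one>\<^bsub>M\<^esub>)) x = x" if "Poly_Mapping.keys x \<subseteq> carrier M" for x
    by (rule frag_induction[OF that]) (simp_all add: frag_extend_diff)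
  have closed: "Poly_Mapping.keys (?s c x) \<subseteq> carrier M"
    if "Poly_Mapping.keys c \<subseteq> ?S" "Poly_Mapping.keys x \<subseteq> carrier M" for c x
    using that unfolding case_prod_unfold
    by (intro keys_frag_extend_subset) (auto 0 4 dest: subsetD)
  show ?thesis
  proof (intro left_module.intro left_module_axioms.intro)
    show "ring ?E"
      by (intro ring_monoid_ring DirProd_monoid monoid_opposite_monoid assms)
    show "abelian_group (regular_bimodule M)"
      by (rule abelian_group_fragments[where S = "carrier M"])
        (auto simp: regular_bimodule_def monoid_ring_def)
  next
    fix a b x
    assume "a \<in> carrier ?E" "b \<in> carrier ?E" "x \<in> carrier (regular_bimodule M)"
    then show "(a \<otimes>\<^bsub>?E\<^esub> b) \<odot>\<^bsub>regular_bimodule M\<^esub> x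
        = a \<odot>\<^bsub>regular_bimodule M\<^esub> (b \<odot>\<^bsub>regular_bimodule M\<^esub> x)"
      unfolding carrE using assoc[of a b x] by (simp add: regular_bimodule_def monoid_ring_def)
  next
    fix a x
    assume "a \<in> carrier ?E" "x \<in> carrier (regular_bimodule M)"
    then show "a \<odot>\<^bsub>regular_bimodule M\<^esub> x \<in> carrier (regular_bimodule M)"
      unfolding carrE using closed[of a x] by (simp add: regular_bimodule_def monoid_ring_def)
  next
    fix x
    assume "x \<in> carrier (regular_bimodule M)"
    then show "\<one>\<^bsub>?E\<^esub> \<odot>\<^bsub>regular_bimodule M\<^esub> x = x"
      using one[of x] by (simp add: regular_bimodule_def monoid_ring_def opposite_monoid_def DirProd_def)
  qed (simp_all add: regular_bimodule_def monoid_ring_def frag_extend_add frag_extend_fun_add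
      case_prod_unfold)
qed

definition left_module_hom ::
    "('r, 'c) ring_scheme \<Rightarrow> ('r, 'm, 'd) module_scheme \<Rightarrow> ('r, 'n, 'e) module_scheme
      \<Rightarrow> ('m \<Rightarrow> 'n) set" where
  "left_module_hom R M N = {f \<in> carrier M \<rightarrow> carrier N.
     (\<forall>x\<in>carrier M. \<forall>y\<in>carrier M. f (x \<oplus>\<^bsub>M\<^esub> y) = f x \<oplus>\<^bsub>N\<^esub> f y) \<and>
     (\<forall>a\<in>carrier R. \<forall>x\<in>carrier M. f (a \<odot>\<^bsub>M\<^esub> x) = a \<odot>\<^bsub>N\<^esub> f x)}"

definition finitely_generated_module ::
    "('r, 'c) ring_scheme \<Rightarrow> ('r, 'm, 'd) module_scheme \<Rightarrow> bool" where
  "finitely_generated_module R M \<longleftrightarrow> left_module R M \<and>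
     (\<exists>S. finite S \<and> S \<subseteq> carrier M \<and>
       (\<forall>x\<in>carrier M. \<exists>c\<in>S \<rightarrow> carrier R. x = (\<Oplus>\<^bsub>M\<^esub>s\<in>S. c s \<odot>\<^bsub>M\<^esub> s)))"

text \<open>The lifting property is tested on surjections \<open>B \<rightarrow> C\<close> with \<open>B\<close> carried by
  \<^typ>\<open>'p \<Rightarrow> 'r\<close> and \<open>C\<close> by \<^typ>\<open>'p\<close>. These types suffice, because they
  accommodate the canonical free cover of \<open>P\<close>: lemma \<open>projective_module_lifting\<close> below derives
  the lifting property for surjections between modules of arbitrary types.\<close>

definition projective_module ::
    "('r, 'c) ring_scheme \<Rightarrow> ('r, 'p) module \<Rightarrow> bool" where
  "projective_module R P \<longleftrightarrow> left_module R P \<and>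
     (\<forall>(B :: ('r, 'p \<Rightarrow> 'r) module) (C :: ('r, 'p) module) g h.
        left_module R B \<longrightarrow> left_module R C \<longrightarrow>
        g \<in> left_module_hom R B C \<longrightarrow> g ` carrier B = carrier C \<longrightarrow> h \<in> left_module_hom R P C \<longrightarrow>
        (\<exists>k\<in>left_module_hom R P B. \<forall>x\<in>carrier P. g (k x) = h x))"

definition free_module :: "('r, 'c) ring_scheme \<Rightarrow> 'x set \<Rightarrow> ('r, 'x \<Rightarrow> 'r) module" where
  "free_module R X =
    \<lparr>carrier = {f. (\<forall>x. f x \<in> carrier R) \<and> finite {x. f x \<noteq> \<zero>\<^bsub>R\<^esub>} \<and> {x. f x \<noteq> \<zero>\<^bsub>R\<^esub>} \<subseteq> X},
     mult = undefined,
     one = undefined,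
     zero = (\<lambda>_. \<zero>\<^bsub>R\<^esub>),
     add = (\<lambda>f g x. f x \<oplus>\<^bsub>R\<^esub> g x),
     smult = (\<lambda>a f x. a \<otimes>\<^bsub>R\<^esub> f x)\<rparr>"

lemma left_module_free_module:
  fixes R (structure)
  assumes "ring R"
  shows "left_module R (free_module R X)"
proof -
  interpret ring R by fact
  let ?F = "free_module R X"
  have closed: "f \<oplus>\<^bsub>?F\<^esub> g \<in> carrier ?F" if "f \<in> carrier ?F" "g \<in> carrier ?F" for f g
  proof -
    have "{x. f x \<oplus> g x \<noteq> \<zero>} \<subseteq> {x. f x \<noteq> \<zero>} \<union> {x. g x \<noteq> \<zero>}" by auto
    with that show ?thesis
      by (auto simp: free_module_def intro: finite_subset[OF _ finite_UnI])
  qed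
  have smult: "a \<odot>\<^bsub>?F\<^esub> f \<in> carrier ?F" if "a \<in> carrier R" "f \<in> carrier ?F" for a f
  proof -
    have "{x. a \<otimes> f x \<noteq> \<zero>} \<subseteq> {x. f x \<noteq> \<zero>}" using that by auto
    with that show ?thesis
      by (auto simp: free_module_def intro: finite_subset)
  qed
  have "abelian_group ?F"
  proof (rule abelian_groupI)
    show "\<exists>y\<in>carrier ?F. y \<oplus>\<^bsub>?F\<^esub> f = \<zero>\<^bsub>?F\<^esub>" if "f \<in> carrier ?F" for f
    proof (rule bexI)
      show "((\<ominus> \<one>) \<odot>\<^bsub>?F\<^esub> f) \<oplus>\<^bsub>?F\<^esub> f = \<zero>\<^bsub>?F\<^esub>"
        using that by (auto simp: free_module_def l_minus l_neg)
      show "(\<ominus> \<one>) \<odot>\<^bsub>?F\<^esub> f \<in> carrier ?F"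
        using that by (intro smult) auto
    qed
  qed (use closed in \<open>auto simp: free_module_def a_ac\<close>)
  with smult show ?thesis
    by (intro left_module.intro left_module_axioms.intro assms)
      (auto simp: free_module_def l_distr r_distr m_assoc)
qed

context left_module
begin

lemma smult_l_null: "x \<in> carrier M \<Longrightarrow> \<zero> \<odot>\<^bsub>M\<^esub> x = \<zero>\<^bsub>M\<^esub>"
  using smult_l_distr[of \<zero> \<zero> x] by (simp add: M.add.l_cancel_one)

lemma smult_r_null: "a \<in> carrier R \<Longrightarrow> a \<odot>\<^bsub>M\<^esub> \<zero>\<^bsub>M\<^esub> = \<zero>\<^bsub>M\<^esub>"
  using smult_r_distr[of a "\<zero>\<^bsub>M\<^esub>" "\<zero>\<^bsub>M\<^esub>"] by (simp add: M.add.l_cancel_one)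

lemma finsum_smult:
  assumes "finite S" "a \<in> carrier R" "f \<in> S \<rightarrow> carrier M"
  shows "(\<Oplus>\<^bsub>M\<^esub>x\<in>S. a \<odot>\<^bsub>M\<^esub> f x) = a \<odot>\<^bsub>M\<^esub> (\<Oplus>\<^bsub>M\<^esub>x\<in>S. f x)"
  using assms by (induction S) (auto simp: smult_r_null smult_r_distr Pi_def M.finsum_closed)

definition extension :: "('x \<Rightarrow> 'm) \<Rightarrow> ('x \<Rightarrow> 'r) \<Rightarrow> 'm" where
  "extension b f = (\<Oplus>\<^bsub>M\<^esub>x\<in>{x. f x \<noteq> \<zero>}. f x \<odot>\<^bsub>M\<^esub> b x)"

lemma extension_eq:
  assumes "f \<in> carrier (free_module R X)" "b \<in> X \<rightarrow> carrier M"
    and "finite S" "{x. f x \<noteq> \<zero>} \<subseteq> S" "S \<subseteq> X"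
  shows "extension b f = (\<Oplus>\<^bsub>M\<^esub>x\<in>S. f x \<odot>\<^bsub>M\<^esub> b x)"
  unfolding extension_def
  by (rule M.add.finprod_mono_neutral_cong_left)
    (use assms in \<open>auto simp: free_module_def smult_l_null Pi_def subset_iff\<close>)

lemma extension_hom:
  assumes "b \<in> X \<rightarrow> carrier M"
  shows "extension b \<in> left_module_hom R (free_module R X) M"
proof -
  let ?F = "free_module R X"
  interpret F: left_module R ?F by (rule left_module_free_module) (rule R.ring_axioms)
  have F: "\<And>x. f x \<in> carrier R" "finite {x. f x \<noteq> \<zero>}" "{x. f x \<noteq> \<zero>} \<subseteq> X"
    if "f \<in> carrier ?F" for f using that by (auto simp: free_module_def)
  have term_closed: "(\<lambda>x. f x \<odot>\<^bsub>M\<^esub> b x) \<in> S \<rightarrow> carrier M" if "f \<in> carrier ?F" "S \<subseteq> X" for f S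
    using F(1)[OF that(1)] that(2) assms by auto
  have add: "extension b (f \<oplus>\<^bsub>?F\<^esub> g) = extension b f \<oplus>\<^bsub>M\<^esub> extension b g"
    if f: "f \<in> carrier ?F" and g: "g \<in> carrier ?F" for f g
  proof -
    let ?S = "{x. f x \<noteq> \<zero>} \<union> {x. g x \<noteq> \<zero>}"
    have S: "finite ?S" "?S \<subseteq> X" using F f g by auto
    have fg: "(f \<oplus>\<^bsub>?F\<^esub> g) x = f x \<oplus> g x" for x by (simp add: free_module_def)
    have "extension b (f \<oplus>\<^bsub>?F\<^esub> g) = (\<Oplus>\<^bsub>M\<^esub>x\<in>?S. (f \<oplus>\<^bsub>?F\<^esub> g) x \<odot>\<^bsub>M\<^esub> b x)"
      by (rule extension_eq[OF F.M.a_closed[OF f g] assms S(1) _ S(2)]) (auto simp: fg)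
    also have "\<dots> = (\<Oplus>\<^bsub>M\<^esub>x\<in>?S. f x \<odot>\<^bsub>M\<^esub> b x \<oplus>\<^bsub>M\<^esub> g x \<odot>\<^bsub>M\<^esub> b x)"
    proof (rule M.finsum_cong'[OF HOL.refl])
      show "(\<lambda>x. f x \<odot>\<^bsub>M\<^esub> b x \<oplus>\<^bsub>M\<^esub> g x \<odot>\<^bsub>M\<^esub> b x) \<in> ?S \<rightarrow> carrier M"
        using term_closed[OF f S(2)] term_closed[OF g S(2)] by blast
      show "(f \<oplus>\<^bsub>?F\<^esub> g) x \<odot>\<^bsub>M\<^esub> b x = f x \<odot>\<^bsub>M\<^esub> b x \<oplus>\<^bsub>M\<^esub> g x \<odot>\<^bsub>M\<^esub> b x" if "x \<in> ?S" for x
        unfolding fg using that S(2) assms F(1)[OF f] F(1)[OF g] by (intro smult_l_distr) blast+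
    qed
    also have "\<dots> = (\<Oplus>\<^bsub>M\<^esub>x\<in>?S. f x \<odot>\<^bsub>M\<^esub> b x) \<oplus>\<^bsub>M\<^esub> (\<Oplus>\<^bsub>M\<^esub>x\<in>?S. g x \<odot>\<^bsub>M\<^esub> b x)"
      by (rule M.finsum_addf[OF term_closed[OF f S(2)] term_closed[OF g S(2)]])
    also have "\<dots> = extension b f \<oplus>\<^bsub>M\<^esub> extension b g"
      using extension_eq[OF f assms S(1) _ S(2)] extension_eq[OF g assms S(1) _ S(2)] by simp
    finally show ?thesis .
  qed
  have smult: "extension b (a \<odot>\<^bsub>?F\<^esub> f) = a \<odot>\<^bsub>M\<^esub> extension b f"
    if a: "a \<in> carrier R" and f: "f \<in> carrier ?F" for a f
  proof -
    let ?S = "{x. f x \<noteq> \<zero>}"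
    have S: "finite ?S" "?S \<subseteq> X" using F f by auto
    have af: "(a \<odot>\<^bsub>?F\<^esub> f) x = a \<otimes> f x" for x by (simp add: free_module_def)
    have "extension b (a \<odot>\<^bsub>?F\<^esub> f) = (\<Oplus>\<^bsub>M\<^esub>x\<in>?S. (a \<odot>\<^bsub>?F\<^esub> f) x \<odot>\<^bsub>M\<^esub> b x)"
      by (rule extension_eq[OF F.smult_closed[OF a f] assms S(1) _ S(2)]) (use a in \<open>auto simp: af\<close>)
    also have "\<dots> = (\<Oplus>\<^bsub>M\<^esub>x\<in>?S. a \<odot>\<^bsub>M\<^esub> (f x \<odot>\<^bsub>M\<^esub> b x))"
    proof (rule M.finsum_cong'[OF HOL.refl])
      show "(\<lambda>x. a \<odot>\<^bsub>M\<^esub> (f x \<odot>\<^bsub>M\<^esub> b x)) \<in> ?S \<rightarrow> carrier M"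
        using term_closed[OF f S(2)] a by blast
      show "(a \<odot>\<^bsub>?F\<^esub> f) x \<odot>\<^bsub>M\<^esub> b x = a \<odot>\<^bsub>M\<^esub> (f x \<odot>\<^bsub>M\<^esub> b x)" if "x \<in> ?S" for x
        unfolding af using that S(2) assms F(1)[OF f] a by (intro smult_assoc1) blast+
    qed
    also have "\<dots> = a \<odot>\<^bsub>M\<^esub> extension b f"
      unfolding extension_def by (rule finsum_smult[OF S(1) a term_closed[OF f S(2)]])
    finally show ?thesis .
  qed
  have "extension b f \<in> carrier M" if "f \<in> carrier ?F" for f
    unfolding extension_def using term_closed[OF that F(3)[OF that]] by (rule M.finsum_closed)
  with add smult show ?thesis by (auto simp: left_module_hom_def)
qed

lemma extension_basis:
  assumes "x \<in> X" "b \<in> X \<rightarrow> carrier M"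
  shows "extension b (\<lambda>y. if y = x then \<one> else \<zero>) = b x"
proof -
  have "extension b (\<lambda>y. if y = x then \<one> else \<zero>)
      = (\<Oplus>\<^bsub>M\<^esub>y\<in>{x}. (if y = x then \<one> else \<zero>) \<odot>\<^bsub>M\<^esub> b y)"
    using assms by (intro extension_eq[of _ X]) (auto simp: free_module_def)
  also have "\<dots> = b x"
    using assms by (auto simp: Pi_def)
  finally show ?thesis .
qed

lemma hom_zero:
  assumes "left_module R N" "h \<in> left_module_hom R M N"
  shows "h \<zero>\<^bsub>M\<^esub> = \<zero>\<^bsub>N\<^esub>"
proof -
  interpret N: left_module R N by fact
  have "h (\<zero> \<odot>\<^bsub>M\<^esub> \<zero>\<^bsub>M\<^esub>) = \<zero> \<odot>\<^bsub>N\<^esub> h \<zero>\<^bsub>M\<^esub>" "h \<zero>\<^bsub>M\<^esub> \<in> carrier N"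
    using assms(2) by (auto simp: left_module_hom_def)
  then show ?thesis by (simp add: smult_l_null N.smult_l_null)
qed

lemma hom_finsum:
  assumes "left_module R N" "h \<in> left_module_hom R M N" "finite S" "f \<in> S \<rightarrow> carrier M"
  shows "h (\<Oplus>\<^bsub>M\<^esub>x\<in>S. f x) = (\<Oplus>\<^bsub>N\<^esub>x\<in>S. h (f x))"
proof -
  interpret N: left_module R N by fact
  have "h \<in> carrier M \<rightarrow> carrier N" "\<And>x y. x \<in> carrier M \<Longrightarrow> y \<in> carrier M \<Longrightarrow> h (x \<oplus>\<^bsub>M\<^esub> y) = h x \<oplus>\<^bsub>N\<^esub> h y"
    using assms(2) by (auto simp: left_module_hom_def)
  with assms(3,4) show ?thesis
    by (induction rule: finite_induct) (auto simp: hom_zero[OF assms(1,2)] Pi_def)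
qed

lemma hom_extension:
  assumes "left_module R N" "h \<in> left_module_hom R M N" "b \<in> X \<rightarrow> carrier M"
    and f: "f \<in> carrier (free_module R X)"
  shows "h (extension b f) = left_module.extension R N (\<lambda>x. h (b x)) f"
proof -
  interpret N: left_module R N by fact
  let ?S = "{x. f x \<noteq> \<zero>}"
  have S: "finite ?S" "?S \<subseteq> X" and fR: "\<And>x. f x \<in> carrier R"
    using f by (auto simp: free_module_def)
  have h: "h \<in> carrier M \<rightarrow> carrier N"
      "\<And>a x. a \<in> carrier R \<Longrightarrow> x \<in> carrier M \<Longrightarrow> h (a \<odot>\<^bsub>M\<^esub> x) = a \<odot>\<^bsub>N\<^esub> h x"
    using assms(2) by (auto simp: left_module_hom_def)
  have b: "b x \<in> carrier M" if "x \<in> ?S" for x using that S(2) assms(3) by blast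
  have "h (extension b f) = (\<Oplus>\<^bsub>N\<^esub>x\<in>?S. h (f x \<odot>\<^bsub>M\<^esub> b x))"
    unfolding extension_def by (rule hom_finsum[OF assms(1,2) S(1)]) (use b fR in blast)
  also have "\<dots> = (\<Oplus>\<^bsub>N\<^esub>x\<in>?S. f x \<odot>\<^bsub>N\<^esub> h (b x))"
    by (rule N.M.finsum_cong'[OF HOL.refl]) (use b fR h in \<open>blast+\<close>)
  finally show ?thesis by (simp add: N.extension_def)
qed

end

lemma left_module_hom_compose:
  "f \<in> left_module_hom R L M \<Longrightarrow> g \<in> left_module_hom R M N \<Longrightarrow> (\<lambda>x. g (f x)) \<in> left_module_hom R L N"
  by (auto simp: left_module_hom_def Pi_def)

lemma projective_module_lifting:
  assumes "projective_module R P" and B: "left_module R B" and C: "left_module R C"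
    and g: "g \<in> left_module_hom R B C" "g ` carrier B = carrier C" and h: "h \<in> left_module_hom R P C"
  obtains k where "k \<in> left_module_hom R P B" "\<And>x. x \<in> carrier P \<Longrightarrow> g (k x) = h x"
proof -
  interpret P: left_module R P using assms(1) by (simp add: projective_module_def)
  interpret B: left_module R B by fact
  interpret C: left_module R C by fact
  let ?X = "carrier P" and ?F = "free_module R (carrier P)"
  have F: "left_module R ?F" by (rule left_module_free_module) (rule P.R.ring_axioms)
  have id: "(\<lambda>x. x) \<in> ?X \<rightarrow> carrier P" "(\<lambda>x. x) \<in> left_module_hom R P P" by (auto simp: left_module_hom_def)
  let ?p = "P.extension (\<lambda>x. x)"
  have p: "?p \<in> left_module_hom R ?F P" by (rule P.extension_hom[OF id(1)])
  have "?p ` carrier ?F = carrier P"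
  proof
    show "?p ` carrier ?F \<subseteq> carrier P" using p by (auto simp: left_module_hom_def)
    show "carrier P \<subseteq> ?p ` carrier ?F"
    proof
      fix x assume x: "x \<in> carrier P"
      have "(\<lambda>y. if y = x then \<one>\<^bsub>R\<^esub> else \<zero>\<^bsub>R\<^esub>) \<in> carrier ?F"
        using x by (auto simp: free_module_def)
      then show "x \<in> ?p ` carrier ?F"
        using P.extension_basis[OF x id(1)] by (metis imageI)
    qed
  qed
  with assms(1) F p id(2) P.left_module_axioms obtain s
    where s: "s \<in> left_module_hom R P ?F" "\<And>x. x \<in> carrier P \<Longrightarrow> ?p (s x) = x"
    unfolding projective_module_def by meson
  have "\<forall>x\<in>?X. \<exists>y\<in>carrier B. g y = h x"
    using g(2) h by (auto simp: left_module_hom_def Pi_def image_iff set_eq_iff) metis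
  then obtain b where b: "b \<in> ?X \<rightarrow> carrier B" "\<And>x. x \<in> ?X \<Longrightarrow> g (b x) = h x"
    using bchoice[of ?X "\<lambda>x y. y \<in> carrier B \<and> g y = h x"] by (metis Pi_I)
  show thesis
  proof
    show "(\<lambda>x. B.extension b (s x)) \<in> left_module_hom R P B"
      by (rule left_module_hom_compose[OF s(1) B.extension_hom[OF b(1)]])
    fix x assume x: "x \<in> carrier P"
    then have sx: "s x \<in> carrier ?F" using s(1) by (auto simp: left_module_hom_def)
    then have supp: "y \<in> ?X" "s x y \<in> carrier R" if "s x y \<noteq> \<zero>\<^bsub>R\<^esub>" for y
      using that by (auto simp: free_module_def)
    have hX: "h y \<in> carrier C" if "y \<in> ?X" for y using h that by (auto simp: left_module_hom_def)
    have "g (B.extension b (s x)) = C.extension (\<lambda>x. g (b x)) (s x)"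
      by (rule B.hom_extension[OF C g(1) b(1) sx])
    also have "\<dots> = C.extension h (s x)"
      unfolding C.extension_def
      by (rule C.M.finsum_cong'[OF HOL.refl]) (use supp hX b(2) in auto)
    also have "\<dots> = h (?p (s x))"
      by (rule P.hom_extension[OF C h id(1) sx, symmetric])
    also have "\<dots> = h x" using s(2)[OF x] by simp
    finally show "g (B.extension b (s x)) = h x" .
  qed
qed


section \<open>Resolutions and finiteness conditions\<close>

text \<open>The complex \<open>\<dots> \<rightarrow> P 2 \<rightarrow> P 1 \<rightarrow> P 0 \<rightarrow> M \<rightarrow> 0\<close> with \<open>d n : P (n + 1) \<rightarrow> P n\<close> and
  augmentation \<open>e : P 0 \<rightarrow> M\<close>.\<close>

definition projective_resolution ::
    "('r, 'c) ring_scheme \<Rightarrow> ('r, 'm, 'd) module_scheme \<Rightarrow> (nat \<Rightarrow> ('r, 'u) module)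
      \<Rightarrow> (nat \<Rightarrow> 'u \<Rightarrow> 'u) \<Rightarrow> ('u \<Rightarrow> 'm) \<Rightarrow> bool" where
  "projective_resolution R M P d e \<longleftrightarrow>
     left_module R M \<and>
     (\<forall>n. projective_module R (P n)) \<and>
     (\<forall>n. d n \<in> left_module_hom R (P (Suc n)) (P n)) \<and>
     e \<in> left_module_hom R (P 0) M \<and>
     e ` carrier (P 0) = carrier M \<and>
     d 0 ` carrier (P 1) = {x \<in> carrier (P 0). e x = \<zero>\<^bsub>M\<^esub>} \<and>
     (\<forall>n. d (Suc n) ` carrier (P (Suc (Suc n))) =
        {x \<in> carrier (P (Suc n)). d n x = \<zero>\<^bsub>P n\<^esub>})"

text \<open>HOL cannot quantify over types inside a definition, so the notions below take as an extra
  argument the type \<^typ>\<open>'u\<close> in which the carriers of the modules of a resolution live. They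
  agree with the usual notions as soon as \<^typ>\<open>'u\<close> is infinite and at least as large as the
  ring and the module (standard free resolutions then fit into \<^typ>\<open>'u\<close>, and so do their
  truncations). For a countable monoid every infinite \<^typ>\<open>'u\<close> is large enough.\<close>

definition FP_infinity ::
    "'u itself \<Rightarrow> ('r, 'c) ring_scheme \<Rightarrow> ('r, 'm, 'd) module_scheme \<Rightarrow> bool" where
  "FP_infinity U R M \<longleftrightarrow>
     (\<exists>(P :: nat \<Rightarrow> ('r, 'u) module) d e. projective_resolution R M P d e \<and>
        (\<forall>n. finitely_generated_module R (P n)))"

text \<open>The infimum over the empty set is \<^term>\<open>\<infinity> :: enat\<close>.\<close>

definition projective_dimension ::
    "'u itself \<Rightarrow> ('r, 'c) ring_scheme \<Rightarrow> ('r, 'm, 'd) module_scheme \<Rightarrow> enat" where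
  "projective_dimension U R M =
     Inf {enat n |n. \<exists>(P :: nat \<Rightarrow> ('r, 'u) module) d e. projective_resolution R M P d e \<and>
        (\<forall>k>n. carrier (P k) = {\<zero>\<^bsub>P k\<^esub>})}"

definition bi_FP_infinity :: "'u itself \<Rightarrow> ('m, 'b) monoid_scheme \<Rightarrow> bool" where
  "bi_FP_infinity U M \<longleftrightarrow> FP_infinity U (enveloping_ring M) (regular_bimodule M)"

definition hochschild_dimension :: "'u itself \<Rightarrow> ('m, 'b) monoid_scheme \<Rightarrow> enat" where
  "hochschild_dimension U M = projective_dimension U (enveloping_ring M) (regular_bimodule M)"

end

theory Submission
  imports Defs "HOL-Library.Countable_Set"
begin

text \<open>The bimodule complex with one generator for the vertex, one for each letter and one for the
  relator is exact up to the kernel of the differential \<open>e \<mapsto> \<Sum> u[a]v\<close> (sum over \<open>r = uav\<close>), for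
  every presentation. Write \<open>r = s\<^sup>m\<close> with \<open>s\<close> primitive; then \<open>s\<close> is a unit of order dividing \<open>m\<close>, and this
  differential is the composite of the norm of the cyclic group \<open>\<langle>s\<rangle>\<close>, acting by
  \<open>(p, q) \<mapsto> (p s, s\<^sup>-\<^sup>1 q)\<close>, with the derivative \<open>\<kappa>\<close> of \<open>s\<close>. If \<open>\<kappa>\<close> is injective and the action is free, the
  usual periodic resolution of the cyclic group continues the complex, and stops at once if \<open>m = 1\<close>.

  Both facts follow from a right-invariant order on words in which \<open>s\<close> is trivial and distinct occurrences
  of a letter in \<open>s\<close> have inequivalent prefixes: leading terms then cannot cancel. Such an order is found by
  refinement. Given an order in which two occurrences collide, let \<open>H\<close> be the quotient of the words by the
  associated congruence and extend it by the torsion-free quotient of the relation module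
  \<open>\<rat>H\<^sup>A / \<rat>H D\<close>, where \<open>D\<close> is the vector of Fox derivatives of \<open>s\<close>. Because \<open>s\<close> is a positive word, an element of
  \<open>\<rat>H D\<close> supported within \<open>D\<close> is a scalar multiple of \<open>D\<close>; so if this does not separate the closest colliding
  pair, the subword between its members has letter counts proportional to those of \<open>s\<close>, and \<open>s\<close> is a proper
  power.\<close>

section \<open>Orders on words\<close>

text \<open>For \<open>m \<ge> 2\<close> the monoid itself admits no right-invariant total order:
  such an order forces elements of finite order to be trivial, and \<open>s\<close> has finite
  order. The order therefore lives on the quotient \<open>H\<close>, in which \<open>s\<close>
  disappears, and it is asked for very little: to tell at which position inside \<open>s\<close> a
  leading term arises. The outer coefficients are then recovered in the monoid itself, where
  prefixes of \<open>s\<close> cancel on the right and suffixes on the left because \<open>s\<close>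
  is a unit. What \<open>H\<close> forgets about powers of \<open>s\<close>, and what freeness of
  the action needs, is supplied by the Fox derivative modulo \<open>m\<close>: it is well defined on
  the monoid because the relator has derivative \<open>m\<close> times that of \<open>s\<close>.

  Invariance is available on the right only. The cone that orders the torsion-free quotient comes
  from Zorn's lemma and need not be stable under left translation. Every leading-term argument
  therefore compares words only after their left factors have been attached, and then cancels common
  right factors.\<close>

lemma lookup_frag_extend:
  "Poly_Mapping.lookup (frag_extend f c) x =
    (\<Sum>i\<in>Poly_Mapping.keys c. Poly_Mapping.lookup c i * Poly_Mapping.lookup (f i) x)"
  by (simp add: frag_extend_def Poly_Mapping.lookup_sum)

lemma frag_extend_comp:
  "frag_extend f (frag_extend g c) = frag_extend (\<lambda>x. frag_extend f (g x)) c"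
proof -
  have "Poly_Mapping.keys c \<subseteq> UNIV" by simp
  then show ?thesis
    by (induction c rule: frag_induction) (auto simp: frag_extend_diff)
qed

text \<open>Right invariance is an equivalence, so the quotient by \<open>equal\<close> is right
  cancellative. On the left only the equivalence, not the order, has to be preserved; this makes the
  quotient a monoid.\<close>

locale word_order =
  fixes s :: "'a list" and le :: "'a list \<Rightarrow> 'a list \<Rightarrow> bool"
  assumes total: "le u v \<or> le v u"
    and trans: "le u v \<Longrightarrow> le v w \<Longrightarrow> le u w"
    and right_iff: "le (u @ w) (v @ w) \<longleftrightarrow> le u v"
    and left_cong: "le u v \<Longrightarrow> le v u \<Longrightarrow> le (w @ u) (w @ v)"
    and root: "le s []" "le [] s"
begin

definition equal :: "'a list \<Rightarrow> 'a list \<Rightarrow> bool" where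
  "equal u v \<longleftrightarrow> le u v \<and> le v u"

text \<open>Classes are encoded by chosen words, so that pairs of a letter and a representative form
  an integral basis for the Fox derivatives.\<close>

definition rep :: "'a list \<Rightarrow> 'a list" where
  "rep w = (SOME u. equal u w)"

lemma equal_refl [simp]: "equal u u"
  using total by (auto simp: equal_def)

lemma equal_sym: "equal u v \<Longrightarrow> equal v u"
  by (auto simp: equal_def)

lemma equal_trans: "equal u v \<Longrightarrow> equal v w \<Longrightarrow> equal u w"
  using trans by (auto simp: equal_def)

lemma equal_append: "equal u u' \<Longrightarrow> equal v v' \<Longrightarrow> equal (u @ v) (u' @ v')"
  using equal_trans[of "u @ v" "u' @ v" "u' @ v'"] by (auto simp: equal_def right_iff left_cong)

lemma equal_append_right_iff: "equal (u @ w) (v @ w) \<longleftrightarrow> equal u v"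
  by (auto simp: equal_def right_iff)

lemma equal_root: "equal s []"
  using root by (simp add: equal_def)

lemma equal_rep: "equal (rep w) w"
  unfolding rep_def by (rule someI[of _ w]) simp

lemma rep_eq_iff: "rep u = rep v \<longleftrightarrow> equal u v"
proof
  show "rep u = rep v \<Longrightarrow> equal u v"
    using equal_rep[of u] equal_rep[of v] equal_sym equal_trans by metis
  assume "equal u v"
  then have "equal x u = equal x v" for x
    using equal_sym equal_trans by blast
  then show "rep u = rep v" by (simp add: rep_def)
qed

lemma rep_append_rep: "rep (g @ rep u) = rep (g @ u)"
  by (simp add: rep_eq_iff equal_append equal_rep)

lemma rep_rep [simp]: "rep (rep u) = rep u"
  using equal_rep by (simp add: rep_eq_iff)

text \<open>The translate by \<open>g\<close> of the Fox derivative of \<open>w\<close>, all partial derivatives at once.\<close>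

primrec fox :: "'a list \<Rightarrow> 'a list \<Rightarrow> ('a \<times> 'a list) \<Rightarrow>\<^sub>0 int" where
  "fox g [] = 0"
| "fox g (b # w) = frag_of (b, rep g) + fox (g @ [b]) w"

lemma fox_append: "fox g (u @ v) = fox g u + fox (g @ u) v"
  by (induction u arbitrary: g) (auto simp: add.assoc)

lemma fox_cong: "equal g h \<Longrightarrow> fox g w = fox h w"
proof (induction w arbitrary: g h)
  case (Cons b w)
  then have "equal (g @ [b]) (h @ [b])" by (simp add: equal_append)
  moreover have "rep g = rep h" using Cons.prems by (simp add: rep_eq_iff)
  ultimately show ?case using Cons.IH by simp
qed simp

lemma fox_rep: "fox (rep g) w = fox g w"
  by (rule fox_cong[OF equal_rep])

text \<open>Since \<open>s\<close> is trivial modulo \<open>equal\<close>, every copy of it starts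
  at the same class and contributes the same derivative.\<close>

lemma fox_power: "fox g (concat (replicate m s)) = frag_cmul (int m) (fox g s)"
proof (induction m arbitrary: g)
  case (Suc m)
  have "fox (g @ s) w = fox g w" for w
    by (rule fox_cong) (use equal_append[OF equal_refl equal_root, of g] in simp)
  with Suc show ?case
    by (simp add: fox_append frag_cmul_distrib)
qed simp

text \<open>No inverse letters occur, so terms of the derivative never cancel and its coefficients
  are plain counts of positions.\<close>

lemma lookup_fox:
  "Poly_Mapping.lookup (fox g w) (b, u) = int (card {i. i < length w \<and> w ! i = b \<and> rep (g @ take i w) = u})"
proof (induction w arbitrary: g)
  case (Cons a w)
  let ?S = "{i. i < length w \<and> w ! i = b \<and> rep ((g @ [a]) @ take i w) = u}"
  let ?T = "{i. i < length (a # w) \<and> (a # w) ! i = b \<and> rep (g @ take i (a # w)) = u}"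
  have T: "?T = (if (a, rep g) = (b, u) then {0} else {}) \<union> Suc ` ?S" (is "_ = ?R")
  proof (rule Set.set_eqI)
    show "i \<in> ?T \<longleftrightarrow> i \<in> ?R" for i by (cases i) (simp_all, blast)
  qed
  have "card ?T = (if (a, rep g) = (b, u) then 1 else 0) + card ?S"
    unfolding T by (subst card_Un_disjoint) (auto simp: card_image)
  then show ?case unfolding fox.simps lookup_add Cons.IH by (simp only: lookup_frag_of) auto
qed simp

definition translate :: "'a list \<Rightarrow> ('a \<times> 'a list \<Rightarrow>\<^sub>0 int) \<Rightarrow> ('a \<times> 'a list \<Rightarrow>\<^sub>0 int)" where
  "translate g = frag_extend (\<lambda>(b, u). frag_of (b, rep (g @ u)))"

lemma translate_fox: "translate g (fox h w) = fox (g @ h) w"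
  by (induction w arbitrary: h) (auto simp: translate_def frag_extend_add rep_append_rep)

text \<open>The isolated (pure) closure of the left submodule generated by the derivative of
  \<open>s\<close>; dividing it out leaves a torsion-free group, hence one that can be
  ordered.\<close>

definition isolated :: "('a \<times> 'a list \<Rightarrow>\<^sub>0 int) set" where
  "isolated = {d. \<exists>k>0. \<exists>c. frag_cmul k d = frag_extend (\<lambda>g. fox g s) c}"

lemma isolated_zero: "0 \<in> isolated"
  unfolding isolated_def by (rule CollectI, rule exI[of _ 1], simp, rule exI[of _ 0], simp)

lemma isolated_add:
  assumes "x \<in> isolated" "y \<in> isolated"
  shows "x + y \<in> isolated"
proof -
  from assms obtain k l c d where k: "k > 0" "frag_cmul k x = frag_extend (\<lambda>g. fox g s) c"
    and l: "l > 0" "frag_cmul l y = frag_extend (\<lambda>g. fox g s) d"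
    by (auto simp: isolated_def)
  have "frag_cmul (k * l) (x + y) = frag_cmul l (frag_cmul k x) + frag_cmul k (frag_cmul l y)"
    by (simp add: frag_cmul_distrib2 mult.commute)
  also have "\<dots> = frag_extend (\<lambda>g. fox g s) (frag_cmul l c + frag_cmul k d)"
    by (simp add: k l frag_extend_add frag_extend_cmul)
  finally have "frag_cmul (k * l) (x + y) = frag_extend (\<lambda>g. fox g s) (frag_cmul l c + frag_cmul k d)" .
  moreover have "k * l > 0" using k l by simp
  ultimately show ?thesis unfolding isolated_def by blast
qed

lemma isolated_uminus: "x \<in> isolated \<Longrightarrow> - x \<in> isolated"
proof -
  assume "x \<in> isolated"
  then obtain k c where k: "k > 0" "frag_cmul k x = frag_extend (\<lambda>g. fox g s) c"
    by (auto simp: isolated_def)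
  have "frag_cmul k (- x) = - frag_cmul k x"
    by (intro poly_mapping_eqI) simp
  then have "frag_cmul k (- x) = frag_extend (\<lambda>g. fox g s) (- c)"
    by (simp only: k(2) frag_extend_minus)
  with k(1) show ?thesis by (auto simp: isolated_def)
qed

lemma isolated_divide:
  assumes "frag_cmul j x \<in> isolated" "j > 0"
  shows "x \<in> isolated"
proof -
  from assms(1) obtain k c where "k > 0" "frag_cmul k (frag_cmul j x) = frag_extend (\<lambda>g. fox g s) c"
    by (auto simp: isolated_def)
  with assms(2) have "k * j > 0" "frag_cmul (k * j) x = frag_extend (\<lambda>g. fox g s) c"
    by simp_all
  then show ?thesis unfolding isolated_def by blast
qed

text \<open>Stability under the left action is what makes the refined equivalence a left
  congruence.\<close>

lemma isolated_translate: "x \<in> isolated \<Longrightarrow> translate g x \<in> isolated"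
proof -
  assume "x \<in> isolated"
  then obtain k c where k: "k > 0" "frag_cmul k x = frag_extend (\<lambda>g. fox g s) c"
    by (auto simp: isolated_def)
  have "frag_cmul k (translate g x) = translate g (frag_extend (\<lambda>g. fox g s) c)"
    by (simp add: translate_def frag_extend_cmul flip: k(2))
  also have "\<dots> = frag_extend (\<lambda>h. translate g (fox h s)) c"
    by (simp add: translate_def frag_extend_comp)
  also have "\<dots> = frag_extend (\<lambda>h. fox h s) (frag_extend (\<lambda>h. frag_of (g @ h)) c)"
    by (simp add: translate_fox frag_extend_comp)
  finally show ?thesis using k(1) by (auto simp: isolated_def)
qed

lemma isolated_root: "fox [] s \<in> isolated"
  unfolding isolated_def
  by (rule CollectI, rule exI[of _ 1], simp, rule exI[of _ "frag_of []"], simp)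

end

section \<open>Ordering an abelian group modulo an isolated subgroup\<close>

lemma extend_to_cone:
  fixes T :: "('x \<Rightarrow>\<^sub>0 int) set"
  assumes zero: "0 \<in> T" and add: "\<And>x y. x \<in> T \<Longrightarrow> y \<in> T \<Longrightarrow> x + y \<in> T"
    and divide: "\<And>k x. frag_cmul k x \<in> T \<Longrightarrow> k > 0 \<Longrightarrow> x \<in> T"
    and uminus: "\<And>x. x \<in> T \<Longrightarrow> - x \<in> T"
  shows "\<exists>P. T \<subseteq> P \<and> (\<forall>x\<in>P. \<forall>y\<in>P. x + y \<in> P) \<and> (\<forall>x. x \<in> P \<or> - x \<in> P) \<and> (\<forall>x. x \<in> P \<longrightarrow> - x \<in> P \<longrightarrow> x \<in> T)"
proof -
  let ?C = "{P. T \<subseteq> P \<and> (\<forall>x\<in>P. \<forall>y\<in>P. x + y \<in> P) \<and> (\<forall>x. x \<in> P \<longrightarrow> - x \<in> P \<longrightarrow> x \<in> T)}"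
  \<comment> \<open>Totality is not imposed on the members of \<open>?C\<close>; it is derived from
    maximality among the cones that meet their negatives only within \<open>T\<close>.\<close>
  have "\<exists>P\<in>?C. \<forall>X\<in>?C. P \<subseteq> X \<longrightarrow> X = P"
  proof (rule subset_Zorn_nonempty)
    have "T \<in> ?C" using add by simp
    then show "?C \<noteq> {}" by blast
  next
    fix \<C> assume ne: "\<C> \<noteq> {}" and chain: "subset.chain ?C \<C>"
    then have C: "\<And>P. P \<in> \<C> \<Longrightarrow> P \<in> ?C" and tot: "\<And>P Q. P \<in> \<C> \<Longrightarrow> Q \<in> \<C> \<Longrightarrow> P \<subseteq> Q \<or> Q \<subseteq> P"
      by (auto simp: subset_chain_def)
    have two: "\<exists>P\<in>\<C>. x \<in> P \<and> y \<in> P" if "x \<in> \<Union>\<C>" "y \<in> \<Union>\<C>" for x y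
    proof -
      from that obtain P Q where "P \<in> \<C>" "x \<in> P" "Q \<in> \<C>" "y \<in> Q" by blast
      with tot[of P Q] show ?thesis by blast
    qed
    show "\<Union>\<C> \<in> ?C"
    proof (intro CollectI conjI ballI allI impI)
      show "T \<subseteq> \<Union>\<C>" using ne C by blast
      show "x + y \<in> \<Union>\<C>" if "x \<in> \<Union>\<C>" "y \<in> \<Union>\<C>" for x y
      proof -
        from two[OF that] obtain P where "P \<in> \<C>" "x \<in> P" "y \<in> P" by blast
        with C[of P] show ?thesis by blast
      qed
      show "x \<in> T" if "x \<in> \<Union>\<C>" "- x \<in> \<Union>\<C>" for x
      proof -
        from two[OF that] obtain P where "P \<in> \<C>" "x \<in> P" "- x \<in> P" by blast
        with C[of P] show ?thesis by blast
      qed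
    qed
  qed
  then obtain P where PC: "P \<in> ?C" and "\<forall>X\<in>?C. P \<subseteq> X \<longrightarrow> X = P" ..
  then have maxi: "X = P" if "X \<in> ?C" "P \<subseteq> X" for X using that by blast
  from PC have TP: "T \<subseteq> P" and Padd: "\<And>x y. x \<in> P \<Longrightarrow> y \<in> P \<Longrightarrow> x + y \<in> P"
    and PT: "\<And>x. x \<in> P \<Longrightarrow> - x \<in> P \<Longrightarrow> x \<in> T" by auto
  have P0: "0 \<in> P" using zero TP by blast
  have mult: "frag_cmul (int n) x \<in> P" if "x \<in> P" for n x
    by (induction n) (auto simp: frag_cmul_distrib P0 Padd that)
  have step: "\<exists>a>0. - frag_cmul a x \<in> P" if "x \<notin> P" for x
  proof (rule ccontr)
    assume neg: "\<not> ?thesis"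
    \<comment> \<open>If no negative multiple of \<open>x\<close> lies in \<open>P\<close>,
      adjoining the nonnegative multiples of \<open>x\<close> produces no new element together with
      its negative, against maximality.\<close>
    define Q where "Q = {p + frag_cmul (int n) x |p n. p \<in> P}"
    have PQ: "P \<subseteq> Q"
    proof
      fix p assume "p \<in> P"
      then show "p \<in> Q" unfolding Q_def by (intro CollectI exI[of _ p] exI[of _ 0]) simp
    qed
    have sum: "y + z \<in> Q" if "y \<in> Q" "z \<in> Q" for y z
    proof -
      from that obtain p i q j where "y = p + frag_cmul (int i) x" "z = q + frag_cmul (int j) x" "p \<in> P" "q \<in> P"
        unfolding Q_def by blast
      then show ?thesis
        unfolding Q_def by (intro CollectI exI[of _ "p + q"] exI[of _ "i + j"]) (simp add: Padd frag_cmul_distrib)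
    qed
    have pointed: "y \<in> T" if "y \<in> Q" "- y \<in> Q" for y
    proof -
      from that obtain p i q j where y: "y = p + frag_cmul (int i) x" "- y = q + frag_cmul (int j) x"
        and pq: "p \<in> P" "q \<in> P" unfolding Q_def by blast
      have "p + q + frag_cmul (int (i + j)) x = y + - y"
        unfolding y(2) unfolding y(1) by (simp add: frag_cmul_distrib ac_simps)
      then have "p + q + frag_cmul (int (i + j)) x = 0" by simp
      then have "- frag_cmul (int (i + j)) x = p + q"
        by (metis eq_neg_iff_add_eq_0)
      then have "- frag_cmul (int (i + j)) x \<in> P" using Padd[OF pq] by simp
      with neg have "\<not> int (i + j) > 0" by blast
      then have "i = 0" "j = 0" by simp_all
      with y have "y = p" "- y = q" by simp_all
      with pq show ?thesis using PT[of y] by simp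
    qed
    have "Q \<in> ?C"
      using subset_trans[OF TP PQ] sum pointed by simp
    from maxi[OF this PQ] have Q: "Q = P" .
    have "0 + frag_cmul (int 1) x \<in> Q" unfolding Q_def using P0 by blast
    then have "x \<in> P" unfolding Q by simp
    with that show False by simp
  qed
  have tot: "x \<in> P \<or> - x \<in> P" for x
  proof (rule ccontr)
    assume a: "\<not> ?thesis"
    then have nx: "x \<notin> P" "- x \<notin> P" by simp_all
    from step[OF nx(1)] obtain i where i: "i > 0" "- frag_cmul i x \<in> P" by (elim exE conjE)
    from step[OF nx(2)] obtain j where j: "j > 0" "- frag_cmul j (- x) \<in> P" by (elim exE conjE)
    note ij = i j
    \<comment> \<open>The common multiple \<open>i * j\<close> brings one multiple of
      \<open>x\<close> into \<open>P\<close> with both signs, hence into \<open>T\<close>;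
      divisibility of \<open>T\<close> then gives \<open>x\<close> itself.\<close>
    have "frag_cmul (int (nat j)) (- frag_cmul i x) = - frag_cmul (i * j) x"
      by (rule poly_mapping_eqI) (use ij in simp)
    with mult[OF ij(2), of "nat j"] have 1: "- frag_cmul (i * j) x \<in> P" by (simp only:)
    have "frag_cmul (int (nat i)) (- frag_cmul j (- x)) = frag_cmul (i * j) x"
      by (rule poly_mapping_eqI) (use ij in simp)
    with mult[OF ij(4), of "nat i"] have "frag_cmul (i * j) x \<in> P" by (simp only:)
    from PT[OF this 1] have "frag_cmul (i * j) x \<in> T" .
    then have "x \<in> T" using divide[of "i * j" x] ij by simp
    with a TP show False by blast
  qed
  show ?thesis using TP Padd tot PT by (intro exI[of _ P] conjI ballI allI impI)
qed

lemma finite_total_max: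
  assumes "finite K" "K \<noteq> {}" and "\<And>x y. R x y \<or> R y x" and "\<And>x y z. R x y \<Longrightarrow> R y z \<Longrightarrow> R x z"
  shows "\<exists>g\<in>K. \<forall>h\<in>K. R h g"
  using assms(1,2)
proof (induction K rule: finite_ne_induct)
  case (singleton x)
  then show ?case using assms(3)[of x x] by simp
next
  case (insert x F)
  then obtain g where g: "g \<in> F" "\<forall>h\<in>F. R h g" by blast
  show ?case
  proof (cases "R x g")
    case True
    with g show ?thesis by blast
  next
    case False
    then have "R g x" "R x x" using assms(3) by blast+
    then have "\<forall>h\<in>insert x F. R h x" using g assms(4) by blast
    then show ?thesis by blast
  qed
qed

section \<open>Combinatorics of periodic words\<close>

lemma concat_replicate_periodic:
  assumes "length s = k * p" "\<And>x. x + p < length s \<Longrightarrow> s ! (x + p) = s ! x"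
  shows "s = concat (replicate k (take p s))"
  using assms
proof (induction k arbitrary: s)
  case (Suc k)
  let ?t = "drop p s"
  show ?case
  proof (cases k)
    case 0
    with Suc.prems show ?thesis by simp
  next
    case (Suc k')
    have "?t = concat (replicate k (take p ?t))"
    proof (rule Suc.IH)
      show "length ?t = k * p" using Suc.prems by simp
      show "?t ! (x + p) = ?t ! x" if "x + p < length ?t" for x
        using Suc.prems(2)[of "x + p"] that by (simp add: add.commute add.left_commute)
    qed
    moreover have "take p ?t = take p s"
    proof (rule nth_equalityI)
      show "length (take p ?t) = length (take p s)" using Suc Suc.prems by simp
      show "take p ?t ! x = take p s ! x" if "x < length (take p ?t)" for x
      proof -
        have "x < p" "x + p < length s" using that by auto
        with Suc.prems(2)[of x] show ?thesis by (simp add: add.commute)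
      qed
    qed
    ultimately show ?thesis
      by (metis append_take_drop_id concat.simps(2) replicate_Suc)
  qed
qed simp

text \<open>A window no longer than the least distance between equal values has no repetition.
  Proportional counts then force every value of the sequence to occur in the window exactly once and
  in the whole sequence equally often, so the length of the window divides that of the
  sequence.\<close>

lemma periodic_of_proportional_window:
  fixes t :: "nat \<Rightarrow> 'c"
  assumes ij: "i < j" "j < n" "t i = t j"
    and min: "\<forall>x y. x < y \<longrightarrow> y < n \<longrightarrow> t x = t y \<longrightarrow> j - i \<le> y - x"
    and k: "(k :: int) > 0"
    and ratio: "\<And>y. k * int (card {x \<in> {i..<j}. t x = y}) = l * int (card {x \<in> {..<n}. t x = y})"
  shows "(j - i) dvd n" "\<And>x. x + (j - i) < n \<Longrightarrow> t (x + (j - i)) = t x"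
proof -
  define p where "p = j - i"
  have window: "inj_on t {a..<a + p}" if "a + p \<le> n" for a
  proof (rule inj_onI, rule ccontr)
    fix x y assume "x \<in> {a..<a + p}" "y \<in> {a..<a + p}" "t x = t y" "x \<noteq> y"
    then show False
      using min[rule_format, of x y] min[rule_format, of y x] that by (cases "x < y") (auto simp: p_def)
  qed
  have ip: "i + p = j" using ij by (simp add: p_def)
  have le1: "card {x \<in> {i..<j}. t x = y} \<le> 1" for y
  proof -
    have "inj_on t {x \<in> {i..<j}. t x = y}" using window[of i] ip ij by (auto simp: inj_on_def)
    moreover have "t ` {x \<in> {i..<j}. t x = y} \<subseteq> {y}" by auto
    ultimately have "card {x \<in> {i..<j}. t x = y} \<le> card {y}"
      by (rule card_inj_on_le) simp
    then show ?thesis by simp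
  qed
  have pos: "card {x \<in> X. t x = t x0} > 0" if "x0 \<in> X" "finite X" for x0 X
    using that by (auto simp: card_gt_0_iff)
  have i1: "card {x \<in> {i..<j}. t x = t i} = 1"
    using le1[of "t i"] pos[of i "{i..<j}"] ij by simp
  have l: "l > 0"
  proof -
    have "l * int (card {x \<in> {..<n}. t x = t i}) > 0"
      using ratio[of "t i"] i1 k by simp
    then show ?thesis by (simp add: zero_less_mult_iff)
  qed
  \<comment> \<open>As \<open>l\<close> is positive, each value occurring anywhere has a positive
    count in the window, and this count is at most one.\<close>
  have win1: "card {x \<in> {i..<j}. t x = t x0} = 1" "k = l * int (card {x \<in> {..<n}. t x = t x0})" if "x0 < n" for x0
  proof -
    have "k * int (card {x \<in> {i..<j}. t x = t x0}) > 0"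
      using ratio[of "t x0"] l pos[of x0 "{..<n}"] that by simp
    then have "card {x \<in> {i..<j}. t x = t x0} > 0" using k by (simp add: zero_less_mult_iff)
    with le1[of "t x0"] show "card {x \<in> {i..<j}. t x = t x0} = 1" by simp
    with ratio[of "t x0"] show "k = l * int (card {x \<in> {..<n}. t x = t x0})" by simp
  qed
  have img: "t ` {i..<j} = t ` {..<n}"
  proof
    show "t ` {i..<j} \<subseteq> t ` {..<n}" using ij by auto
    show "t ` {..<n} \<subseteq> t ` {i..<j}"
    proof
      fix y assume "y \<in> t ` {..<n}"
      then obtain x0 where x0: "x0 < n" "y = t x0" by auto
      with win1(1)[OF x0(1)] have "card {x \<in> {i..<j}. t x = y} \<noteq> 0" by simp
      then have "{x \<in> {i..<j}. t x = y} \<noteq> {}" by (metis card.empty)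
      then show "y \<in> t ` {i..<j}" by auto
    qed
  qed
  have cimg: "card (t ` {..<n}) = p"
    using card_image[OF window[of i]] ij ip unfolding img[symmetric] by simp
  define c where "c = card {x \<in> {..<n}. t x = t i}"
  have c: "card {x \<in> {..<n}. t x = y} = c" if "y \<in> t ` {..<n}" for y
  proof -
    from that obtain x0 where "x0 < n" "y = t x0" by auto
    with win1(2)[of x0] win1(2)[of i] ij l have "int (card {x \<in> {..<n}. t x = y}) = int c"
      by (simp add: c_def)
    then show ?thesis by simp
  qed
  have "{..<n} = (\<Union>y\<in>t ` {..<n}. {x \<in> {..<n}. t x = y})" by auto
  then have "n = card (\<Union>y\<in>t ` {..<n}. {x \<in> {..<n}. t x = y})" by (metis card_lessThan)
  also have "\<dots> = (\<Sum>y\<in>t ` {..<n}. card {x \<in> {..<n}. t x = y})"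
    by (rule card_UN_disjoint) auto
  also have "\<dots> = p * c" using c cimg by simp
  finally show "(j - i) dvd n" by (simp add: p_def)
  show "t (x + (j - i)) = t x" if "x + (j - i) < n" for x
  proof -
    \<comment> \<open>Every window of length \<open>p\<close> has \<open>p\<close> distinct values,
      hence all of them. The value at \<open>x + p\<close> thus recurs in the window starting at
      \<open>x\<close>, and by minimality of the distance only at \<open>x\<close>.\<close>
    have w: "x + p < n" using that by (simp add: p_def)
    have "t ` {x..<x + p} = t ` {..<n}"
    proof (rule card_subset_eq)
      show "t ` {x..<x + p} \<subseteq> t ` {..<n}" using w by auto
      show "card (t ` {x..<x + p}) = card (t ` {..<n})"
        using card_image[OF window[of x]] w cimg by simp
    qed simp
    then have "t (x + p) \<in> t ` {x..<x + p}" using w by auto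
    then obtain z where z: "x \<le> z" "z < x + p" "t (x + p) = t z" by auto
    with min[rule_format, of z "x + p"] w have "p \<le> x + p - z" by (simp add: p_def)
    with z have "z = x" by simp
    with z show ?thesis by (simp add: p_def)
  qed
qed

section \<open>Refinement of an order and elimination of collisions\<close>

context word_order
begin

text \<open>\<open>R\<close> stands for \<open>le\<close> or its converse; a translate of \<open>fox [] s\<close> by an extremal \<open>g\<close>
  has a letter outside the support of \<open>fox [] s\<close> that no other translate can cancel.\<close>

lemma no_extremal_translate:
  assumes R: "\<And>u v. R u v \<or> R v u" "\<And>u v w. R u v \<Longrightarrow> R v w \<Longrightarrow> R u w"
      "\<And>u v w. R (u @ w) (v @ w) \<longleftrightarrow> R u v" "\<And>u v. equal u v \<longleftrightarrow> R u v \<and> R v u"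
    and s: "s \<noteq> []" and c: "Poly_Mapping.keys c \<subseteq> range rep"
    and d: "frag_cmul k d = frag_extend (\<lambda>g. fox g s) c"
    and supp: "Poly_Mapping.keys d \<subseteq> Poly_Mapping.keys (fox [] s)"
    and g: "g \<in> Poly_Mapping.keys c" "\<And>h. h \<in> Poly_Mapping.keys c \<Longrightarrow> R h g" "\<not> R g []"
  shows False
proof -
  let ?b = "hd s"
  let ?I = "{i. i < length s \<and> s ! i = ?b}"
  have I: "finite ?I" "?I \<noteq> {}"
    using s by (auto intro: exI[of _ 0] simp: hd_conv_nth)
  \<comment> \<open>The order is not left-invariant, so the greatest prefix has to be sought after
    translation by \<open>g\<close>, not within \<open>s\<close> itself.\<close>
  obtain i where i: "i \<in> ?I" and imax: "\<And>i'. i' \<in> ?I \<Longrightarrow> R (g @ take i' s) (g @ take i s)"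
  proof -
    have "\<exists>x\<in>?I. \<forall>y\<in>?I. R (g @ take y s) (g @ take x s)"
      by (rule finite_total_max[OF I]) (rule R(1), erule (1) R(2))
    then show ?thesis using that by blast
  qed
  let ?u = "g @ take i s"
  have other: "Poly_Mapping.lookup (fox h s) (?b, rep ?u) = 0" if h: "h \<in> Poly_Mapping.keys c" "h \<noteq> g" for h
  proof (rule ccontr)
    assume "\<not> ?thesis"
    then have "{i'. i' < length s \<and> s ! i' = ?b \<and> rep (h @ take i' s) = rep ?u} \<noteq> {}"
      by (auto simp: lookup_fox)
    then obtain i' where i': "i' \<in> ?I" "equal (h @ take i' s) ?u"
      by (auto simp: rep_eq_iff)
    have "R ?u (h @ take i' s)" using i'(2) R(4) by blast
    then have "R (g @ take i' s) (h @ take i' s)" using imax[OF i'(1)] R(2) by blast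
    then have "R g h" by (simp add: R(3))
    then have "equal g h" using g(2)[OF h(1)] R(4) by blast
    moreover obtain g' h' where "g = rep g'" "h = rep h'" using c g(1) h(1) by blast
    ultimately show False using h(2) by (metis rep_eq_iff rep_rep)
  qed
  have "Poly_Mapping.lookup (frag_cmul k d) (?b, rep ?u) =
      (\<Sum>h\<in>Poly_Mapping.keys c. Poly_Mapping.lookup c h * Poly_Mapping.lookup (fox h s) (?b, rep ?u))"
    unfolding d by (rule lookup_frag_extend)
  also have "\<dots> = (\<Sum>h\<in>{g}. Poly_Mapping.lookup c h * Poly_Mapping.lookup (fox h s) (?b, rep ?u))"
    by (rule sum.mono_neutral_right) (use g(1) other in auto)
  also have "\<dots> \<noteq> 0"
  proof -
    have "i \<in> {i'. i' < length s \<and> s ! i' = ?b \<and> rep (g @ take i' s) = rep ?u}"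
      using i by simp
    then have "card {i'. i' < length s \<and> s ! i' = ?b \<and> rep (g @ take i' s) = rep ?u} \<noteq> 0"
      by (subst card_0_eq) auto
    with g(1) show ?thesis by (simp add: lookup_fox in_keys_iff)
  qed
  finally have "(?b, rep ?u) \<in> Poly_Mapping.keys d" by (auto simp: in_keys_iff)
  with supp have "Poly_Mapping.lookup (fox [] s) (?b, rep ?u) \<noteq> 0" by (auto simp: in_keys_iff)
  then have "{i'. i' < length s \<and> s ! i' = ?b \<and> rep ([] @ take i' s) = rep ?u} \<noteq> {}"
    by (auto simp: lookup_fox)
  then obtain i' where i': "i' \<in> ?I" "equal (take i' s) ?u" by (auto simp: rep_eq_iff)
  \<comment> \<open>Here \<open>take i' s\<close> is equivalent to the greatest translated prefix,
    hence lies above its own translate by \<open>g\<close>; cancelling it on the right compares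
    \<open>g\<close> with the identity.\<close>
  have "R (g @ take i' s) (take i' s)"
    using imax[OF i'(1)] i'(2) R(2,4) by blast
  then have "R g []" using R(3)[of g "take i' s" "[]"] by simp
  with g(3) show False by simp
qed

text \<open>With the identity adjoined to the support of \<open>c\<close>, a greatest and a least
  element must both be equivalent to the identity: otherwise \<open>no_extremal_translate\<close>
  applies to \<open>le\<close> or to its converse. Only the untranslated derivative remains.\<close>

lemma isolated_proportional:
  assumes s: "s \<noteq> []" and d: "d \<in> isolated"
    and supp: "Poly_Mapping.keys d \<subseteq> Poly_Mapping.keys (fox [] s)"
  obtains k l where "k > 0" "frag_cmul k d = frag_cmul l (fox [] s)"
proof -
  from d obtain k c0 where k: "k > 0" and c0: "frag_cmul k d = frag_extend (\<lambda>g. fox g s) c0"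
    by (auto simp: isolated_def)
  \<comment> \<open>Coefficients of equivalent words are collected, because distinct keys must be
    inequivalent for an extremal one to be isolated from the others.\<close>
  define c where "c = frag_extend (\<lambda>g. frag_of (rep g)) c0"
  have c: "frag_cmul k d = frag_extend (\<lambda>g. fox g s) c"
    by (simp add: c_def frag_extend_comp fox_rep c0)
  have range: "Poly_Mapping.keys c \<subseteq> range rep"
    unfolding c_def by (rule keys_frag_extend_subset) auto
  let ?K = "insert (rep []) (Poly_Mapping.keys c)"
  have K: "finite ?K" "?K \<noteq> {}" by simp_all
  have ex: "R g []"
    if R: "\<And>u v. R u v \<or> R v u" "\<And>u v w. R u v \<Longrightarrow> R v w \<Longrightarrow> R u w"
      "\<And>u v w. R (u @ w) (v @ w) \<longleftrightarrow> R u v" "\<And>u v. equal u v \<longleftrightarrow> R u v \<and> R v u"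
      and g: "g \<in> ?K" "\<And>h. h \<in> ?K \<Longrightarrow> R h g" for R g
  proof (cases "g = rep []")
    case True
    then show ?thesis using equal_rep[of "[]"] R(4) by blast
  next
    case False
    then have gc: "g \<in> Poly_Mapping.keys c" using g(1) by simp
    have gmax: "R h g" if "h \<in> Poly_Mapping.keys c" for h using that by (intro g(2)) simp
    show ?thesis
    proof (rule ccontr)
      assume neg: "\<not> R g []"
      show False
        by (rule no_extremal_translate[where R = R and g = g and c = c and k = k and d = d])
          (fact R s range c supp gc gmax neg)+
    qed
  qed
  obtain g where g: "g \<in> ?K" "\<And>h. h \<in> ?K \<Longrightarrow> le h g"
  proof -
    have "\<exists>g\<in>?K. \<forall>h\<in>?K. le h g"
      by (rule finite_total_max[OF K]) (rule total, erule (1) trans)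
    then show ?thesis using that by blast
  qed
  have "le g []"
    by (rule ex[of le]) (fact total trans right_iff equal_def g)+
  obtain g' where g': "g' \<in> ?K" "\<And>h. h \<in> ?K \<Longrightarrow> le g' h"
  proof -
    have "\<exists>g\<in>?K. \<forall>h\<in>?K. le g h"
      by (rule finite_total_max[OF K]) (rule total, erule (1) trans[rotated])
    then show ?thesis using that by blast
  qed
  have equal: "equal u v \<longleftrightarrow> le v u \<and> le u v" for u v by (auto simp: equal_def)
  have "le [] g'"
    by (rule ex[of "\<lambda>x y. le y x"]) (rule total, erule (1) trans[rotated], (fact right_iff equal g')+)
  have "h = rep []" if h: "h \<in> Poly_Mapping.keys c" for h
  proof -
    have "le h []" using g(2)[of h] h \<open>le g []\<close> trans by blast
    moreover have "le [] h" using g'(2)[of h] h \<open>le [] g'\<close> trans by blast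
    ultimately have "rep h = rep []" by (simp add: rep_eq_iff equal_def)
    moreover obtain h' where "h = rep h'" using range h by blast
    ultimately show ?thesis by simp
  qed
  then have "Poly_Mapping.keys c \<subseteq> {rep []}" by blast
  then have "c = frag_cmul (Poly_Mapping.lookup c (rep [])) (frag_of (rep []))"
    by (intro poly_mapping_eqI) (auto simp: in_keys_iff)
  then have "frag_cmul k d = frag_cmul (Poly_Mapping.lookup c (rep [])) (fox (rep []) s)"
    unfolding c by (metis frag_extend_cmul frag_extend_of)
  with k that show thesis by (simp add: fox_rep)
qed

text \<open>Comparing first by \<open>le\<close> and then by the derivatives modulo \<open>isolated\<close> amounts to passing to an
  extension of the ordered monoid of words modulo \<open>equal\<close> by a torsion-free abelian group.\<close>

lemma refinement:
  obtains le' where "word_order s le'"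
    "\<And>u v. word_order.equal le' u v \<longleftrightarrow> equal u v \<and> fox [] v - fox [] u \<in> isolated"
proof -
  have "\<exists>P. isolated \<subseteq> P \<and> (\<forall>x\<in>P. \<forall>y\<in>P. x + y \<in> P) \<and> (\<forall>x. x \<in> P \<or> - x \<in> P) \<and>
      (\<forall>x. x \<in> P \<longrightarrow> - x \<in> P \<longrightarrow> x \<in> isolated)"
    by (rule extend_to_cone)
      (rule isolated_zero, erule (1) isolated_add, erule (1) isolated_divide, erule isolated_uminus)
  then obtain P where TP: "isolated \<subseteq> P" and Padd: "\<And>x y. x \<in> P \<Longrightarrow> y \<in> P \<Longrightarrow> x + y \<in> P"
    and Ptot: "\<And>x. x \<in> P \<or> - x \<in> P" and PT: "\<And>x. x \<in> P \<Longrightarrow> - x \<in> P \<Longrightarrow> x \<in> isolated"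
    by (elim exE conjE) blast
  define le' where "le' u v \<longleftrightarrow> le u v \<and> (le v u \<longrightarrow> fox [] v - fox [] u \<in> P)" for u v
  have eq: "le' u v \<and> le' v u \<longleftrightarrow> equal u v \<and> fox [] v - fox [] u \<in> isolated" for u v
  proof
    assume "le' u v \<and> le' v u"
    then show "equal u v \<and> fox [] v - fox [] u \<in> isolated"
      using PT[of "fox [] v - fox [] u"] by (auto simp: le'_def equal_def)
  next
    assume "equal u v \<and> fox [] v - fox [] u \<in> isolated"
    then show "le' u v \<and> le' v u"
      using TP isolated_uminus[of "fox [] v - fox [] u"] by (auto simp: le'_def equal_def)
  qed
  have wo: "word_order s le'"
  proof
    show "le' u v \<or> le' v u" for u v
      using total[of u v] Ptot[of "fox [] v - fox [] u"] by (auto simp: le'_def)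
    show "le' u w" if "le' u v" "le' v w" for u v w
    proof -
      have "le u w" using that trans by (auto simp: le'_def)
      moreover have "fox [] w - fox [] u \<in> P" if wu: "le w u"
      proof -
        have "le v u" "le w v" using \<open>le' u v\<close> \<open>le' v w\<close> wu trans by (auto simp: le'_def)
        then have "(fox [] w - fox [] v) + (fox [] v - fox [] u) \<in> P"
          using \<open>le' u v\<close> \<open>le' v w\<close> by (intro Padd) (auto simp: le'_def)
        then show ?thesis by simp
      qed
      ultimately show ?thesis by (simp add: le'_def)
    qed
    show "le' (u @ w) (v @ w) \<longleftrightarrow> le' u v" for u v w
    proof -
      have "fox [] (v @ w) - fox [] (u @ w) = fox [] v - fox [] u" if "le u v" "le v u"
        using fox_cong[of u v w] that by (simp add: fox_append equal_def)
      then show ?thesis by (auto simp: le'_def right_iff)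
    qed
    show "le' (w @ u) (w @ v)" if "le' u v" "le' v u" for u v w
    proof -
      have uv: "equal u v" "fox [] v - fox [] u \<in> isolated" using eq that by blast+
      \<comment> \<open>The cone \<open>P\<close> need not be stable under translation, so left
        multiplication need not preserve \<open>le'\<close>. The subgroup \<open>isolated\<close> is
        stable, which suffices for a congruence.\<close>
      have "translate w (fox [] v - fox [] u) = translate w (fox [] v) - translate w (fox [] u)"
        by (simp only: translate_def frag_extend_diff)
      also have "\<dots> = fox [] (w @ v) - fox [] (w @ u)" by (simp add: translate_fox fox_append)
      finally have "fox [] (w @ v) - fox [] (w @ u) \<in> isolated"
        using isolated_translate[OF uv(2), of w] by simp
      moreover have "equal (w @ u) (w @ v)" using uv(1) by (simp add: equal_append)
      ultimately show ?thesis using eq by blast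
    qed
    have "equal [] s" using equal_root equal_sym by blast
    with eq[of "[]" s] isolated_root show "le' s []" "le' [] s" by simp_all
  qed
  interpret L: word_order s le' by (rule wo)
  from wo show thesis by (rule that) (unfold L.equal_def, rule eq)
qed

lemma fox_take_diff:
  assumes "i \<le> j" "j \<le> length s"
  shows "Poly_Mapping.lookup (fox [] (take j s) - fox [] (take i s)) (b, u)
    = int (card {x \<in> {i..<j}. (s ! x, rep (take x s)) = (b, u)})"
proof -
  have *: "Poly_Mapping.lookup (fox [] (take m s)) (b, u) = int (card {x \<in> {..<m}. (s ! x, rep (take x s)) = (b, u)})"
    if "m \<le> length s" for m
  proof -
    have "x < length (take m s) \<and> take m s ! x = b \<and> rep ([] @ take x (take m s)) = u
        \<longleftrightarrow> x \<in> {..<m} \<and> (s ! x, rep (take x s)) = (b, u)" for x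
    proof (cases "x < m")
      case True
      then have "take x (take m s) = take x s" by (simp add: min_absorb1)
      with True that show ?thesis by simp
    qed simp
    then show ?thesis by (simp only: lookup_fox)
  qed
  have "card {x \<in> {..<j}. Q x} = card {x \<in> {..<i}. Q x} + card {x \<in> {i..<j}. Q x}" for Q
  proof -
    have "{x \<in> {..<j}. Q x} = {x \<in> {..<i}. Q x} \<union> {x \<in> {i..<j}. Q x}"
      using assms(1) by auto
    moreover have "card ({x \<in> {..<i}. Q x} \<union> {x \<in> {i..<j}. Q x})
        = card {x \<in> {..<i}. Q x} + card {x \<in> {i..<j}. Q x}"
      by (rule card_Un_disjoint) auto
    ultimately show ?thesis by simp
  qed
  note split = this[of "\<lambda>x. (s ! x, rep (take x s)) = (b, u)"]
  show ?thesis
    unfolding lookup_minus *[OF assms(2)] *[OF order_trans[OF assms]] split by simp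
qed

definition collisions :: "(nat \<times> nat) set" where
  "collisions = {(i, j). i < length s \<and> j < length s \<and> i \<noteq> j \<and> s ! i = s ! j \<and> equal (take i s) (take j s)}"

lemma finite_collisions: "finite collisions"
  by (rule finite_subset[of _ "{..<length s} \<times> {..<length s}"]) (auto simp: collisions_def)

text \<open>The refined equivalence is finer, so no collision is created; the pair at least distance
  is the one shown to be lost, because only there is the window between its members known to be free
  of repetitions.\<close>

lemma refine_collisions:
  assumes prim: "\<not> proper_power s" and ne: "collisions \<noteq> {}"
  obtains le' where "word_order s le'" "word_order.collisions s le' \<subset> collisions"
proof -
  let ?t = "\<lambda>x. (s ! x, rep (take x s))"
  let ?C = "{(i, j). i < j \<and> j < length s \<and> ?t i = ?t j}"
  have "?C \<noteq> {}"
  proof -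
    from ne obtain i j where "i < length s" "j < length s" "i \<noteq> j" "?t i = ?t j"
      by (auto simp: collisions_def rep_eq_iff)
    then have "(i, j) \<in> ?C \<or> (j, i) \<in> ?C" by auto
    then show ?thesis by blast
  qed
  then obtain q where q: "q \<in> ?C" "\<And>q'. q' \<in> ?C \<Longrightarrow> snd q - fst q \<le> snd q' - fst q'"
    using ex_has_least_nat[of "\<lambda>q. q \<in> ?C" _ "\<lambda>q. snd q - fst q"] by blast
  obtain i j where q_eq: "q = (i, j)" by (cases q)
  have ij: "i < j" "j < length s" "?t i = ?t j" using q(1) q_eq by auto
  have min: "\<forall>x y. x < y \<longrightarrow> y < length s \<longrightarrow> ?t x = ?t y \<longrightarrow> j - i \<le> y - x"
  proof (intro allI impI)
    fix x y assume "x < y" "y < length s" "?t x = ?t y"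
    then show "j - i \<le> y - x" using q(2)[of "(x, y)"] q_eq by auto
  qed
  have sne: "s \<noteq> []" using ij by auto
  obtain le' where le': "word_order s le'"
    and eq: "\<And>u v. word_order.equal le' u v \<longleftrightarrow> equal u v \<and> fox [] v - fox [] u \<in> isolated"
    using refinement by blast
  interpret L: word_order s le' by (rule le')
  have sub: "L.collisions \<subseteq> collisions"
    by (auto simp: L.collisions_def collisions_def eq)
  have in_C: "(i, j) \<in> collisions" using ij by (auto simp: collisions_def rep_eq_iff)
  have notin: "(i, j) \<notin> L.collisions"
  proof
    assume "(i, j) \<in> L.collisions"
    then have d: "fox [] (take j s) - fox [] (take i s) \<in> isolated" (is "?d \<in> _")
      by (auto simp: L.collisions_def eq)
    have v: "Poly_Mapping.lookup (fox [] s) (b, u) = int (card {x \<in> {..<length s}. ?t x = (b, u)})" for b u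
      using fox_take_diff[of 0 "length s" b u] by (simp add: atLeast0LessThan)
    have ld: "Poly_Mapping.lookup ?d (b, u) = int (card {x \<in> {i..<j}. ?t x = (b, u)})" for b u
      using fox_take_diff[of i j b u] ij by simp
    have "Poly_Mapping.keys ?d \<subseteq> Poly_Mapping.keys (fox [] s)"
    proof
      fix y assume "y \<in> Poly_Mapping.keys ?d"
      moreover obtain b u where y: "y = (b, u)" by (cases y)
      ultimately have "{x \<in> {i..<j}. ?t x = (b, u)} \<noteq> {}"
        by (auto simp: in_keys_iff ld simp del: lookup_minus)
      then obtain x where "x \<in> {i..<j}" "?t x = (b, u)" by blast
      then have "x \<in> {x \<in> {..<length s}. ?t x = (b, u)}" using ij(2) by simp
      then have "0 < card {x \<in> {..<length s}. ?t x = (b, u)}" by (subst card_gt_0_iff) auto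
      then show "y \<in> Poly_Mapping.keys (fox [] s)" unfolding in_keys_iff y v by linarith
    qed
    from isolated_proportional[OF sne d this] obtain k l
      where k: "k > 0" and kl: "frag_cmul k ?d = frag_cmul l (fox [] s)" .
    \<comment> \<open>Positions are labelled by letter and prefix class together. Coefficients of
      the derivatives count labels, so proportionality becomes the hypothesis on the window, and
      periodicity of labels gives periodicity of letters.\<close>
    have ratio: "k * int (card {x \<in> {i..<j}. ?t x = y}) = l * int (card {x \<in> {..<length s}. ?t x = y})" for y
    proof -
      have "Poly_Mapping.lookup (frag_cmul k ?d) y = Poly_Mapping.lookup (frag_cmul l (fox [] s)) y"
        by (simp only: kl)
      then show ?thesis unfolding lookup_frag_cmul by (cases y) (simp only: ld v)
    qed
    note per = periodic_of_proportional_window[of i j "length s" ?t k l, OF ij min k ratio]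
    from per(1) obtain c where c: "length s = c * (j - i)" by (metis dvd_def mult.commute)
    have "s ! (x + (j - i)) = s ! x" if "x + (j - i) < length s" for x
      using per(2)[OF that] by simp
    then have "s = concat (replicate c (take (j - i) s))"
      by (rule concat_replicate_periodic[OF c])
    moreover have "take (j - i) s \<noteq> []" using ij sne by simp
    \<comment> \<open>The window ends at \<open>j\<close>, strictly inside \<open>s\<close>, so its
      length is not that of all of \<open>s\<close>.\<close>
    moreover have "c \<ge> 2"
    proof (rule ccontr)
      assume "\<not> c \<ge> 2"
      then have "c = 0 \<or> c = 1" by auto
      with c ij show False by auto
    qed
    ultimately show False using prim unfolding proper_power_def by blast
  qed
  have "L.collisions \<subset> collisions" using sub in_C notin by blast
  with le' show thesis by (rule that)
qed

end

text \<open>The preorder with all words equivalent is a starting point. Collisions form a finite set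
  that a refinement strictly shrinks, so an order with the fewest of them has none.\<close>

theorem collision_free_word_order:
  assumes "\<not> proper_power s"
  obtains le where "word_order s le" "word_order.collisions s le = {}"
proof -
  have triv: "word_order s (\<lambda>_ _. True)" by unfold_locales simp_all
  from ex_has_least_nat[of "word_order s", OF triv, of "\<lambda>le. card (word_order.collisions s le)"]
  obtain le where le: "word_order s le"
    and min: "\<forall>le'. word_order s le' \<longrightarrow> card (word_order.collisions s le) \<le> card (word_order.collisions s le')"
    by (elim exE conjE)
  interpret word_order s le by (rule le)
  have "collisions = {}"
  proof (rule ccontr)
    assume "collisions \<noteq> {}"
    from refine_collisions[OF assms this] obtain le' where le': "word_order s le'"
      "word_order.collisions s le' \<subset> collisions" .
    from min le'(1) have "card collisions \<le> card (word_order.collisions s le')" by blast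
    moreover have "card (word_order.collisions s le') < card collisions"
      by (rule psubset_card_mono[OF finite_collisions le'(2)])
    ultimately show False by simp
  qed
  with le show thesis by (rule that)
qed

section \<open>Chain maps and homotopies\<close>

lemma homI:
  assumes "\<And>x. x \<in> carrier M \<Longrightarrow> f x \<in> carrier N"
    and "\<And>x y. x \<in> carrier M \<Longrightarrow> y \<in> carrier M \<Longrightarrow> f (x \<oplus>\<^bsub>M\<^esub> y) = f x \<oplus>\<^bsub>N\<^esub> f y"
    and "\<And>a x. a \<in> carrier R \<Longrightarrow> x \<in> carrier M \<Longrightarrow> f (a \<odot>\<^bsub>M\<^esub> x) = a \<odot>\<^bsub>N\<^esub> f x"
  shows "f \<in> left_module_hom R M N"
  using assms by (simp add: left_module_hom_def)

lemma homD:
  assumes "f \<in> left_module_hom R M N"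
  shows "\<And>x. x \<in> carrier M \<Longrightarrow> f x \<in> carrier N"
    and "\<And>x y. x \<in> carrier M \<Longrightarrow> y \<in> carrier M \<Longrightarrow> f (x \<oplus>\<^bsub>M\<^esub> y) = f x \<oplus>\<^bsub>N\<^esub> f y"
    and "\<And>a x. a \<in> carrier R \<Longrightarrow> x \<in> carrier M \<Longrightarrow> f (a \<odot>\<^bsub>M\<^esub> x) = a \<odot>\<^bsub>N\<^esub> f x"
  using assms by (auto simp: left_module_hom_def)

lemma hom_minus:
  assumes M: "left_module R M" and N: "left_module R N" and f: "f \<in> left_module_hom R M N"
    and x: "x \<in> carrier M" and y: "y \<in> carrier M"
  shows "f (x \<ominus>\<^bsub>M\<^esub> y) = f x \<ominus>\<^bsub>N\<^esub> f y"
proof -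
  interpret M: left_module R M by fact
  interpret N: left_module R N by fact
  have "f (x \<ominus>\<^bsub>M\<^esub> y) \<oplus>\<^bsub>N\<^esub> f y = f ((x \<ominus>\<^bsub>M\<^esub> y) \<oplus>\<^bsub>M\<^esub> y)"
    using homD(2)[OF f, of "x \<ominus>\<^bsub>M\<^esub> y" y] x y by simp
  also have "(x \<ominus>\<^bsub>M\<^esub> y) \<oplus>\<^bsub>M\<^esub> y = x"
    using x y by (simp add: M.minus_eq M.M.a_assoc M.M.l_neg)
  finally have "f (x \<ominus>\<^bsub>M\<^esub> y) \<oplus>\<^bsub>N\<^esub> f y = f x" .
  moreover have "f x \<in> carrier N" "f y \<in> carrier N" "f (x \<ominus>\<^bsub>M\<^esub> y) \<in> carrier N"
    using homD(1)[OF f] x y by simp_all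
  ultimately show ?thesis
    by (metis N.M.a_assoc N.M.a_inv_closed N.M.minus_eq N.M.r_neg N.M.r_zero)
qed

lemma smult_a_inv:
  assumes "left_module R N" "a \<in> carrier R" "y \<in> carrier N"
  shows "a \<odot>\<^bsub>N\<^esub> (\<ominus>\<^bsub>N\<^esub> y) = \<ominus>\<^bsub>N\<^esub> (a \<odot>\<^bsub>N\<^esub> y)"
proof -
  interpret N: left_module R N by fact
  have "a \<odot>\<^bsub>N\<^esub> (\<ominus>\<^bsub>N\<^esub> y) \<oplus>\<^bsub>N\<^esub> a \<odot>\<^bsub>N\<^esub> y = a \<odot>\<^bsub>N\<^esub> (\<ominus>\<^bsub>N\<^esub> y \<oplus>\<^bsub>N\<^esub> y)"
    using assms(2,3) by (simp add: N.smult_r_distr)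
  also have "\<dots> = \<zero>\<^bsub>N\<^esub>" using assms(2,3) by (simp add: N.M.l_neg N.smult_r_null)
  finally show ?thesis using assms(2,3) by (intro N.M.minus_equality[symmetric]) simp_all
qed

lemma hom_diff:
  assumes N: "left_module R N" and f: "f \<in> left_module_hom R M N" and g: "g \<in> left_module_hom R M N"
  shows "(\<lambda>x. f x \<ominus>\<^bsub>N\<^esub> g x) \<in> left_module_hom R M N"
proof -
  interpret N: left_module R N by fact
  note f' = homD[OF f] and g' = homD[OF g]
  show ?thesis
  proof (rule homI)
    fix x y assume xy: "x \<in> carrier M" "y \<in> carrier M"
    then show "f x \<ominus>\<^bsub>N\<^esub> g x \<in> carrier N" using f'(1) g'(1) by simp
    have c: "f x \<in> carrier N" "f y \<in> carrier N" "g x \<in> carrier N" "g y \<in> carrier N"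
      using xy f'(1) g'(1) by simp_all
    then show "f (x \<oplus>\<^bsub>M\<^esub> y) \<ominus>\<^bsub>N\<^esub> g (x \<oplus>\<^bsub>M\<^esub> y) = (f x \<ominus>\<^bsub>N\<^esub> g x) \<oplus>\<^bsub>N\<^esub> (f y \<ominus>\<^bsub>N\<^esub> g y)"
      using f'(2)[OF xy] g'(2)[OF xy] by (simp add: N.M.minus_eq N.M.minus_add N.M.a_ac)
  next
    fix a x assume ax: "a \<in> carrier R" "x \<in> carrier M"
    then have "f x \<in> carrier N" "g x \<in> carrier N" using f'(1) g'(1) by simp_all
    then show "f (a \<odot>\<^bsub>M\<^esub> x) \<ominus>\<^bsub>N\<^esub> g (a \<odot>\<^bsub>M\<^esub> x) = a \<odot>\<^bsub>N\<^esub> (f x \<ominus>\<^bsub>N\<^esub> g x)"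
      using f'(3)[OF ax] g'(3)[OF ax] ax by (simp add: N.M.minus_eq N.smult_r_distr smult_a_inv[OF N])
  qed
qed

lemma left_module_kernel:
  assumes M: "left_module R M" and N: "left_module R N" and f: "f \<in> left_module_hom R M N"
  shows "left_module R (M\<lparr>carrier := {x \<in> carrier M. f x = \<zero>\<^bsub>N\<^esub>}\<rparr>)" (is "left_module R ?K")
proof -
  interpret M: left_module R M by fact
  interpret N: left_module R N by fact
  note f' = homD[OF f]
  have f0: "f \<zero>\<^bsub>M\<^esub> = \<zero>\<^bsub>N\<^esub>" by (rule M.hom_zero[OF N f])
  have "abelian_group ?K"
  proof (rule abelian_groupI)
    fix x assume "x \<in> carrier ?K"
    then have x: "x \<in> carrier M" "f x = \<zero>\<^bsub>N\<^esub>" by simp_all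
    have "f (\<zero>\<^bsub>M\<^esub> \<ominus>\<^bsub>M\<^esub> x) = \<zero>\<^bsub>N\<^esub>"
      using hom_minus[OF M N f M.M.zero_closed x(1)] f0 x(2) by (simp add: N.M.minus_eq)
    then show "\<exists>y\<in>carrier ?K. y \<oplus>\<^bsub>?K\<^esub> x = \<zero>\<^bsub>?K\<^esub>"
      using x by (intro bexI[of _ "\<zero>\<^bsub>M\<^esub> \<ominus>\<^bsub>M\<^esub> x"]) (simp_all add: M.M.minus_eq M.M.l_neg)
  qed (use f' f0 M.M.a_ac in \<open>auto simp: M.M.a_assoc\<close>)
  then show ?thesis
    by (intro left_module.intro left_module_axioms.intro M.R.ring_axioms)
      (use f' in \<open>auto simp: M.smult_l_distr M.smult_r_distr M.smult_assoc1 N.smult_r_null\<close>)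
qed

lemma projective_lifting:
  assumes P: "projective_module R P" and B: "left_module R B" and C: "left_module R C"
    and g: "g \<in> left_module_hom R B C" "g ` carrier B = carrier C" and h: "h \<in> left_module_hom R P C"
  shows "\<exists>k\<in>left_module_hom R P B. \<forall>x\<in>carrier P. g (k x) = h x"
  by (rule projective_module_lifting[OF P B C g h]) blast

text \<open>Restricting the carrier of \<open>C\<close> to the kernel of \<open>f\<close> makes
  \<open>g\<close> surjective, and \<open>h\<close> takes values there.\<close>

lemma projective_lifting_exact:
  assumes P: "projective_module R P" and B: "left_module R B" and C: "left_module R C" and D: "left_module R D"
    and g: "g \<in> left_module_hom R B C" and f: "f \<in> left_module_hom R C D"
    and exact: "g ` carrier B = {x \<in> carrier C. f x = \<zero>\<^bsub>D\<^esub>}"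
    and h: "h \<in> left_module_hom R P C" and cycle: "\<forall>x\<in>carrier P. f (h x) = \<zero>\<^bsub>D\<^esub>"
  shows "\<exists>k\<in>left_module_hom R P B. \<forall>x\<in>carrier P. g (k x) = h x"
proof -
  let ?K = "C\<lparr>carrier := {x \<in> carrier C. f x = \<zero>\<^bsub>D\<^esub>}\<rparr>"
  have K: "left_module R ?K" by (rule left_module_kernel[OF C D f])
  have gB: "g x \<in> carrier C" "f (g x) = \<zero>\<^bsub>D\<^esub>" if "x \<in> carrier B" for x
    using exact that by auto
  have gK: "g \<in> left_module_hom R B ?K"
    by (rule homI) (use gB homD[OF g] in simp_all)
  have hK: "h \<in> left_module_hom R P ?K"
    by (rule homI) (use cycle homD[OF h] in simp_all)
  have "g ` carrier B = carrier ?K" using exact by simp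
  then show ?thesis by (rule projective_lifting[OF P B K gK _ hK])
qed

locale resolution =
  fixes R :: "('r, 'c) ring_scheme" and M :: "('r, 'm, 'd) module_scheme"
    and P :: "nat \<Rightarrow> ('r, 'u) module" and d :: "nat \<Rightarrow> 'u \<Rightarrow> 'u" and e :: "'u \<Rightarrow> 'm"
  assumes res: "projective_resolution R M P d e"
begin

lemma aug_module: "left_module R M"
  and projective: "projective_module R (P n)"
  and d_hom: "d n \<in> left_module_hom R (P (Suc n)) (P n)"
  and e_hom: "e \<in> left_module_hom R (P 0) M"
  and e_surj: "e ` carrier (P 0) = carrier M"
  and exact_0: "d 0 ` carrier (P (Suc 0)) = {x \<in> carrier (P 0). e x = \<zero>\<^bsub>M\<^esub>}"
  and exact_Suc: "d (Suc n) ` carrier (P (Suc (Suc n))) = {x \<in> carrier (P (Suc n)). d n x = \<zero>\<^bsub>P n\<^esub>}"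
  using res by (simp_all add: projective_resolution_def)

lemma chain_module: "left_module R (P n)"
  using projective by (simp add: projective_module_def)

lemma e_d: "x \<in> carrier (P (Suc 0)) \<Longrightarrow> e (d 0 x) = \<zero>\<^bsub>M\<^esub>"
  using exact_0 by blast

lemma d_d: "x \<in> carrier (P (Suc (Suc n))) \<Longrightarrow> d n (d (Suc n) x) = \<zero>\<^bsub>P n\<^esub>"
  using exact_Suc[of n] by blast

text \<open>In degree 0 the boundary is the augmentation \<open>e\<close>, whose target has another
  type; hiding the case distinction here lets comparison maps and homotopies be built by one
  induction.\<close>

definition cycle :: "nat \<Rightarrow> 'u \<Rightarrow> bool" where
  "cycle n x = (case n of 0 \<Rightarrow> e x = \<zero>\<^bsub>M\<^esub> | Suc k \<Rightarrow> d k x = \<zero>\<^bsub>P k\<^esub>)"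

lemma lift_cycle:
  assumes L: "projective_module R L" and h: "h \<in> left_module_hom R L (P n)"
    and c: "\<forall>x\<in>carrier L. cycle n (h x)"
  shows "\<exists>k\<in>left_module_hom R L (P (Suc n)). \<forall>x\<in>carrier L. d n (k x) = h x"
proof (cases n)
  case 0
  have "\<forall>x\<in>carrier L. e (h x) = \<zero>\<^bsub>M\<^esub>" using c 0 by (simp add: cycle_def)
  from projective_lifting_exact[OF L chain_module chain_module aug_module d_hom e_hom exact_0 h[unfolded 0] this]
  show ?thesis using 0 by simp
next
  case (Suc j)
  have "\<forall>x\<in>carrier L. d j (h x) = \<zero>\<^bsub>P j\<^esub>" using c Suc by (simp add: cycle_def)
  from projective_lifting_exact[OF L chain_module chain_module chain_module d_hom d_hom exact_Suc h[unfolded Suc] this]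
  show ?thesis using Suc by simp
qed

end

lemma comparison:
  fixes P Q :: "nat \<Rightarrow> ('r, 'u) module"
  assumes "projective_resolution R M P d e" and "projective_resolution R M Q d' e'"
  shows "\<exists>a. (\<forall>n. a n \<in> left_module_hom R (P n) (Q n)) \<and> (\<forall>x\<in>carrier (P 0). e' (a 0 x) = e x) \<and>
    (\<forall>n. \<forall>x\<in>carrier (P (Suc n)). d' n (a (Suc n) x) = a n (d n x))"
proof -
  interpret P: resolution R M P d e by unfold_locales fact
  interpret Q: resolution R M Q d' e' by unfold_locales fact
  \<comment> \<open>Dependent choice sees only the previous map, so the invariant carries what the
    next lift requires: \<open>f (d n x)\<close> is a cycle.\<close>
  define good where "good n f \<longleftrightarrow> f \<in> left_module_hom R (P n) (Q n) \<and>
    (n = 0 \<longrightarrow> (\<forall>x\<in>carrier (P 0). e' (f x) = e x)) \<and> (\<forall>x\<in>carrier (P (Suc n)). Q.cycle n (f (d n x)))" for n f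
  have "\<exists>a. \<forall>n. good n (a n) \<and> (\<forall>x\<in>carrier (P (Suc n)). d' n (a (Suc n) x) = a n (d n x))"
  proof (rule dependent_nat_choice)
    from projective_lifting[OF P.projective Q.chain_module P.aug_module Q.e_hom Q.e_surj P.e_hom]
    obtain f where f: "f \<in> left_module_hom R (P 0) (Q 0)" "\<forall>x\<in>carrier (P 0). e' (f x) = e x" ..
    have "e' (f (d 0 x)) = \<zero>\<^bsub>M\<^esub>" if "x \<in> carrier (P (Suc 0))" for x
      using bspec[OF f(2) homD(1)[OF P.d_hom that]] P.e_d[OF that] by simp
    with f have "good 0 f" by (simp add: good_def Q.cycle_def)
    then show "\<exists>f. good 0 f" by (intro exI[of _ f])
  next
    fix f n assume "good n f"
    then have f: "f \<in> left_module_hom R (P n) (Q n)" "\<forall>x\<in>carrier (P (Suc n)). Q.cycle n (f (d n x))"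
      by (simp_all add: good_def)
    from Q.lift_cycle[OF P.projective left_module_hom_compose[OF P.d_hom f(1)] f(2)]
    obtain k where k: "k \<in> left_module_hom R (P (Suc n)) (Q (Suc n))"
      "\<forall>x\<in>carrier (P (Suc n)). d' n (k x) = f (d n x)" ..
    have "Q.cycle (Suc n) (k (d (Suc n) x))" if "x \<in> carrier (P (Suc (Suc n)))" for x
    proof -
      have "d' n (k (d (Suc n) x)) = f (d n (d (Suc n) x))"
        by (rule bspec[OF k(2) homD(1)[OF P.d_hom that]])
      also have "\<dots> = \<zero>\<^bsub>Q n\<^esub>"
        using P.d_d[OF that] left_module.hom_zero[OF P.chain_module Q.chain_module f(1)] by simp
      finally show ?thesis by (simp add: Q.cycle_def)
    qed
    with k show "\<exists>k. good (Suc n) k \<and> (\<forall>x\<in>carrier (P (Suc n)). d' n (k x) = f (d n x))"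
      unfolding good_def by blast
  qed
  then obtain a where a: "\<forall>n. good n (a n) \<and> (\<forall>x\<in>carrier (P (Suc n)). d' n (a (Suc n) x) = a n (d n x))" ..
  show ?thesis
    by (rule exI[of _ a]) (use a in \<open>simp add: good_def\<close>)
qed

lemma (in resolution) null_homotopy:
  assumes f: "\<And>n. f n \<in> left_module_hom R (P n) (P n)"
    and f0: "\<forall>x\<in>carrier (P 0). e (f 0 x) = \<zero>\<^bsub>M\<^esub>"
    and fd: "\<forall>n. \<forall>x\<in>carrier (P (Suc n)). d n (f (Suc n) x) = f n (d n x)"
  shows "\<exists>h. (\<forall>n. h n \<in> left_module_hom R (P n) (P (Suc n))) \<and>
    (\<forall>n. \<forall>x\<in>carrier (P (Suc n)). d (Suc n) (h (Suc n) x) = f (Suc n) x \<ominus>\<^bsub>P (Suc n)\<^esub> h n (d n x))"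
proof -
  define good where "good n h \<longleftrightarrow> h \<in> left_module_hom R (P n) (P (Suc n)) \<and>
    (\<forall>x\<in>carrier (P (Suc n)). d n (f (Suc n) x \<ominus>\<^bsub>P (Suc n)\<^esub> h (d n x)) = \<zero>\<^bsub>P n\<^esub>)" for n h
  have diff: "(\<lambda>x. f (Suc n) x \<ominus>\<^bsub>P (Suc n)\<^esub> h (d n x)) \<in> left_module_hom R (P (Suc n)) (P (Suc n))"
    if "h \<in> left_module_hom R (P n) (P (Suc n))" for n h
    by (rule hom_diff[OF chain_module f left_module_hom_compose[OF d_hom that]])
  have d_diff: "d n (f (Suc n) x \<ominus>\<^bsub>P (Suc n)\<^esub> h (d n x)) = f n (d n x) \<ominus>\<^bsub>P n\<^esub> d n (h (d n x))"
    if h: "h \<in> left_module_hom R (P n) (P (Suc n))" and x: "x \<in> carrier (P (Suc n))" for n h x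
    using hom_minus[OF chain_module chain_module d_hom homD(1)[OF f x] homD(1)[OF h homD(1)[OF d_hom x]]] bspec[OF spec[OF fd] x]
    by simp
  have self: "y \<ominus>\<^bsub>P n\<^esub> y = \<zero>\<^bsub>P n\<^esub>" if "y \<in> carrier (P n)" for n y
  proof -
    interpret N: left_module R "P n" by (rule chain_module)
    show ?thesis using that by (simp add: N.M.minus_eq N.M.r_neg)
  qed
  have "\<exists>h. \<forall>n. good n (h n) \<and> (\<forall>x\<in>carrier (P (Suc n)). d (Suc n) (h (Suc n) x) = f (Suc n) x \<ominus>\<^bsub>P (Suc n)\<^esub> h n (d n x))"
  proof (rule dependent_nat_choice)
    have "\<forall>x\<in>carrier (P 0). cycle 0 (f 0 x)"
      using f0 by (simp add: cycle_def)
    from lift_cycle[OF projective f this] obtain h where h: "h \<in> left_module_hom R (P 0) (P (Suc 0))"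
      "\<forall>x\<in>carrier (P 0). d 0 (h x) = f 0 x" ..
    have "d 0 (f (Suc 0) x \<ominus>\<^bsub>P (Suc 0)\<^esub> h (d 0 x)) = \<zero>\<^bsub>P 0\<^esub>" if "x \<in> carrier (P (Suc 0))" for x
      using d_diff[OF h(1) that] bspec[OF h(2) homD(1)[OF d_hom that]] self[OF homD(1)[OF f homD(1)[OF d_hom that]]] by simp
    with h(1) have "good 0 h" by (simp add: good_def)
    then show "\<exists>h. good 0 h" by (intro exI[of _ h])
  next
    fix h n assume "good n h"
    then have h: "h \<in> left_module_hom R (P n) (P (Suc n))"
      "\<And>x. x \<in> carrier (P (Suc n)) \<Longrightarrow> d n (f (Suc n) x \<ominus>\<^bsub>P (Suc n)\<^esub> h (d n x)) = \<zero>\<^bsub>P n\<^esub>"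
      by (simp_all add: good_def)
    have "\<forall>x\<in>carrier (P (Suc n)). cycle (Suc n) (f (Suc n) x \<ominus>\<^bsub>P (Suc n)\<^esub> h (d n x))"
      using h(2) by (simp add: cycle_def)
    from lift_cycle[OF projective diff[OF h(1)] this]
    obtain k where k: "k \<in> left_module_hom R (P (Suc n)) (P (Suc (Suc n)))"
      "\<forall>x\<in>carrier (P (Suc n)). d (Suc n) (k x) = f (Suc n) x \<ominus>\<^bsub>P (Suc n)\<^esub> h (d n x)" ..
    have "d (Suc n) (f (Suc (Suc n)) x \<ominus>\<^bsub>P (Suc (Suc n))\<^esub> k (d (Suc n) x)) = \<zero>\<^bsub>P (Suc n)\<^esub>"
      if x: "x \<in> carrier (P (Suc (Suc n)))" for x
    proof -
      interpret N: left_module R "P (Suc n)" by (rule chain_module)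
      have dx: "d (Suc n) x \<in> carrier (P (Suc n))" by (rule homD(1)[OF d_hom x])
      have fdx: "f (Suc n) (d (Suc n) x) \<in> carrier (P (Suc n))" by (rule homD(1)[OF f dx])
      have "d (Suc n) (k (d (Suc n) x)) = f (Suc n) (d (Suc n) x) \<ominus>\<^bsub>P (Suc n)\<^esub> h (d n (d (Suc n) x))"
        by (rule bspec[OF k(2) dx])
      also have "h (d n (d (Suc n) x)) = \<zero>\<^bsub>P (Suc n)\<^esub>"
        using d_d[OF x] left_module.hom_zero[OF chain_module chain_module h(1)] by simp
      also have "f (Suc n) (d (Suc n) x) \<ominus>\<^bsub>P (Suc n)\<^esub> \<zero>\<^bsub>P (Suc n)\<^esub> = f (Suc n) (d (Suc n) x)"
        using fdx by (simp add: N.M.minus_eq)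
      finally show ?thesis using d_diff[OF k(1) x] self[OF fdx] by simp
    qed
    with k show "\<exists>k. good (Suc n) k \<and> (\<forall>x\<in>carrier (P (Suc n)). d (Suc n) (k x) = f (Suc n) x \<ominus>\<^bsub>P (Suc n)\<^esub> h (d n x))"
      unfolding good_def by blast
  qed
  then obtain h where h: "\<forall>n. good n (h n) \<and>
    (\<forall>x\<in>carrier (P (Suc n)). d (Suc n) (h (Suc n) x) = f (Suc n) x \<ominus>\<^bsub>P (Suc n)\<^esub> h n (d n x))" ..
  show ?thesis
    by (rule exI[of _ h]) (use h in \<open>simp add: good_def\<close>)
qed

text \<open>Compare \<open>P\<close> with the short resolution \<open>Q\<close> in both directions.
  The identity minus the round trip lies over zero and is therefore null-homotopic, and above degree
  \<open>n\<close> the round trip passes through a zero module.\<close>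

lemma contraction_above_dimension:
  fixes P Q :: "nat \<Rightarrow> ('r, 'u) module"
  assumes P: "projective_resolution R M P d e" and Q: "projective_resolution R M Q d' e'"
    and zero: "\<forall>k>n. carrier (Q k) = {\<zero>\<^bsub>Q k\<^esub>}"
  shows "\<exists>h. (\<forall>k. h k \<in> left_module_hom R (P k) (P (Suc k))) \<and>
    (\<forall>k\<ge>n. \<forall>x\<in>carrier (P (Suc k)). x = d (Suc k) (h (Suc k) x) \<oplus>\<^bsub>P (Suc k)\<^esub> h k (d k x))"
proof -
  interpret P: resolution R M P d e by unfold_locales fact
  interpret Q: resolution R M Q d' e' by unfold_locales fact
  obtain a where a: "\<And>n. a n \<in> left_module_hom R (P n) (Q n)"
    "\<And>x. x \<in> carrier (P 0) \<Longrightarrow> e' (a 0 x) = e x"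
    "\<And>n x. x \<in> carrier (P (Suc n)) \<Longrightarrow> d' n (a (Suc n) x) = a n (d n x)"
    using comparison[OF P Q] by (elim exE conjE) blast
  obtain b where b: "\<And>n. b n \<in> left_module_hom R (Q n) (P n)"
    "\<And>x. x \<in> carrier (Q 0) \<Longrightarrow> e (b 0 x) = e' x"
    "\<And>n x. x \<in> carrier (Q (Suc n)) \<Longrightarrow> d n (b (Suc n) x) = b n (d' n x)"
    using comparison[OF Q P] by (elim exE conjE) blast
  define f where "f n x = x \<ominus>\<^bsub>P n\<^esub> b n (a n x)" for n x
  have id: "(\<lambda>x. x) \<in> left_module_hom R (P n) (P n)" for n by (rule homI) simp_all
  have f: "f n \<in> left_module_hom R (P n) (P n)" for n
    unfolding f_def by (rule hom_diff[OF P.chain_module id left_module_hom_compose[OF a(1) b(1)]])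
  have ba: "b n (a n x) \<in> carrier (P n)" if "x \<in> carrier (P n)" for n x
    by (rule homD(1)[OF b(1) homD(1)[OF a(1) that]])
  have e_f: "\<forall>x\<in>carrier (P 0). e (f 0 x) = \<zero>\<^bsub>M\<^esub>"
  proof
    fix x assume x: "x \<in> carrier (P 0)"
    interpret N: left_module R M by (rule P.aug_module)
    have "e (f 0 x) = e x \<ominus>\<^bsub>M\<^esub> e (b 0 (a 0 x))"
      unfolding f_def by (rule hom_minus[OF P.chain_module P.aug_module P.e_hom x ba[OF x]])
    also have "e (b 0 (a 0 x)) = e x" using b(2)[OF homD(1)[OF a(1) x]] a(2)[OF x] by simp
    finally show "e (f 0 x) = \<zero>\<^bsub>M\<^esub>" using homD(1)[OF P.e_hom x] by (simp add: N.M.minus_eq N.M.r_neg)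
  qed
  have d_f: "\<forall>n. \<forall>x\<in>carrier (P (Suc n)). d n (f (Suc n) x) = f n (d n x)"
  proof (intro allI ballI)
    fix n x assume x: "x \<in> carrier (P (Suc n))"
    have "d n (f (Suc n) x) = d n x \<ominus>\<^bsub>P n\<^esub> d n (b (Suc n) (a (Suc n) x))"
      unfolding f_def by (rule hom_minus[OF P.chain_module P.chain_module P.d_hom x ba[OF x]])
    also have "d n (b (Suc n) (a (Suc n) x)) = b n (a n (d n x))"
      using b(3)[OF homD(1)[OF a(1) x]] a(3)[OF x] by simp
    finally show "d n (f (Suc n) x) = f n (d n x)" by (simp add: f_def)
  qed
  obtain h where h: "\<And>n. h n \<in> left_module_hom R (P n) (P (Suc n))"
    "\<And>n x. x \<in> carrier (P (Suc n)) \<Longrightarrow> d (Suc n) (h (Suc n) x) = f (Suc n) x \<ominus>\<^bsub>P (Suc n)\<^esub> h n (d n x)"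
    using P.null_homotopy[of f, OF f e_f d_f] by (elim exE conjE) blast
  show ?thesis
  proof (intro exI[of _ h] conjI allI impI ballI)
    show "h k \<in> left_module_hom R (P k) (P (Suc k))" for k by (rule h(1))
    fix k x assume k: "k \<ge> n" and x: "x \<in> carrier (P (Suc k))"
    interpret N: left_module R "P (Suc k)" by (rule P.chain_module)
    have "a (Suc k) x = \<zero>\<^bsub>Q (Suc k)\<^esub>"
      using homD(1)[OF a(1) x] zero[rule_format, of "Suc k"] k by simp
    then have "b (Suc k) (a (Suc k) x) = \<zero>\<^bsub>P (Suc k)\<^esub>"
      using left_module.hom_zero[OF Q.chain_module P.chain_module b(1)] by simp
    then have fx: "f (Suc k) x = x" using x by (simp add: f_def N.M.minus_eq)
    have hx: "h k (d k x) \<in> carrier (P (Suc k))"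
      by (rule homD(1)[OF h(1) homD(1)[OF P.d_hom x]])
    show "x = d (Suc k) (h (Suc k) x) \<oplus>\<^bsub>P (Suc k)\<^esub> h k (d k x)"
      unfolding h(2)[OF x] fx using x hx by (simp add: N.M.minus_eq N.M.a_assoc N.M.l_neg)
  qed
qed


section \<open>Transport of modules along injections\<close>

text \<open>All modules of a resolution must have carriers in one type \<open>'u\<close>; a copy
  along an injection takes the free bimodules there.\<close>

definition transport :: "('x \<Rightarrow> 'u) \<Rightarrow> ('r, 'x, 'd) module_scheme \<Rightarrow> ('r, 'u) module" where
  "transport i M = \<lparr>carrier = i ` carrier M, mult = undefined, one = undefined, zero = i \<zero>\<^bsub>M\<^esub>,
     add = (\<lambda>x y. i (inv_into (carrier M) i x \<oplus>\<^bsub>M\<^esub> inv_into (carrier M) i y)),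
     smult = (\<lambda>a x. i (a \<odot>\<^bsub>M\<^esub> inv_into (carrier M) i x))\<rparr>"

context
  fixes R :: "('r, 'c) ring_scheme" and M :: "('r, 'x, 'd) module_scheme" and i :: "'x \<Rightarrow> 'u"
  assumes M: "left_module R M" and inj: "inj_on i (carrier M)"
begin

interpretation M: left_module R M by (rule M)

private lemma ops:
  "carrier (transport i M) = i ` carrier M" "\<zero>\<^bsub>transport i M\<^esub> = i \<zero>\<^bsub>M\<^esub>"
  "x \<in> carrier M \<Longrightarrow> y \<in> carrier M \<Longrightarrow> i x \<oplus>\<^bsub>transport i M\<^esub> i y = i (x \<oplus>\<^bsub>M\<^esub> y)"
  "x \<in> carrier M \<Longrightarrow> a \<odot>\<^bsub>transport i M\<^esub> i x = i (a \<odot>\<^bsub>M\<^esub> x)"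
  using inj by (simp_all add: transport_def)

lemma left_module_transport: "left_module R (transport i M)"
proof -
  have "abelian_group (transport i M)"
  proof (rule abelian_groupI)
    fix x assume "x \<in> carrier (transport i M)"
    then obtain x' where x: "x = i x'" "x' \<in> carrier M" by (auto simp: ops)
    then show "\<exists>y\<in>carrier (transport i M). y \<oplus>\<^bsub>transport i M\<^esub> x = \<zero>\<^bsub>transport i M\<^esub>"
      by (intro bexI[of _ "i (\<ominus>\<^bsub>M\<^esub> x')"]) (simp_all add: ops M.M.l_neg)
  qed (auto simp: ops M.M.a_ac)
  then show ?thesis
    by (intro left_module.intro left_module_axioms.intro M.R.ring_axioms)
      (auto simp: ops M.smult_l_distr M.smult_r_distr M.smult_assoc1)
qed

lemma transport_hom: "i \<in> left_module_hom R M (transport i M)"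
  by (rule homI) (simp_all add: ops)

lemma transport_inv_hom: "inv_into (carrier M) i \<in> left_module_hom R (transport i M) M"
  by (rule homI) (auto simp: ops inj)

lemma finitely_generated_transport:
  assumes "finitely_generated_module R M"
  shows "finitely_generated_module R (transport i M)"
proof -
  interpret T: left_module R "transport i M" by (rule left_module_transport)
  let ?j = "inv_into (carrier M) i"
  from assms obtain S where S: "finite S" "S \<subseteq> carrier M"
    and gen: "\<And>x. x \<in> carrier M \<Longrightarrow> \<exists>c\<in>S \<rightarrow> carrier R. x = (\<Oplus>\<^bsub>M\<^esub>s\<in>S. c s \<odot>\<^bsub>M\<^esub> s)"
    unfolding finitely_generated_module_def by blast
  have j: "?j (i s) = s" if "s \<in> S" for s using that S(2) inj by (simp add: subset_iff)
  have "\<exists>c\<in>i ` S \<rightarrow> carrier R. x = (\<Oplus>\<^bsub>transport i M\<^esub>s\<in>i ` S. c s \<odot>\<^bsub>transport i M\<^esub> s)"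
    if "x \<in> carrier (transport i M)" for x
  proof -
    from that obtain y where y: "y \<in> carrier M" "x = i y" by (auto simp: ops)
    from gen[OF y(1)] obtain c where c: "c \<in> S \<rightarrow> carrier R" "y = (\<Oplus>\<^bsub>M\<^esub>s\<in>S. c s \<odot>\<^bsub>M\<^esub> s)" by blast
    have cl: "(\<lambda>s. c s \<odot>\<^bsub>M\<^esub> s) \<in> S \<rightarrow> carrier M" using c(1) S(2) by auto
    have "x = (\<Oplus>\<^bsub>transport i M\<^esub>s\<in>S. i (c s \<odot>\<^bsub>M\<^esub> s))"
      unfolding y(2) c(2) by (rule M.hom_finsum[OF left_module_transport transport_hom S(1) cl])
    also have "\<dots> = (\<Oplus>\<^bsub>transport i M\<^esub>s\<in>S. c (?j (i s)) \<odot>\<^bsub>transport i M\<^esub> i s)"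
      by (rule T.M.finsum_cong'[OF HOL.refl]) (use c(1) S(2) j ops in \<open>auto simp: Pi_def subset_iff\<close>)
    also have "\<dots> = (\<Oplus>\<^bsub>transport i M\<^esub>s\<in>i ` S. c (?j s) \<odot>\<^bsub>transport i M\<^esub> s)"
      by (rule T.M.finsum_reindex[symmetric])
        (use c(1) S(2) j inj_on_subset[OF inj S(2)] in \<open>auto simp: ops subset_iff Pi_def\<close>)
    finally show ?thesis using c(1) j by (intro bexI[of _ "\<lambda>s. c (?j s)"]) auto
  qed
  with S show ?thesis
    unfolding finitely_generated_module_def
    by (intro conjI exI[of _ "i ` S"] left_module_transport) (auto simp: ops)
qed

end

section \<open>Free bimodules\<close>

text \<open>The free module on \<open>X\<close> over the enveloping ring, written with the triples
  as an integral basis, so that homomorphisms can be given by \<open>frag_extend\<close> on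
  triples.\<close>

definition free_bimodule ::
    "('m, 'b) monoid_scheme \<Rightarrow> 'x set \<Rightarrow> ('m \<times> 'm \<Rightarrow>\<^sub>0 int, 'm \<times> 'x \<times> 'm \<Rightarrow>\<^sub>0 int) module" where
  "free_bimodule M X =
    \<lparr>carrier = {c. Poly_Mapping.keys c \<subseteq> carrier M \<times> X \<times> carrier M},
     mult = undefined, one = undefined, zero = 0, add = (+),
     smult = (\<lambda>c z. frag_extend (\<lambda>(m, n). frag_extend (\<lambda>(p, x, q). frag_of (m \<otimes>\<^bsub>M\<^esub> p, x, q \<otimes>\<^bsub>M\<^esub> n)) z) c)\<rparr>"

lemma frag_additive_eq:
  fixes f g :: "('y \<Rightarrow>\<^sub>0 int) \<Rightarrow> 'z::ab_group_add"
  assumes "Poly_Mapping.keys z \<subseteq> S"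
    and "\<And>y. y \<in> S \<Longrightarrow> f (frag_of y) = g (frag_of y)"
    and f: "\<And>a b. f (a - b) = f a - f b" and g: "\<And>a b. g (a - b) = g a - g b"
  shows "f z = g z"
  using assms(1)
proof (induction z rule: frag_induction)
  case zero
  show ?case using f[of 0 0] g[of 0 0] by simp
qed (use assms in auto)

context monoid
begin

abbreviation E where "E \<equiv> enveloping_ring G"

lemma carrier_E: "carrier E = {c. Poly_Mapping.keys c \<subseteq> carrier G \<times> carrier G}"
  by (simp add: monoid_ring_def opposite_monoid_def)

lemma mult_E: "c \<otimes>\<^bsub>E\<^esub> d =
    frag_extend (\<lambda>(m, n). frag_extend (\<lambda>(m', n'). frag_of (m \<otimes> m', n' \<otimes> n)) d) c"
  by (simp add: monoid_ring_def opposite_monoid_def DirProd_def case_prod_unfold)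

lemma E_simps: "\<one>\<^bsub>E\<^esub> = frag_of (\<one>, \<one>)" "\<zero>\<^bsub>E\<^esub> = 0" "c \<oplus>\<^bsub>E\<^esub> d = c + d"
  by (simp_all add: monoid_ring_def opposite_monoid_def DirProd_def)

lemma ring_E: "ring E"
  by (intro ring_monoid_ring DirProd_monoid monoid_opposite_monoid monoid_axioms)

lemma free_bimodule_simps:
  "carrier (free_bimodule G X) = {c. Poly_Mapping.keys c \<subseteq> carrier G \<times> X \<times> carrier G}"
  "\<zero>\<^bsub>free_bimodule G X\<^esub> = 0" "c \<oplus>\<^bsub>free_bimodule G X\<^esub> d = c + d"
  "frag_of (m, n) \<odot>\<^bsub>free_bimodule G X\<^esub> frag_of (p, x, q) = frag_of (m \<otimes> p, x, q \<otimes> n)"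
  by (simp_all add: free_bimodule_def)

lemma smult_free_bimodule: "c \<odot>\<^bsub>free_bimodule G X\<^esub> z =
    frag_extend (\<lambda>(m, n). frag_extend (\<lambda>(p, x, q). frag_of (m \<otimes> p, x, q \<otimes> n)) z) c"
  by (simp add: free_bimodule_def)

lemma left_module_free_bimodule: "left_module E (free_bimodule G X)"
proof -
  let ?S = "carrier G \<times> carrier G" and ?T = "carrier G \<times> X \<times> carrier G"
  let ?s = "\<lambda>c z. frag_extend (\<lambda>(m, n). frag_extend (\<lambda>(p, x, q). frag_of (m \<otimes> p, x, q \<otimes> n)) z) c"
  let ?m = "\<lambda>c d. frag_extend (\<lambda>(m, n). frag_extend (\<lambda>(m', n'). frag_of (m \<otimes> m', n' \<otimes> n)) d) c"
  have assoc: "?s (?m c d) x = ?s c (?s d x)"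
    if c: "Poly_Mapping.keys c \<subseteq> ?S" and d: "Poly_Mapping.keys d \<subseteq> ?S"
      and x: "Poly_Mapping.keys x \<subseteq> ?T" for c d x
  proof (rule frag_additive_eq[OF c])
    fix p assume p: "p \<in> ?S"
    show "?s (?m (frag_of p) d) x = ?s (frag_of p) (?s d x)"
    proof (rule frag_additive_eq[OF d])
      fix q assume q: "q \<in> ?S"
      show "?s (?m (frag_of p) (frag_of q)) x = ?s (frag_of p) (?s (frag_of q) x)"
        by (rule frag_additive_eq[OF x])
          (use p q in \<open>auto simp: frag_extend_diff m_assoc case_prod_unfold\<close>)
    qed (auto simp: frag_extend_diff case_prod_unfold)
  qed (auto simp: frag_extend_diff case_prod_unfold)
  have one: "?s (frag_of (\<one>, \<one>)) x = x" if "Poly_Mapping.keys x \<subseteq> ?T" for x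
    by (rule frag_additive_eq[OF that]) (auto simp: frag_extend_diff)
  have closed: "Poly_Mapping.keys (?s c x) \<subseteq> ?T"
    if "Poly_Mapping.keys c \<subseteq> ?S" "Poly_Mapping.keys x \<subseteq> ?T" for c x
    using that unfolding case_prod_unfold
    by (intro keys_frag_extend_subset) (auto 0 4 dest: subsetD)
  show ?thesis
  proof (intro left_module.intro left_module_axioms.intro)
    show "ring E" by (rule ring_E)
    show "abelian_group (free_bimodule G X)"
      by (rule abelian_group_fragments[where S = ?T]) (auto simp: free_bimodule_def)
  next
    fix a b x
    assume "a \<in> carrier E" "b \<in> carrier E" "x \<in> carrier (free_bimodule G X)"
    then show "(a \<otimes>\<^bsub>E\<^esub> b) \<odot>\<^bsub>free_bimodule G X\<^esub> x
        = a \<odot>\<^bsub>free_bimodule G X\<^esub> (b \<odot>\<^bsub>free_bimodule G X\<^esub> x)"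
      unfolding carrier_E mult_E using assoc[of a b x] by (simp add: free_bimodule_def)
  next
    fix a x assume "a \<in> carrier E" "x \<in> carrier (free_bimodule G X)"
    then show "a \<odot>\<^bsub>free_bimodule G X\<^esub> x \<in> carrier (free_bimodule G X)"
      using closed[of a x] by (simp add: carrier_E free_bimodule_def)
  next
    fix x assume "x \<in> carrier (free_bimodule G X)"
    then show "\<one>\<^bsub>E\<^esub> \<odot>\<^bsub>free_bimodule G X\<^esub> x = x"
      using one[of x] by (simp add: E_simps free_bimodule_def)
  qed (simp_all add: E_simps free_bimodule_def frag_extend_add frag_extend_fun_add case_prod_unfold)
qed

text \<open>Stated for an arbitrary target record so that it covers both free bimodules and
  \<^const>\<open>regular_bimodule\<close>.\<close>

lemma frag_extend_hom:
  assumes N: "carrier N = {c. Poly_Mapping.keys c \<subseteq> S}" "add N = (+)"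
      "smult N = (\<lambda>c z. frag_extend (\<lambda>(m, n). frag_extend (\<lambda>y. frag_of (act m n y)) z) c)"
    and closed: "\<And>p x q. p \<in> carrier G \<Longrightarrow> x \<in> X \<Longrightarrow> q \<in> carrier G \<Longrightarrow> Poly_Mapping.keys (f (p, x, q)) \<subseteq> S"
    and equivariant: "\<And>m n p x q. m \<in> carrier G \<Longrightarrow> n \<in> carrier G \<Longrightarrow> p \<in> carrier G \<Longrightarrow> x \<in> X \<Longrightarrow> q \<in> carrier G \<Longrightarrow>
      f (m \<otimes> p, x, q \<otimes> n) = frag_extend (\<lambda>y. frag_of (act m n y)) (f (p, x, q))"
  shows "frag_extend f \<in> left_module_hom E (free_bimodule G X) N"
proof (rule homI)
  fix z assume "z \<in> carrier (free_bimodule G X)"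
  then show "frag_extend f z \<in> carrier N"
    unfolding N mem_Collect_eq free_bimodule_simps
    by (intro keys_frag_extend_subset) (auto dest!: subsetD intro: closed[THEN subsetD])
next
  fix c z assume "c \<in> carrier E" "z \<in> carrier (free_bimodule G X)"
  then have c: "Poly_Mapping.keys c \<subseteq> carrier G \<times> carrier G"
    and z: "Poly_Mapping.keys z \<subseteq> carrier G \<times> X \<times> carrier G"
    by (simp_all add: carrier_E free_bimodule_simps)
  show "frag_extend f (c \<odot>\<^bsub>free_bimodule G X\<^esub> z) = c \<odot>\<^bsub>N\<^esub> frag_extend f z"
    unfolding smult_free_bimodule N
  proof (rule frag_additive_eq[OF c], goal_cases)
    case (1 y)
    show ?case
      by (rule frag_additive_eq[OF z]) (use 1 equivariant in \<open>auto simp: frag_extend_diff case_prod_unfold\<close>)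
  qed (simp_all add: frag_extend_diff)
qed (simp add: N free_bimodule_simps frag_extend_add)

lemma frag_extend_hom_free:
  assumes "\<And>p x q. p \<in> carrier G \<Longrightarrow> x \<in> X \<Longrightarrow> q \<in> carrier G \<Longrightarrow>
      Poly_Mapping.keys (f (p, x, q)) \<subseteq> carrier G \<times> Y \<times> carrier G"
    and "\<And>m n p x q. m \<in> carrier G \<Longrightarrow> n \<in> carrier G \<Longrightarrow> p \<in> carrier G \<Longrightarrow> x \<in> X \<Longrightarrow> q \<in> carrier G \<Longrightarrow>
      f (m \<otimes> p, x, q \<otimes> n) = frag_extend (\<lambda>(p, x, q). frag_of (m \<otimes> p, x, q \<otimes> n)) (f (p, x, q))"
  shows "frag_extend f \<in> left_module_hom E (free_bimodule G X) (free_bimodule G Y)"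
  by (rule frag_extend_hom[where S = "carrier G \<times> Y \<times> carrier G"
        and act = "\<lambda>m n (p, x, q). (m \<otimes> p, x, q \<otimes> n)"])
    (use assms in \<open>simp_all add: free_bimodule_def case_prod_unfold fun_eq_iff\<close>)

definition component :: "'x \<Rightarrow> ('a \<times> 'x \<times> 'a \<Rightarrow>\<^sub>0 int) \<Rightarrow> ('a \<times> 'a \<Rightarrow>\<^sub>0 int)" where
  "component x = frag_extend (\<lambda>(p, y, q). if y = x then frag_of (p, q) else 0)"

lemma component_in_E:
  assumes "z \<in> carrier (free_bimodule G X)"
  shows "component x z \<in> carrier E"
  using assms unfolding component_def carrier_E mem_Collect_eq free_bimodule_simps
  by (intro keys_frag_extend_subset) (auto dest!: subsetD split: if_splits)

lemma component_eq_zero: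
  assumes "x \<notin> (fst \<circ> snd) ` Poly_Mapping.keys z"
  shows "component x z = 0"
  unfolding component_def by (rule frag_extend_eq_0) (use assms in force)

lemma component_smult:
  assumes "c \<in> carrier E" "z \<in> carrier (free_bimodule G X)"
  shows "component x (c \<odot>\<^bsub>free_bimodule G X\<^esub> z) = c \<otimes>\<^bsub>E\<^esub> component x z"
proof -
  from assms have c: "Poly_Mapping.keys c \<subseteq> carrier G \<times> carrier G"
    and z: "Poly_Mapping.keys z \<subseteq> carrier G \<times> X \<times> carrier G"
    by (simp_all add: carrier_E free_bimodule_simps)
  show ?thesis
    unfolding smult_free_bimodule mult_E component_def
  proof (rule frag_additive_eq[OF c], goal_cases)
    case (1 y)
    show ?case
      by (rule frag_additive_eq[OF z]) (auto simp: frag_extend_diff case_prod_unfold)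
  qed (simp_all add: frag_extend_diff)
qed

text \<open>Coordinates over the enveloping ring lead into \<open>free_module\<close>, where
  \<open>extension\<close> supplies the lifts needed for projectivity.\<close>

lemma components_hom:
  "(\<lambda>z x. component x z) \<in> left_module_hom E (free_bimodule G X) (free_module E X)"
proof (rule homI)
  fix z assume z: "z \<in> carrier (free_bimodule G X)"
  have sub: "{x. component x z \<noteq> 0} \<subseteq> (fst \<circ> snd) ` Poly_Mapping.keys z"
  proof (rule subsetI, rule ccontr)
    fix x assume "x \<in> {x. component x z \<noteq> 0}" "x \<notin> (fst \<circ> snd) ` Poly_Mapping.keys z"
    with component_eq_zero[of x z] show False by simp
  qed
  have "(fst \<circ> snd) ` Poly_Mapping.keys z \<subseteq> X"
    using z unfolding free_bimodule_simps mem_Collect_eq by auto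
  with sub have "{x. component x z \<noteq> 0} \<subseteq> X" by (rule order_trans)
  moreover have "finite {x. component x z \<noteq> 0}"
    by (rule finite_subset[OF sub], rule finite_imageI, rule finite_keys)
  ultimately show "(\<lambda>x. component x z) \<in> carrier (free_module E X)"
    using component_in_E[OF z] unfolding free_module_def E_simps by simp
next
  fix y z
  show "(\<lambda>x. component x (y \<oplus>\<^bsub>free_bimodule G X\<^esub> z)) =
      (\<lambda>x. component x y) \<oplus>\<^bsub>free_module E X\<^esub> (\<lambda>x. component x z)"
    by (simp add: free_module_def free_bimodule_simps E_simps component_def frag_extend_add)
next
  fix c z assume cz: "c \<in> carrier E" "z \<in> carrier (free_bimodule G X)"
  show "(\<lambda>x. component x (c \<odot>\<^bsub>free_bimodule G X\<^esub> z)) = c \<odot>\<^bsub>free_module E X\<^esub> (\<lambda>x. component x z)"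
    unfolding component_smult[OF cz] by (simp add: free_module_def)
qed

definition generator :: "'x \<Rightarrow> ('a \<times> 'x \<times> 'a \<Rightarrow>\<^sub>0 int)" where
  "generator x = frag_of (\<one>, x, \<one>)"

lemma generator_closed: "x \<in> X \<Longrightarrow> generator x \<in> carrier (free_bimodule G X)"
  by (simp add: generator_def free_bimodule_simps)

lemma component_generator: "component x (generator y) = (if y = x then \<one>\<^bsub>E\<^esub> else \<zero>\<^bsub>E\<^esub>)"
  by (simp add: component_def generator_def E_simps)

lemma hom_eq_on_generators:
  assumes N: "left_module E N"
    and f: "f \<in> left_module_hom E (free_bimodule G X) N" and g: "g \<in> left_module_hom E (free_bimodule G X) N"
    and eq: "\<And>x. x \<in> X \<Longrightarrow> f (generator x) = g (generator x)"
    and z: "z \<in> carrier (free_bimodule G X)"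
  shows "f z = g z"
proof -
  let ?F = "free_bimodule G X"
  interpret F: left_module E ?F by (rule left_module_free_bimodule)
  interpret N: left_module E N by fact
  have minus: "h (a - b) = h a \<ominus>\<^bsub>N\<^esub> h b"
    if "h \<in> left_module_hom E ?F N" "a \<in> carrier ?F" "b \<in> carrier ?F" for h a b
  proof -
    have "a - b \<in> carrier ?F"
      using that(2,3) keys_diff[of a b] by (auto simp: free_bimodule_simps)
    moreover have "(a - b) \<oplus>\<^bsub>?F\<^esub> b = a" by (simp add: free_bimodule_simps)
    ultimately have "a \<ominus>\<^bsub>?F\<^esub> b = a - b"
      using that(2,3) by (metis F.M.a_assoc F.M.a_inv_closed F.M.minus_eq F.M.r_neg F.M.r_zero)
    with hom_minus[OF F.left_module_axioms N that] show ?thesis by simp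
  qed
  have "z \<in> carrier ?F \<and> f z = g z"
    using z unfolding free_bimodule_simps(1) mem_Collect_eq
  proof (induction z rule: frag_induction)
    case zero
    show ?case using F.hom_zero[OF N f] F.hom_zero[OF N g] by (simp add: free_bimodule_simps)
  next
    case (one y)
    then obtain p x q where y: "y = (p, x, q)" "p \<in> carrier G" "x \<in> X" "q \<in> carrier G" by auto
    have pq: "frag_of (p, q) \<in> carrier E" using y by (simp add: carrier_E)
    have eq_y: "frag_of y = frag_of (p, q) \<odot>\<^bsub>?F\<^esub> generator x"
      using y by (simp add: generator_def free_bimodule_simps)
    have "f (frag_of y) = g (frag_of y)"
      unfolding eq_y homD(3)[OF f pq generator_closed[OF y(3)]] homD(3)[OF g pq generator_closed[OF y(3)]]
      using eq[OF y(3)] by simp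
    with y show ?case by simp
  next
    case (diff a b)
    then have ab: "a \<in> carrier ?F" "b \<in> carrier ?F" by (simp_all add: free_bimodule_simps)
    have "Poly_Mapping.keys (a - b) \<subseteq> carrier G \<times> X \<times> carrier G"
      using ab keys_diff[of a b] by (auto simp: free_bimodule_simps)
    with diff minus[OF f ab] minus[OF g ab] show ?case by simp
  qed
  then show ?thesis by simp
qed

lemma free_bimodule_lifting:
  assumes B: "left_module E B" and C: "left_module E C"
    and g: "g \<in> left_module_hom E B C" "g ` carrier B = carrier C"
    and h: "h \<in> left_module_hom E (free_bimodule G X) C"
  shows "\<exists>k\<in>left_module_hom E (free_bimodule G X) B. \<forall>z\<in>carrier (free_bimodule G X). g (k z) = h z"
proof -
  interpret B: left_module E B by fact
  have "\<forall>x\<in>X. \<exists>y. y \<in> carrier B \<and> g y = h (generator x)"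
  proof
    fix x assume "x \<in> X"
    then have "h (generator x) \<in> g ` carrier B"
      unfolding g(2) by (rule homD(1)[OF h generator_closed])
    then obtain y where "h (generator x) = g y" "y \<in> carrier B" by (rule imageE)
    then show "\<exists>y. y \<in> carrier B \<and> g y = h (generator x)" by (intro exI[of _ y]) simp
  qed
  from bchoice[OF this] obtain b where b: "\<forall>x\<in>X. b x \<in> carrier B \<and> g (b x) = h (generator x)" ..
  have bX: "b \<in> X \<rightarrow> carrier B" using b by simp
  let ?k = "\<lambda>z. B.extension b (\<lambda>x. component x z)"
  have k: "?k \<in> left_module_hom E (free_bimodule G X) B"
    by (rule left_module_hom_compose[OF components_hom B.extension_hom[OF bX]])
  have gen: "?k (generator x) = b x" if "x \<in> X" for x
  proof -
    have "(\<lambda>y. component y (generator x)) = (\<lambda>y. if y = x then \<one>\<^bsub>E\<^esub> else \<zero>\<^bsub>E\<^esub>)"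
      by (auto simp: component_generator fun_eq_iff)
    then show ?thesis using B.extension_basis[OF that bX] by simp
  qed
  have gk: "(\<lambda>z. g (?k z)) \<in> left_module_hom E (free_bimodule G X) C"
    by (rule left_module_hom_compose[OF k g(1)])
  have "g (?k z) = h z" if "z \<in> carrier (free_bimodule G X)" for z
    by (rule hom_eq_on_generators[OF C gk h _ that]) (simp add: gen b)
  with k show ?thesis by (intro bexI[of _ ?k] ballI)
qed

lemma projective_transport_free_bimodule:
  assumes inj: "inj_on i (carrier (free_bimodule G X))"
  shows "projective_module E (transport i (free_bimodule G X) :: ('a \<times> 'a \<Rightarrow>\<^sub>0 int, 'u) module)"
proof -
  let ?F = "free_bimodule G X"
  note F = left_module_free_bimodule[of X]
  note T = transport_hom[OF F inj] and T' = transport_inv_hom[OF F inj]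
  have "\<exists>k\<in>left_module_hom E (transport i ?F) B. \<forall>x\<in>carrier (transport i ?F). g (k x) = h x"
    if "left_module E B" "left_module E C" "g \<in> left_module_hom E B C" "g ` carrier B = carrier C"
      "h \<in> left_module_hom E (transport i ?F) C"
    for B :: "('a \<times> 'a \<Rightarrow>\<^sub>0 int, 'u \<Rightarrow> 'a \<times> 'a \<Rightarrow>\<^sub>0 int) module" and C :: "('a \<times> 'a \<Rightarrow>\<^sub>0 int, 'u) module" and g h
  proof -
    from free_bimodule_lifting[OF that(1-4) left_module_hom_compose[OF T that(5)]]
    obtain k where k: "k \<in> left_module_hom E ?F B" "\<forall>z\<in>carrier ?F. g (k z) = h (i z)" ..
    have "g (k (inv_into (carrier ?F) i x)) = h x" if "x \<in> carrier (transport i ?F)" for x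
    proof -
      have x: "x \<in> i ` carrier ?F" using that by (simp add: transport_def)
      show ?thesis using bspec[OF k(2) inv_into_into[OF x]] f_inv_into_f[OF x] by simp
    qed
    with left_module_hom_compose[OF T' k(1)] show ?thesis
      by (intro bexI[of _ "\<lambda>x. k (inv_into (carrier ?F) i x)"] ballI)
  qed
  then show ?thesis
    unfolding projective_module_def using left_module_transport[OF F inj] by (intro conjI allI impI)
qed

lemma finsum_fragments:
  assumes "abelian_monoid N" "add N = (+)" "zero N = (0 :: 'y \<Rightarrow>\<^sub>0 int)" "finite S" "f \<in> S \<rightarrow> carrier N"
  shows "finsum N f S = sum f S"
proof -
  interpret N: abelian_monoid N by fact
  from assms(4,5) show ?thesis
    by (induction S rule: finite_induct) (auto simp: assms(2,3) Pi_def)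
qed

lemma finitely_generated_free_bimodule:
  assumes X: "finite X"
  shows "finitely_generated_module E (free_bimodule G X)"
proof -
  let ?F = "free_bimodule G X"
  interpret F: left_module E ?F by (rule left_module_free_bimodule)
  have inj: "inj_on generator X" by (auto simp: generator_def inj_on_def frag_of_eq)
  have expand: "z = (\<Sum>x\<in>X. component x z \<odot>\<^bsub>?F\<^esub> generator x)" if "z \<in> carrier ?F" for z
  proof -
    have z: "Poly_Mapping.keys z \<subseteq> carrier G \<times> X \<times> carrier G" using that by (simp add: free_bimodule_simps)
    show ?thesis
    proof (rule frag_additive_eq[OF z], goal_cases)
      case (1 y)
      then obtain p x q where y: "y = (p, x, q)" "p \<in> carrier G" "x \<in> X" "q \<in> carrier G" by auto
      have "(\<Sum>w\<in>X. component w (frag_of y) \<odot>\<^bsub>?F\<^esub> generator w)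
          = (\<Sum>w\<in>X. if w = x then frag_of y else 0)"
        by (rule sum.cong) (use y in \<open>auto simp: component_def generator_def smult_free_bimodule\<close>)
      also have "\<dots> = frag_of y" using X y by simp
      finally show ?case ..
    qed (simp_all add: component_def smult_free_bimodule frag_extend_diff sum_subtractf)
  qed
  have "\<exists>c\<in>generator ` X \<rightarrow> carrier E. z = (\<Oplus>\<^bsub>?F\<^esub>s\<in>generator ` X. c s \<odot>\<^bsub>?F\<^esub> s)"
    if z: "z \<in> carrier ?F" for z
  proof
    let ?c = "\<lambda>s. component (inv_into X generator s) z"
    show c: "?c \<in> generator ` X \<rightarrow> carrier E" using component_in_E[OF z] by auto
    have cl: "(\<lambda>s. ?c s \<odot>\<^bsub>?F\<^esub> s) \<in> generator ` X \<rightarrow> carrier ?F"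
    proof (rule Pi_I)
      fix s assume "s \<in> generator ` X"
      then have "s \<in> carrier ?F" using generator_closed by auto
      then show "?c s \<odot>\<^bsub>?F\<^esub> s \<in> carrier ?F" by (rule F.smult_closed[OF component_in_E[OF z]])
    qed
    have "(\<Oplus>\<^bsub>?F\<^esub>s\<in>generator ` X. ?c s \<odot>\<^bsub>?F\<^esub> s) = (\<Sum>s\<in>generator ` X. ?c s \<odot>\<^bsub>?F\<^esub> s)"
      by (rule finsum_fragments[OF F.M.abelian_monoid_axioms _ _ _ cl])
        (use X in \<open>simp_all add: free_bimodule_def\<close>)
    also have "\<dots> = (\<Sum>x\<in>X. component x z \<odot>\<^bsub>?F\<^esub> generator x)"
      by (subst sum.reindex[OF inj]) (simp add: inj)
    finally show "z = (\<Oplus>\<^bsub>?F\<^esub>s\<in>generator ` X. ?c s \<odot>\<^bsub>?F\<^esub> s)"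
      using expand[OF z] by simp
  qed
  moreover have "finite (generator ` X)" "generator ` X \<subseteq> carrier ?F"
    using X generator_closed by auto
  ultimately show ?thesis
    unfolding finitely_generated_module_def using F.left_module_axioms by blast
qed

end

section \<open>Embedding countable carriers into an infinite type\<close>

lemma countable_fragments:
  assumes "countable S"
  shows "countable {c :: 'y \<Rightarrow>\<^sub>0 int. Poly_Mapping.keys c \<subseteq> S}"
proof -
  let ?f = "\<lambda>l. sum_list (map (\<lambda>(y, k). frag_cmul k (frag_of y)) l) :: 'y \<Rightarrow>\<^sub>0 int"
  have "{c :: 'y \<Rightarrow>\<^sub>0 int. Poly_Mapping.keys c \<subseteq> S} \<subseteq> ?f ` lists (S \<times> UNIV)"
  proof
    fix c :: "'y \<Rightarrow>\<^sub>0 int" assume "c \<in> {c. Poly_Mapping.keys c \<subseteq> S}"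
    moreover obtain ys where ys: "set ys = Poly_Mapping.keys c" "distinct ys"
      using finite_distinct_list[OF finite_keys] by metis
    moreover have "c = ?f (map (\<lambda>y. (y, Poly_Mapping.lookup c y)) ys)"
    proof -
      have "c = frag_extend frag_of c" by (rule frag_expansion)
      also have "\<dots> = (\<Sum>y\<in>set ys. frag_cmul (Poly_Mapping.lookup c y) (frag_of y))"
        by (simp add: frag_extend_def ys(1))
      also have "\<dots> = ?f (map (\<lambda>y. (y, Poly_Mapping.lookup c y)) ys)"
        using ys(2) by (simp add: sum_list_distinct_conv_sum_set o_def)
      finally show ?thesis .
    qed
    ultimately show "c \<in> ?f ` lists (S \<times> UNIV)"
      by (intro image_eqI[of _ _ "map (\<lambda>y. (y, Poly_Mapping.lookup c y)) ys"]) auto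
  qed
  moreover have "countable (?f ` lists (S \<times> UNIV))"
    using assms by (intro countable_image countable_lists countable_SIGMA) auto
  ultimately show ?thesis by (rule countable_subset)
qed

lemma countable_inj_infinite:
  assumes "countable S"
  obtains i :: "'x \<Rightarrow> 'u::infinite" where "inj_on i S"
proof -
  obtain f :: "nat \<Rightarrow> 'u" where "inj f"
    using infinite_countable_subset[OF infinite_UNIV] by blast
  then have "inj_on (f \<circ> to_nat_on S) S"
    using inj_on_to_nat_on[OF assms] by (intro comp_inj_on) (auto intro: inj_on_subset)
  then show thesis by (rule that)
qed

section \<open>Free bimodule resolutions\<close>

text \<open>The sum of the coefficients, obtained by sending every basis element to one point; on
  free bimodules it makes both actions of the monoid trivial.\<close>

definition augmentation :: "('y \<Rightarrow>\<^sub>0 int) \<Rightarrow> int" where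
  "augmentation z = Poly_Mapping.lookup (frag_extend (\<lambda>_. frag_of ()) z) ()"

lemma augmentation_simps [simp]:
  "augmentation 0 = 0" "augmentation (frag_of y) = 1"
  "augmentation (a + b) = augmentation a + augmentation b"
  "augmentation (a - b) = augmentation a - augmentation b"
  by (simp_all add: augmentation_def frag_extend_add frag_extend_diff lookup_add lookup_minus)

lemma augmentation_sum: "augmentation (sum f I) = (\<Sum>i\<in>I. augmentation (f i))"
  by (induction I rule: infinite_finite_induct) simp_all

lemma augmentation_frag_extend:
  assumes "Poly_Mapping.keys z \<subseteq> S" "\<And>y. y \<in> S \<Longrightarrow> augmentation (f y) = a"
  shows "augmentation (frag_extend f z) = augmentation z * a"
  by (rule frag_additive_eq[OF assms(1)]) (simp_all add: assms(2) frag_extend_diff algebra_simps)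

context monoid
begin

lemma hom_expansion:
  assumes H: "H \<in> left_module_hom E (free_bimodule G X) (free_bimodule G Y)"
    and z: "z \<in> carrier (free_bimodule G X)"
  shows "H z = frag_extend (\<lambda>(p, x, q). frag_of (p, q) \<odot>\<^bsub>free_bimodule G Y\<^esub> H (generator x)) z"
proof -
  let ?Y = "free_bimodule G Y"
  interpret Y: left_module E ?Y by (rule left_module_free_bimodule)
  let ?f = "\<lambda>(p, x, q). frag_of (p, q) \<odot>\<^bsub>?Y\<^esub> H (generator x)"
  have in_E: "frag_of (p, q) \<in> carrier E" if "p \<in> carrier G" "q \<in> carrier G" for p q
    using that by (simp add: carrier_E)
  have H_gen: "H (generator x) \<in> carrier ?Y" if "x \<in> X" for x
    by (rule homD(1)[OF H generator_closed[OF that]])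
  have "frag_extend ?f \<in> left_module_hom E (free_bimodule G X) ?Y"
  proof (rule frag_extend_hom_free)
    fix p x q assume a: "p \<in> carrier G" "x \<in> X" "q \<in> carrier G"
    show "Poly_Mapping.keys (?f (p, x, q)) \<subseteq> carrier G \<times> Y \<times> carrier G"
      using Y.smult_closed[OF in_E[OF a(1,3)] H_gen[OF a(2)]] by (simp add: free_bimodule_simps(1))
    fix m n assume mn: "m \<in> carrier G" "n \<in> carrier G"
    have "frag_of (m \<otimes> p, q \<otimes> n) \<odot>\<^bsub>?Y\<^esub> H (generator x)
        = (frag_of (m, n) \<otimes>\<^bsub>E\<^esub> frag_of (p, q)) \<odot>\<^bsub>?Y\<^esub> H (generator x)"
      by (simp add: mult_E)
    also have "\<dots> = frag_of (m, n) \<odot>\<^bsub>?Y\<^esub> (frag_of (p, q) \<odot>\<^bsub>?Y\<^esub> H (generator x))"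
      by (rule Y.smult_assoc1[OF in_E[OF mn] in_E[OF a(1,3)] H_gen[OF a(2)]])
    finally show "?f (m \<otimes> p, x, q \<otimes> n) = frag_extend (\<lambda>(p, x, q). frag_of (m \<otimes> p, x, q \<otimes> n)) (?f (p, x, q))"
      by (simp add: smult_free_bimodule[where c = "frag_of (m, n)"])
  qed
  then show ?thesis
  proof (rule hom_eq_on_generators[OF Y.left_module_axioms H _ _ z])
    fix x assume "x \<in> X"
    then show "H (generator x) = frag_extend ?f (generator x)"
      using Y.smult_one[OF H_gen] by (simp add: generator_def E_simps)
  qed
qed

text \<open>With both actions made trivial, a homomorphism out of a free bimodule of rank one is
  multiplication by one integer, read off at the generator.\<close>

lemma augmentation_hom:
  assumes H: "H \<in> left_module_hom E (free_bimodule G {x}) (free_bimodule G Y)"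
    and z: "z \<in> carrier (free_bimodule G {x})"
  shows "augmentation (H z) = augmentation z * augmentation (H (generator x))"
proof -
  have smult: "augmentation (frag_of (p, q) \<odot>\<^bsub>free_bimodule G Y\<^esub> w) = augmentation w" for p q w
  proof -
    have "augmentation (frag_extend (\<lambda>(p', x, q'). frag_of (p \<otimes> p', x, q' \<otimes> q)) w) = augmentation w * 1"
      by (rule augmentation_frag_extend[where S = UNIV]) auto
    then show ?thesis by (simp add: smult_free_bimodule)
  qed
  have keys: "Poly_Mapping.keys z \<subseteq> carrier G \<times> {x} \<times> carrier G"
    using z by (simp add: free_bimodule_simps)
  show ?thesis
    unfolding hom_expansion[OF H z]
    by (rule augmentation_frag_extend[OF keys]) (auto simp: smult)
qed

end

locale free_resolution = monoid G for G :: "('a, 'b) monoid_scheme" (structure) +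
  fixes X :: "nat \<Rightarrow> 'x set"
    and d :: "nat \<Rightarrow> ('a \<times> 'x \<times> 'a \<Rightarrow>\<^sub>0 int) \<Rightarrow> ('a \<times> 'x \<times> 'a \<Rightarrow>\<^sub>0 int)"
    and e :: "('a \<times> 'x \<times> 'a \<Rightarrow>\<^sub>0 int) \<Rightarrow> ('a \<Rightarrow>\<^sub>0 int)"
  assumes countable_carrier: "countable (carrier G)"
    and finite_rank: "finite (X n)"
    and d_hom: "d n \<in> left_module_hom E (free_bimodule G (X (Suc n))) (free_bimodule G (X n))"
    and e_hom: "e \<in> left_module_hom E (free_bimodule G (X 0)) (regular_bimodule G)"
    and e_surj: "e ` carrier (free_bimodule G (X 0)) = carrier (regular_bimodule G)"
    and exact_0: "d 0 ` carrier (free_bimodule G (X (Suc 0))) = {z \<in> carrier (free_bimodule G (X 0)). e z = 0}"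
    and exact_Suc: "d (Suc n) ` carrier (free_bimodule G (X (Suc (Suc n)))) =
        {z \<in> carrier (free_bimodule G (X (Suc n))). d n z = 0}"
begin

abbreviation F where "F n \<equiv> free_bimodule G (X n)"

lemma left_module_F: "left_module E (F n)"
  by (rule left_module_free_bimodule)

lemma zero_regular_bimodule: "\<zero>\<^bsub>regular_bimodule G\<^esub> = 0"
  by (simp add: regular_bimodule_def monoid_ring_def)

text \<open>The union of the carriers over all degrees is still countable, so one injection serves
  every degree and all differentials are transported along the same map.\<close>

lemma embedding:
  "\<exists>i :: ('a \<times> 'x \<times> 'a \<Rightarrow>\<^sub>0 int) \<Rightarrow> 'u::infinite. \<forall>n. inj_on i (carrier (F n))"
proof -
  have "countable (\<Union>n. carrier (F n))"
    unfolding free_bimodule_simps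
    by (intro countable_UN countable_fragments countable_SIGMA)
      (simp_all add: countable_carrier countable_finite finite_rank)
  then obtain i :: "_ \<Rightarrow> 'u" where "inj_on i (\<Union>n. carrier (F n))"
    by (rule countable_inj_infinite)
  then have "\<forall>n. inj_on i (carrier (F n))" by (intro allI) (rule inj_on_subset, assumption, blast)
  then show ?thesis by (rule exI[of _ i])
qed

lemma projective_resolution_transport:
  assumes inj: "\<And>n. inj_on i (carrier (F n))"
  shows "projective_resolution E (regular_bimodule G) (\<lambda>n. transport i (F n))
    (\<lambda>n x. i (d n (inv_into (carrier (F (Suc n))) i x))) (\<lambda>x. e (inv_into (carrier (F 0)) i x))"
proof -
  let ?T = "\<lambda>n. transport i (F n)" and ?j = "\<lambda>n. inv_into (carrier (F n)) i"
  have carr: "carrier (?T n) = i ` carrier (F n)" for n by (simp add: transport_def)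
  have zero: "\<zero>\<^bsub>?T n\<^esub> = i 0" for n by (simp add: transport_def free_bimodule_simps)
  have j: "?j n (i z) = z" if "z \<in> carrier (F n)" for n z using inv_into_f_f[OF inj that] .
  have zero_F: "0 \<in> carrier (F n)" for n by (simp add: free_bimodule_simps)
  have i_eq: "i z = i 0 \<longleftrightarrow> z = 0" if "z \<in> carrier (F n)" for n z
    using inj_on_eq_iff[OF inj that zero_F] .
  have image: "(\<lambda>x. i (d n (?j (Suc n) x))) ` carrier (?T (Suc n)) = i ` d n ` carrier (F (Suc n))" for n
    unfolding carr image_image using j by (intro image_cong) simp_all
  have regular: "left_module E (regular_bimodule G)"
    by (rule left_module_regular_bimodule) (rule monoid_axioms)
  show ?thesis
    unfolding projective_resolution_def
  proof (intro conjI allI)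
    show "projective_module E (?T n)" for n by (rule projective_transport_free_bimodule[OF inj])
    show "(\<lambda>x. i (d n (?j (Suc n) x))) \<in> left_module_hom E (?T (Suc n)) (?T n)" for n
      using left_module_hom_compose[OF left_module_hom_compose[OF transport_inv_hom[OF left_module_F inj] d_hom]
          transport_hom[OF left_module_F inj]] .
    show "(\<lambda>x. e (?j 0 x)) \<in> left_module_hom E (?T 0) (regular_bimodule G)"
      by (rule left_module_hom_compose[OF transport_inv_hom[OF left_module_F inj] e_hom])
    show "(\<lambda>x. e (?j 0 x)) ` carrier (?T 0) = carrier (regular_bimodule G)"
      unfolding carr image_image e_surj[symmetric] using j by (intro image_cong) simp_all
    have "(\<lambda>x. i (d 0 (?j (Suc 0) x))) ` carrier (?T (Suc 0)) = i ` {z \<in> carrier (F 0). e z = 0}"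
      by (simp only: image exact_0)
    also have "\<dots> = {x \<in> carrier (?T 0). e (?j 0 x) = \<zero>\<^bsub>regular_bimodule G\<^esub>}"
      unfolding carr zero_regular_bimodule using j by auto
    finally show "(\<lambda>x. i (d 0 (?j (Suc 0) x))) ` carrier (?T 1) = {x \<in> carrier (?T 0). e (?j 0 x) = \<zero>\<^bsub>regular_bimodule G\<^esub>}"
      by simp
    fix n
    have dF: "d n z \<in> carrier (F n)" if "z \<in> carrier (F (Suc n))" for z by (rule homD(1)[OF d_hom that])
    have "(\<lambda>x. i (d (Suc n) (?j (Suc (Suc n)) x))) ` carrier (?T (Suc (Suc n)))
        = i ` {z \<in> carrier (F (Suc n)). d n z = 0}"
      by (simp only: image exact_Suc)
    also have "\<dots> = {x \<in> carrier (?T (Suc n)). i (d n (?j (Suc n) x)) = \<zero>\<^bsub>?T n\<^esub>}"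
      unfolding carr zero using j i_eq[OF dF] by auto
    finally show "(\<lambda>x. i (d (Suc n) (?j (Suc (Suc n)) x))) ` carrier (?T (Suc (Suc n)))
        = {x \<in> carrier (?T (Suc n)). i (d n (?j (Suc n) x)) = \<zero>\<^bsub>?T n\<^esub>}" .
  qed (rule regular)
qed

lemma bi_FP_infinity: "bi_FP_infinity (U :: 'u::infinite itself) G"
proof -
  obtain i :: "('a \<times> 'x \<times> 'a \<Rightarrow>\<^sub>0 int) \<Rightarrow> 'u" where inj: "\<And>n. inj_on i (carrier (F n))"
    using embedding by blast
  have "finitely_generated_module E (transport i (F n))" for n
    by (rule finitely_generated_transport[OF left_module_F inj finitely_generated_free_bimodule[OF finite_rank]])
  with projective_resolution_transport[OF inj] show ?thesis
    unfolding bi_FP_infinity_def FP_infinity_def by blast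
qed

lemma hochschild_dimension_le:
  assumes "\<And>k. k > n \<Longrightarrow> X k = {}"
  shows "hochschild_dimension (U :: 'u::infinite itself) G \<le> enat n"
proof -
  obtain i :: "('a \<times> 'x \<times> 'a \<Rightarrow>\<^sub>0 int) \<Rightarrow> 'u" where inj: "\<And>n. inj_on i (carrier (F n))"
    using embedding by blast
  have "carrier (transport i (F k)) = {\<zero>\<^bsub>transport i (F k)\<^esub>}" if "k > n" for k
    using assms[OF that] by (simp add: transport_def free_bimodule_def)
  with projective_resolution_transport[OF inj] show ?thesis
    unfolding hochschild_dimension_def projective_dimension_def by (intro Inf_lower) blast
qed

text \<open>Applying \<open>Hom(-, \<int>/m)\<close> to the resolution gives zero differentials in high degrees,
  which rules out a contraction.\<close>

lemma hochschild_dimension_infinite: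
  assumes x: "\<And>k. k \<ge> l \<Longrightarrow> X k = {x}"
    and m: "\<not> m dvd 1" and dvd: "\<And>k z. k \<ge> l \<Longrightarrow> z \<in> carrier (F (Suc k)) \<Longrightarrow> m dvd augmentation (d k z)"
  shows "hochschild_dimension (U :: 'u::infinite itself) G = \<infinity>"
proof -
  obtain i :: "('a \<times> 'x \<times> 'a \<Rightarrow>\<^sub>0 int) \<Rightarrow> 'u" where inj: "\<And>n. inj_on i (carrier (F n))"
    using embedding by blast
  let ?j = "\<lambda>n. inv_into (carrier (F n)) i"
  have False
    if Q: "projective_resolution E (regular_bimodule G) (Q :: nat \<Rightarrow> (_, 'u) module) d' e'"
      and zero: "\<forall>k>n. carrier (Q k) = {\<zero>\<^bsub>Q k\<^esub>}" for n Q d' e'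
  proof -
    note T = transport_hom[OF left_module_F inj] and T' = transport_inv_hom[OF left_module_F inj]
    from contraction_above_dimension[OF projective_resolution_transport[OF inj] Q zero]
    obtain h where h: "\<And>k. h k \<in> left_module_hom E (transport i (F k)) (transport i (F (Suc k)))"
      and contr: "\<forall>k\<ge>n. \<forall>x\<in>carrier (transport i (F (Suc k))).
        x = i (d (Suc k) (?j (Suc (Suc k)) (h (Suc k) x))) \<oplus>\<^bsub>transport i (F (Suc k))\<^esub>
          h k (i (d k (?j (Suc k) x)))"
      by (elim exE conjE) blast
    define H where "H k z = ?j (Suc k) (h k (i z))" for k z
    have H: "H k \<in> left_module_hom E (F k) (F (Suc k))" for k
      unfolding H_def by (rule left_module_hom_compose[OF left_module_hom_compose[OF T h] T'])
    \<comment> \<open>High enough for the rank to be one and for the contraction to be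
      valid.\<close>
    define k where "k = max l n"
    have k: "k \<ge> l" "k \<ge> n" by (simp_all add: k_def)
    let ?g = "generator x :: 'a \<times> 'x \<times> 'a \<Rightarrow>\<^sub>0 int"
    have Fx: "F k = free_bimodule G {x}" "F (Suc k) = free_bimodule G {x}" "F (Suc (Suc k)) = free_bimodule G {x}"
      using x k by simp_all
    have g: "?g \<in> carrier (F (Suc k))" unfolding Fx by (rule generator_closed) simp
    have ig: "i ?g \<in> carrier (transport i (F (Suc k)))" by (rule homD(1)[OF T g])
    have jg: "?j (Suc k) (i ?g) = ?g" by (rule inv_into_f_f[OF inj g])
    have "?j (Suc k) (i ?g) = ?j (Suc k) (i (d (Suc k) (H (Suc k) ?g)) \<oplus>\<^bsub>transport i (F (Suc k))\<^esub> h k (i (d k ?g)))"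
      using arg_cong[OF contr[rule_format, OF k(2) ig], of "?j (Suc k)"] unfolding H_def jg .
    also have "\<dots> = ?j (Suc k) (i (d (Suc k) (H (Suc k) ?g))) \<oplus>\<^bsub>F (Suc k)\<^esub> H k (d k ?g)"
      unfolding H_def[of k]
      by (rule homD(2)[OF T' homD(1)[OF T homD(1)[OF d_hom homD(1)[OF H g]]]
            homD(1)[OF h homD(1)[OF T homD(1)[OF d_hom g]]]])
    also have "?j (Suc k) (i (d (Suc k) (H (Suc k) ?g))) = d (Suc k) (H (Suc k) ?g)"
      by (rule inv_into_f_f[OF inj homD(1)[OF d_hom homD(1)[OF H g]]])
    finally have "?g = d (Suc k) (H (Suc k) ?g) + H k (d k ?g)"
      unfolding jg free_bimodule_simps(3) .
    \<comment> \<open>The generator has augmentation 1, while both summands involve a differential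
      and so have augmentation divisible by \<open>m\<close>.\<close>
    then have "augmentation ?g = augmentation (d (Suc k) (H (Suc k) ?g)) + augmentation (H k (d k ?g))"
      by (metis augmentation_simps(3))
    moreover have "m dvd augmentation (d (Suc k) (H (Suc k) ?g))"
      using dvd[of "Suc k", OF _ homD(1)[OF H g]] k by simp
    moreover have "m dvd augmentation (H k (d k ?g))"
    proof -
      have dg: "d k ?g \<in> carrier (free_bimodule G {x})"
        using homD(1)[OF d_hom g] unfolding Fx .
      have "augmentation (H k (d k ?g)) = augmentation (d k ?g) * augmentation (H k ?g)"
        using augmentation_hom[OF _ dg] H[of k] unfolding Fx .
      then show ?thesis using dvd[OF k(1) g] by simp
    qed
    ultimately have "m dvd augmentation ?g" by simp
    then show False using m by (simp add: generator_def)
  qed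
  then have none: "{enat n |n. \<exists>(P :: nat \<Rightarrow> (_, 'u) module) d e. projective_resolution E (regular_bimodule G) P d e \<and>
        (\<forall>k>n. carrier (P k) = {\<zero>\<^bsub>P k\<^esub>})} = {}"
    by blast
  show ?thesis
    unfolding hochschild_dimension_def projective_dimension_def none by (simp add: top_enat_def)
qed

end

section \<open>Free actions of a finite cyclic group\<close>

locale cyclic_action =
  fixes shift :: "'y \<Rightarrow> 'y" and Y :: "'y set" and m :: nat
  assumes shift_closed: "y \<in> Y \<Longrightarrow> shift y \<in> Y"
    and period: "y \<in> Y \<Longrightarrow> (shift ^^ m) y = y"
    and free: "y \<in> Y \<Longrightarrow> j < m \<Longrightarrow> (shift ^^ j) y = y \<Longrightarrow> j = 0"
    and pos: "m > 0"
begin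

definition difference :: "('y \<Rightarrow>\<^sub>0 int) \<Rightarrow> ('y \<Rightarrow>\<^sub>0 int)" where
  "difference = frag_extend (\<lambda>y. frag_of (shift y) - frag_of y)"

definition orbit_sum :: "('y \<Rightarrow>\<^sub>0 int) \<Rightarrow> ('y \<Rightarrow>\<^sub>0 int)" where
  "orbit_sum = frag_extend (\<lambda>y. \<Sum>j<m. frag_of ((shift ^^ j) y))"

lemma pow_closed: "y \<in> Y \<Longrightarrow> (shift ^^ j) y \<in> Y"
  by (induction j) (simp_all add: shift_closed)

lemma pow_mod: "y \<in> Y \<Longrightarrow> (shift ^^ (j mod m)) y = (shift ^^ j) y"
  by (rule funpow_mod_eq) (rule period)

lemma pow_inj:
  assumes y: "y \<in> Y" and ij: "i < m" "j < m" and eq: "(shift ^^ i) y = (shift ^^ j) y"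
  shows "i = j"
proof -
  have *: "i = j" if "i \<le> j" "i < m" "j < m" "(shift ^^ i) y = (shift ^^ j) y" for i j
  proof -
    have "(shift ^^ (m - i + i)) y = (shift ^^ (m - i + j)) y"
      using that(4) unfolding funpow_add by simp
    then have "y = (shift ^^ (j - i + m)) y" using that period[OF y] by (simp add: add.commute)
    then have eq: "(shift ^^ (j - i)) y = y" unfolding funpow_add using period[OF y] by simp
    have "j - i < m" using that by simp
    from free[OF y this eq] that(1) show ?thesis by simp
  qed
  show ?thesis using *[of i j] *[of j i] ij eq by (cases "i \<le> j") simp_all
qed

text \<open>The choice is made from the orbit as a set, so all points of an orbit in
  \<open>Y\<close> receive the same base point.\<close>

definition base :: "'y \<Rightarrow> 'y" where
  "base y = (SOME x. x \<in> range (\<lambda>i. (shift ^^ i) y))"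

definition index :: "'y \<Rightarrow> nat" where
  "index y = (THE i. i < m \<and> (shift ^^ i) (base y) = y)"

lemma base_eq_pow: obtains k where "base y = (shift ^^ k) y"
proof -
  have "base y \<in> range (\<lambda>i. (shift ^^ i) y)" unfolding base_def by (rule someI_ex) blast
  then show thesis using that by blast
qed

lemma base_closed: "y \<in> Y \<Longrightarrow> base y \<in> Y"
  using base_eq_pow[of y] pow_closed by metis

lemma base_shift:
  assumes y: "y \<in> Y"
  shows "base (shift y) = base y"
proof -
  have "range (\<lambda>i. (shift ^^ i) (shift y)) = range (\<lambda>i. (shift ^^ i) y)"
  proof (intro equalityI subsetI)
    fix x assume "x \<in> range (\<lambda>i. (shift ^^ i) (shift y))"
    then obtain i where "x = (shift ^^ i) (shift y)" by blast
    then have "x = (shift ^^ Suc i) y" by (simp add: funpow_swap1)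
    then show "x \<in> range (\<lambda>i. (shift ^^ i) y)" by blast
  next
    fix x assume "x \<in> range (\<lambda>i. (shift ^^ i) y)"
    then obtain i where x: "x = (shift ^^ i) y" by blast
    have "y = (shift ^^ (m - 1)) (shift y)"
      using period[OF y] pos by (metis Suc_pred' comp_apply funpow_Suc_right)
    then have "x = (shift ^^ (i + (m - 1))) (shift y)" unfolding x funpow_add by simp
    then show "x \<in> range (\<lambda>i. (shift ^^ i) (shift y))" by blast
  qed
  then show ?thesis by (simp add: base_def)
qed

lemma index_props:
  assumes y: "y \<in> Y"
  shows "index y < m" "(shift ^^ index y) (base y) = y"
proof -
  obtain k where k: "base y = (shift ^^ k) y" by (rule base_eq_pow)
  \<comment> \<open>The base point lies \<open>k\<close> steps after \<open>y\<close>; another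
    \<open>(m - 1) * k\<close> steps complete a multiple of the period and return to
    \<open>y\<close>.\<close>
  have "(shift ^^ ((m - 1) * k)) (base y) = (shift ^^ ((m - 1) * k + k)) y"
    unfolding k funpow_add by simp
  also have "(m - 1) * k + k = m * k" using pos by (cases m) simp_all
  also have "(shift ^^ (m * k)) y = y" using pow_mod[OF y, of "m * k"] by simp
  finally have "(shift ^^ ((m - 1) * k mod m)) (base y) = y"
    using pow_mod[OF base_closed[OF y]] by simp
  then have ex: "((m - 1) * k mod m) < m \<and> (shift ^^ ((m - 1) * k mod m)) (base y) = y" using pos by simp
  have "index y < m \<and> (shift ^^ index y) (base y) = y"
    unfolding index_def
    by (rule theI[of _ "(m - 1) * k mod m"], rule ex) (use pow_inj[OF base_closed[OF y]] ex in metis)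
  then show "index y < m" "(shift ^^ index y) (base y) = y" by simp_all
qed

lemma index_eq:
  assumes "y \<in> Y" "i < m" "(shift ^^ i) (base y) = y"
  shows "index y = i"
  using pow_inj[OF base_closed[OF assms(1)] index_props(1)[OF assms(1)] assms(2)]
    index_props(2)[OF assms(1)] assms(3) by simp

lemma index_shift:
  assumes y: "y \<in> Y"
  shows "index (shift y) = (if Suc (index y) = m then 0 else Suc (index y))"
proof (rule index_eq[OF shift_closed[OF y]])
  have "(shift ^^ Suc (index y)) (base y) = shift y" using index_props(2)[OF y] by simp
  then show "(shift ^^ (if Suc (index y) = m then 0 else Suc (index y))) (base (shift y)) = shift y"
    using period[OF base_closed[OF y]] by (cases "Suc (index y) = m") (auto simp: base_shift[OF y])
qed (use index_props(1)[OF y] pos in auto)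

text \<open>On an orbit with base point \<open>x\<close>, the contracting homotopy sends \<open>shift\<^sup>j x\<close> to the sum of
  \<open>shift\<^sup>i x\<close> over \<open>i < j\<close> in one degree, and to \<open>x\<close> if \<open>j = m - 1\<close> and to \<open>0\<close> otherwise in the next.\<close>

definition partial_orbit :: "('y \<Rightarrow>\<^sub>0 int) \<Rightarrow> ('y \<Rightarrow>\<^sub>0 int)" where
  "partial_orbit = frag_extend (\<lambda>y. \<Sum>i<index y. frag_of ((shift ^^ i) (base y)))"

definition last_base :: "('y \<Rightarrow>\<^sub>0 int) \<Rightarrow> ('y \<Rightarrow>\<^sub>0 int)" where
  "last_base = frag_extend (\<lambda>y. if Suc (index y) = m then frag_of (base y) else 0)"

lemma keys_sum_frag_of: "(\<And>i. i \<in> I \<Longrightarrow> f i \<in> S) \<Longrightarrow> Poly_Mapping.keys (\<Sum>i\<in>I. frag_of (f i)) \<subseteq> S"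
proof (induction I rule: infinite_finite_induct)
  case (insert x I)
  then show ?case
    using keys_add[of "frag_of (f x)" "\<Sum>i\<in>I. frag_of (f i)"] by auto
qed simp_all

lemma keys_closed:
  assumes "Poly_Mapping.keys z \<subseteq> Y"
  shows "Poly_Mapping.keys (orbit_sum z) \<subseteq> Y" "Poly_Mapping.keys (partial_orbit z) \<subseteq> Y"
    "Poly_Mapping.keys (last_base z) \<subseteq> Y"
  unfolding orbit_sum_def partial_orbit_def last_base_def
  by (intro keys_frag_extend_subset keys_sum_frag_of; use assms pow_closed base_closed in \<open>auto split: if_splits\<close>)+

lemma orbit_sum_shift:
  assumes y: "y \<in> Y"
  shows "orbit_sum (frag_of (shift y)) = orbit_sum (frag_of y)"
proof -
  have "(\<Sum>j<m. frag_of ((shift ^^ j) (shift y))) + frag_of y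
      = (\<Sum>j<m. frag_of ((shift ^^ Suc j) y)) + frag_of ((shift ^^ 0) y)"
    by (simp add: funpow_swap1)
  also have "\<dots> = (\<Sum>j<Suc m. frag_of ((shift ^^ j) y))"
    by (simp only: sum.lessThan_Suc_shift add.commute)
  also have "\<dots> = (\<Sum>j<m. frag_of ((shift ^^ j) y)) + frag_of y"
    using period[OF y] by simp
  finally show ?thesis by (simp add: orbit_sum_def)
qed

lemma orbit_sum_pow: "y \<in> Y \<Longrightarrow> orbit_sum (frag_of ((shift ^^ j) y)) = orbit_sum (frag_of y)"
  by (induction j) (simp_all add: orbit_sum_shift pow_closed)

lemma orbit_sum_difference:
  assumes "Poly_Mapping.keys z \<subseteq> Y"
  shows "orbit_sum (difference z) = 0"
proof -
  have "orbit_sum (difference z) = frag_extend (\<lambda>_. 0) z"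
    by (rule frag_additive_eq[OF assms])
      (simp_all add: difference_def orbit_sum_def frag_extend_diff orbit_sum_shift[unfolded orbit_sum_def, simplified])
  then show ?thesis by (simp add: frag_extend_eq_0)
qed

lemma difference_orbit_sum:
  assumes "Poly_Mapping.keys z \<subseteq> Y"
  shows "difference (orbit_sum z) = 0"
proof -
  have "difference (orbit_sum z) = frag_extend (\<lambda>_. 0) z"
  proof (rule frag_additive_eq[OF assms])
    fix y assume y: "y \<in> Y"
    have "difference (orbit_sum (frag_of y)) = (\<Sum>j<m. frag_of ((shift ^^ Suc j) y) - frag_of ((shift ^^ j) y))"
      by (simp add: difference_def orbit_sum_def frag_extend_sum)
    also have "\<dots> = frag_of ((shift ^^ m) y) - frag_of ((shift ^^ 0) y)"
      by (rule sum_lessThan_telescope)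
    finally show "difference (orbit_sum (frag_of y)) = frag_extend (\<lambda>_. 0) (frag_of y)"
      using period[OF y] by simp
  qed (simp_all add: difference_def orbit_sum_def frag_extend_diff)
  then show ?thesis by (simp add: frag_extend_eq_0)
qed

text \<open>The first summand telescopes to \<open>y\<close> minus its base point. The orbit sum
  passes through the last position of the orbit exactly once, so the second summand restores the
  base point.\<close>

lemma homotopy_difference:
  assumes "Poly_Mapping.keys z \<subseteq> Y"
  shows "z = difference (partial_orbit z) + last_base (orbit_sum z)"
proof (rule frag_additive_eq[OF assms, of "\<lambda>z. z"])
  fix y assume y: "y \<in> Y"
  let ?x = "base y"
  have x: "?x \<in> Y" by (rule base_closed[OF y])
  have "difference (partial_orbit (frag_of y)) =
      (\<Sum>i<index y. frag_of ((shift ^^ Suc i) ?x) - frag_of ((shift ^^ i) ?x))"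
    by (simp add: difference_def partial_orbit_def frag_extend_sum)
  also have "\<dots> = frag_of ((shift ^^ index y) ?x) - frag_of ((shift ^^ 0) ?x)"
    by (rule sum_lessThan_telescope)
  finally have 1: "difference (partial_orbit (frag_of y)) = frag_of y - frag_of ?x"
    using index_props(2)[OF y] by simp
  have base_pow: "base ((shift ^^ j) ?x) = ?x" for j
  proof -
    have "base ((shift ^^ j) ?x) = base ?x" for j
      by (induction j) (simp_all add: base_shift pow_closed x)
    from this[of j] this[of "index y"] show ?thesis using index_props(2)[OF y] by simp
  qed
  have index_pow: "index ((shift ^^ j) ?x) = j" if "j < m" for j
    by (rule index_eq[OF pow_closed[OF x] that]) (simp add: base_pow)
  have "orbit_sum (frag_of y) = orbit_sum (frag_of ?x)"
    using orbit_sum_pow[OF x, of "index y"] index_props(2)[OF y] by simp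
  then have "last_base (orbit_sum (frag_of y)) =
      (\<Sum>j<m. if Suc (index ((shift ^^ j) ?x)) = m then frag_of (base ((shift ^^ j) ?x)) else 0)"
    by (simp add: orbit_sum_def last_base_def frag_extend_sum)
  also have "\<dots> = (\<Sum>j<m. if j = m - 1 then frag_of ?x else 0)"
    by (rule sum.cong) (use pos in \<open>auto simp: index_pow base_pow\<close>)
  also have "\<dots> = frag_of ?x" using pos by simp
  finally show "frag_of y = difference (partial_orbit (frag_of y)) + last_base (orbit_sum (frag_of y))"
    using 1 by simp
qed (simp_all add: difference_def partial_orbit_def last_base_def orbit_sum_def frag_extend_diff)

text \<open>Passing from \<open>y\<close> to \<open>shift y\<close> lengthens the partial sum by
  \<open>y\<close>, except at the end of the orbit, where the index falls back to 0; there the full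
  orbit sum makes up for the lost partial sum.\<close>

lemma homotopy_orbit_sum:
  assumes "Poly_Mapping.keys z \<subseteq> Y"
  shows "z = partial_orbit (difference z) + orbit_sum (last_base z)"
proof (rule frag_additive_eq[OF assms, of "\<lambda>z. z"])
  fix y assume y: "y \<in> Y"
  let ?x = "base y"
  let ?S = "\<lambda>n. \<Sum>i<n. frag_of ((shift ^^ i) ?x)"
  have P: "partial_orbit (difference (frag_of y)) = ?S (index (shift y)) - ?S (index y)"
    by (simp add: difference_def partial_orbit_def frag_extend_diff base_shift[OF y])
  have S: "?S (Suc (index y)) = ?S (index y) + frag_of y"
    using index_props(2)[OF y] by simp
  show "frag_of y = partial_orbit (difference (frag_of y)) + orbit_sum (last_base (frag_of y))"
  proof (cases "Suc (index y) = m")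
    case True
    then have "orbit_sum (last_base (frag_of y)) = ?S (Suc (index y))"
      by (simp add: orbit_sum_def last_base_def del: sum.lessThan_Suc)
    then show ?thesis using True P S index_shift[OF y] by simp
  next
    case False
    then have "orbit_sum (last_base (frag_of y)) = 0"
      by (simp add: orbit_sum_def last_base_def)
    moreover have "index (shift y) = Suc (index y)" using False index_shift[OF y] by simp
    ultimately show ?thesis using P S by (simp del: sum.lessThan_Suc)
  qed
qed (simp_all add: difference_def partial_orbit_def last_base_def orbit_sum_def frag_extend_diff)

lemma kernel_orbit_sum:
  assumes "Poly_Mapping.keys z \<subseteq> Y" "orbit_sum z = 0"
  shows "\<exists>w. Poly_Mapping.keys w \<subseteq> Y \<and> difference w = z"
  using homotopy_difference[OF assms(1)] assms(2) keys_closed(2)[OF assms(1)]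
  by (intro exI[of _ "partial_orbit z"]) (simp add: last_base_def)

lemma kernel_difference:
  assumes "Poly_Mapping.keys z \<subseteq> Y" "difference z = 0"
  shows "\<exists>w. Poly_Mapping.keys w \<subseteq> Y \<and> orbit_sum w = z"
  using homotopy_orbit_sum[OF assms(1)] assms(2) keys_closed(3)[OF assms(1)]
  by (intro exI[of _ "last_base z"]) (simp add: partial_orbit_def)

end


section \<open>Special one-relator monoids\<close>

locale special_monoid =
  fixes A :: "'a set" and r :: "'a list"
  assumes relator: "r \<in> lists A"
begin

abbreviation C where "C \<equiv> generated_congruence A {(r, [])}"
abbreviation G where "G \<equiv> one_relator_monoid A r"

sublocale monoid G
  unfolding one_relator_monoid_def by (rule monoid_presented_monoid)

definition cls :: "'a list \<Rightarrow> 'a list set" where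
  "cls w = C `` {w}"

lemma congruence_lists: "(u, v) \<in> C \<Longrightarrow> u \<in> lists A \<and> v \<in> lists A"
  by (induction rule: generated_congruence.induct) auto

lemma cls_closed: "u \<in> lists A \<Longrightarrow> cls u \<in> carrier G"
  by (auto simp: cls_def one_relator_monoid_def presented_monoid_def quotient_def)

lemma cls_mult: "u \<in> lists A \<Longrightarrow> v \<in> lists A \<Longrightarrow> cls u \<otimes>\<^bsub>G\<^esub> cls v = cls (u @ v)"
  unfolding cls_def one_relator_monoid_def by (rule presented_monoid_mult_class)

lemma cls_Nil: "cls [] = \<one>\<^bsub>G\<^esub>"
  by (simp add: cls_def one_relator_monoid_def presented_monoid_def)

lemma cls_eq_iff: "u \<in> lists A \<Longrightarrow> v \<in> lists A \<Longrightarrow> cls u = cls v \<longleftrightarrow> (u, v) \<in> C"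
  unfolding cls_def by (rule eq_equiv_class_iff[OF generated_congruence_equiv])

lemma cls_relator: "cls r = \<one>\<^bsub>G\<^esub>"
  using relator cls_Nil by (metis cls_eq_iff generated_congruence.gen insertI1 lists.Nil)

definition word :: "'a list set \<Rightarrow> 'a list" where
  "word x = (SOME u. u \<in> lists A \<and> cls u = x)"

lemma word_props:
  assumes "x \<in> carrier G"
  shows "word x \<in> lists A" "cls (word x) = x"
proof -
  have "\<exists>u. u \<in> lists A \<and> cls u = x"
    using assms by (auto simp: cls_def one_relator_monoid_def presented_monoid_def quotient_def)
  then have "word x \<in> lists A \<and> cls (word x) = x"
    unfolding word_def by (rule someI_ex)
  then show "word x \<in> lists A" "cls (word x) = x" by simp_all
qed

lemma countable_carrier:
  assumes "finite A"
  shows "countable (carrier G)"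
proof -
  have "carrier G \<subseteq> cls ` lists A"
  proof
    fix x assume "x \<in> carrier G"
    from word_props[OF this] show "x \<in> cls ` lists A" by (intro image_eqI[of x cls "word x"]) simp_all
  qed
  moreover have "countable (cls ` lists A)"
    using assms by (intro countable_image countable_lists countable_finite)
  ultimately show ?thesis by (rule countable_subset)
qed

text \<open>The two-sided derivative: one term for each factorisation of the word as
  \<open>u @ [a] @ v\<close>, with outer factors \<open>p u\<close> and \<open>v q\<close>. Letters
  are tagged by \<open>Some\<close>, and \<open>None\<close> is the sole basis element in the
  degrees of rank one.\<close>

primrec der :: "'a list set \<Rightarrow> 'a list \<Rightarrow> 'a list set \<Rightarrow> ('a list set \<times> 'a option \<times> 'a list set) \<Rightarrow>\<^sub>0 int" where
  "der p [] q = 0"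
| "der p (a # w) q = frag_of (p, Some a, cls w \<otimes>\<^bsub>G\<^esub> q) + der (p \<otimes>\<^bsub>G\<^esub> cls [a]) w q"

lemma cls_Cons_mult:
  assumes "a \<in> A" "w \<in> lists A" "p \<in> carrier G"
  shows "p \<otimes>\<^bsub>G\<^esub> cls [a] \<otimes>\<^bsub>G\<^esub> cls w = p \<otimes>\<^bsub>G\<^esub> cls (a # w)"
proof -
  have "p \<otimes>\<^bsub>G\<^esub> cls [a] \<otimes>\<^bsub>G\<^esub> cls w = p \<otimes>\<^bsub>G\<^esub> (cls [a] \<otimes>\<^bsub>G\<^esub> cls w)"
    using assms by (intro m_assoc cls_closed) simp_all
  also have "cls [a] \<otimes>\<^bsub>G\<^esub> cls w = cls (a # w)"
    using assms by (simp add: cls_mult)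
  finally show ?thesis .
qed

lemma der_append:
  assumes "p \<in> carrier G" "q \<in> carrier G" "u \<in> lists A" "v \<in> lists A"
  shows "der p (u @ v) q = der p u (cls v \<otimes>\<^bsub>G\<^esub> q) + der (p \<otimes>\<^bsub>G\<^esub> cls u) v q"
  using assms
proof (induction u arbitrary: p)
  case Nil
  then show ?case by (simp add: cls_Nil)
next
  case (Cons a u)
  then have a: "a \<in> A" "u \<in> lists A" by simp_all
  have "cls (u @ v) \<otimes>\<^bsub>G\<^esub> q = cls u \<otimes>\<^bsub>G\<^esub> (cls v \<otimes>\<^bsub>G\<^esub> q)"
    using Cons.prems a by (simp add: cls_mult[symmetric] m_assoc cls_closed)
  moreover have "der (p \<otimes>\<^bsub>G\<^esub> cls [a]) (u @ v) q =
      der (p \<otimes>\<^bsub>G\<^esub> cls [a]) u (cls v \<otimes>\<^bsub>G\<^esub> q) + der (p \<otimes>\<^bsub>G\<^esub> cls [a] \<otimes>\<^bsub>G\<^esub> cls u) v q"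
    using Cons.prems a by (intro Cons.IH m_closed cls_closed) simp_all
  ultimately show ?case using cls_Cons_mult[OF a Cons.prems(1)] by (simp add: add.assoc)
qed

lemma der_sum:
  assumes "p \<in> carrier G" "w \<in> lists A"
  shows "der p w q = (\<Sum>i<length w. frag_of (p \<otimes>\<^bsub>G\<^esub> cls (take i w), Some (w ! i), cls (drop (Suc i) w) \<otimes>\<^bsub>G\<^esub> q))"
  using assms
proof (induction w arbitrary: p)
  case (Cons a w)
  then have a: "a \<in> A" "w \<in> lists A" by simp_all
  have IH: "der (p \<otimes>\<^bsub>G\<^esub> cls [a]) w q = (\<Sum>i<length w. frag_of (p \<otimes>\<^bsub>G\<^esub> cls [a] \<otimes>\<^bsub>G\<^esub> cls (take i w), Some (w ! i), cls (drop (Suc i) w) \<otimes>\<^bsub>G\<^esub> q))"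
    using Cons.prems a by (intro Cons.IH m_closed cls_closed) simp_all
  have "p \<otimes>\<^bsub>G\<^esub> cls [a] \<otimes>\<^bsub>G\<^esub> cls (take i w) = p \<otimes>\<^bsub>G\<^esub> cls (a # take i w)" for i
    using a by (intro cls_Cons_mult Cons.prems(1)) (auto dest: in_set_takeD)
  with IH show ?case
    using Cons.prems(1) by (simp add: sum.lessThan_Suc_shift cls_Nil del: sum.lessThan_Suc)
qed simp

lemma take_drop_lists:
  assumes "w \<in> lists A"
  shows "take i w \<in> lists A" "drop i w \<in> lists A"
  using assms by (auto dest: in_set_takeD in_set_dropD)

lemma keys_der:
  assumes "p \<in> carrier G" "w \<in> lists A" "q \<in> carrier G"
  shows "Poly_Mapping.keys (der p w q) \<subseteq> carrier G \<times> Some ` A \<times> carrier G"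
  using assms
proof (induction w arbitrary: p)
  case (Cons a w)
  then have "Poly_Mapping.keys (der (p \<otimes>\<^bsub>G\<^esub> cls [a]) w q) \<subseteq> carrier G \<times> Some ` A \<times> carrier G"
    by (intro Cons.IH m_closed cls_closed) simp_all
  moreover have "(p, Some a, cls w \<otimes>\<^bsub>G\<^esub> q) \<in> carrier G \<times> Some ` A \<times> carrier G"
    using Cons.prems by (simp add: cls_closed)
  ultimately show ?case
    using keys_add[of "frag_of (p, Some a, cls w \<otimes>\<^bsub>G\<^esub> q)" "der (p \<otimes>\<^bsub>G\<^esub> cls [a]) w q"] by auto
qed simp

lemma der_equivariant:
  assumes "k \<in> carrier G" "n \<in> carrier G" "p \<in> carrier G" "q \<in> carrier G" "w \<in> lists A"
  shows "der (k \<otimes>\<^bsub>G\<^esub> p) w (q \<otimes>\<^bsub>G\<^esub> n) =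
    frag_extend (\<lambda>(p, x, q). frag_of (k \<otimes>\<^bsub>G\<^esub> p, x, q \<otimes>\<^bsub>G\<^esub> n)) (der p w q)"
  using assms
proof (induction w arbitrary: p)
  case (Cons a w)
  then have a: "a \<in> A" "w \<in> lists A" "cls [a] \<in> carrier G" "cls w \<in> carrier G" by (simp_all add: cls_closed)
  have "der (k \<otimes>\<^bsub>G\<^esub> (p \<otimes>\<^bsub>G\<^esub> cls [a])) w (q \<otimes>\<^bsub>G\<^esub> n) =
      frag_extend (\<lambda>(p, x, q). frag_of (k \<otimes>\<^bsub>G\<^esub> p, x, q \<otimes>\<^bsub>G\<^esub> n)) (der (p \<otimes>\<^bsub>G\<^esub> cls [a]) w q)"
    using Cons.prems a by (intro Cons.IH m_closed) simp_all
  with a Cons.prems show ?case by (simp add: frag_extend_add m_assoc)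
qed simp

definition d0 :: "('a list set \<times> 'a option \<times> 'a list set \<Rightarrow>\<^sub>0 int) \<Rightarrow> ('a list set \<times> 'a option \<times> 'a list set \<Rightarrow>\<^sub>0 int)" where
  "d0 = frag_extend (\<lambda>(p, x, q). case x of None \<Rightarrow> 0
    | Some a \<Rightarrow> frag_of (p \<otimes>\<^bsub>G\<^esub> cls [a], None, q) - frag_of (p, None, cls [a] \<otimes>\<^bsub>G\<^esub> q))"

definition aug :: "('a list set \<times> 'a option \<times> 'a list set \<Rightarrow>\<^sub>0 int) \<Rightarrow> ('a list set \<Rightarrow>\<^sub>0 int)" where
  "aug = frag_extend (\<lambda>(p, x, q). frag_of (p \<otimes>\<^bsub>G\<^esub> q))"

lemma d0_hom: "d0 \<in> left_module_hom E (free_bimodule G (Some ` A)) (free_bimodule G {None})"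
  unfolding d0_def
proof (rule frag_extend_hom_free)
  fix p x q assume a: "p \<in> carrier G" "x \<in> Some ` A" "q \<in> carrier G"
  then obtain b where b: "x = Some b" "cls [b] \<in> carrier G" using cls_closed by auto
  let ?f = "\<lambda>(p, x, q). case x of None \<Rightarrow> 0
    | Some a \<Rightarrow> frag_of (p \<otimes>\<^bsub>G\<^esub> cls [a], None, q) - frag_of (p, None, cls [a] \<otimes>\<^bsub>G\<^esub> q)"
  show "Poly_Mapping.keys (?f (p, x, q)) \<subseteq> carrier G \<times> {None} \<times> carrier G"
    using a b keys_diff[of "frag_of (p \<otimes>\<^bsub>G\<^esub> cls [b], None, q)" "frag_of (p, None, cls [b] \<otimes>\<^bsub>G\<^esub> q)"] by auto
  fix k n assume "k \<in> carrier G" "n \<in> carrier G"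
  with a b show "?f (k \<otimes>\<^bsub>G\<^esub> p, x, q \<otimes>\<^bsub>G\<^esub> n) =
      frag_extend (\<lambda>(p, x, q). frag_of (k \<otimes>\<^bsub>G\<^esub> p, x, q \<otimes>\<^bsub>G\<^esub> n)) (?f (p, x, q))"
    by (simp add: frag_extend_diff m_assoc)
qed

lemma aug_hom: "aug \<in> left_module_hom E (free_bimodule G {None}) (regular_bimodule G)"
  unfolding aug_def
  by (rule frag_extend_hom[where S = "carrier G" and act = "\<lambda>m n y. m \<otimes>\<^bsub>G\<^esub> y \<otimes>\<^bsub>G\<^esub> n"])
    (simp_all add: regular_bimodule_def monoid_ring_def m_assoc)

text \<open>Boundaries of consecutive terms telescope along the word; this is the fundamental
  formula of the free differential calculus.\<close>

lemma d0_der: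
  assumes "p \<in> carrier G" "q \<in> carrier G" "w \<in> lists A"
  shows "d0 (der p w q) = frag_of (p \<otimes>\<^bsub>G\<^esub> cls w, None, q) - frag_of (p, None, cls w \<otimes>\<^bsub>G\<^esub> q)"
  using assms
proof (induction w arbitrary: p)
  case Nil
  then show ?case by (simp add: d0_def cls_Nil)
next
  case (Cons a w)
  then have a: "a \<in> A" "w \<in> lists A" "cls [a] \<in> carrier G" "cls w \<in> carrier G" by (simp_all add: cls_closed)
  have "cls [a] \<otimes>\<^bsub>G\<^esub> (cls w \<otimes>\<^bsub>G\<^esub> q) = cls (a # w) \<otimes>\<^bsub>G\<^esub> q"
    using a Cons.prems cls_mult[of "[a]" w] by (simp add: m_assoc[symmetric])
  then have "d0 (frag_of (p, Some a, cls w \<otimes>\<^bsub>G\<^esub> q)) =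
      frag_of (p \<otimes>\<^bsub>G\<^esub> cls [a], None, cls w \<otimes>\<^bsub>G\<^esub> q) - frag_of (p, None, cls (a # w) \<otimes>\<^bsub>G\<^esub> q)"
    by (simp add: d0_def)
  moreover have "d0 (der (p \<otimes>\<^bsub>G\<^esub> cls [a]) w q) =
      frag_of (p \<otimes>\<^bsub>G\<^esub> cls [a] \<otimes>\<^bsub>G\<^esub> cls w, None, q) - frag_of (p \<otimes>\<^bsub>G\<^esub> cls [a], None, cls w \<otimes>\<^bsub>G\<^esub> q)"
    using Cons.prems a by (intro Cons.IH m_closed) simp_all
  moreover have "d0 (der p (a # w) q) = d0 (frag_of (p, Some a, cls w \<otimes>\<^bsub>G\<^esub> q)) + d0 (der (p \<otimes>\<^bsub>G\<^esub> cls [a]) w q)"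
    by (simp add: d0_def frag_extend_add)
  ultimately show ?case using cls_Cons_mult[OF a(1,2) Cons.prems(1)] by simp
qed

lemma aug_surj: "aug ` carrier (free_bimodule G {None}) = carrier (regular_bimodule G)"
proof
  show "aug ` carrier (free_bimodule G {None}) \<subseteq> carrier (regular_bimodule G)"
    using homD(1)[OF aug_hom] by blast
  show "carrier (regular_bimodule G) \<subseteq> aug ` carrier (free_bimodule G {None})"
  proof
    fix z assume "z \<in> carrier (regular_bimodule G)"
    then have z: "Poly_Mapping.keys z \<subseteq> carrier G" by (simp add: regular_bimodule_def monoid_ring_def)
    let ?w = "frag_extend (\<lambda>y. frag_of (\<one>\<^bsub>G\<^esub>, None, y)) z"
    have "?w \<in> carrier (free_bimodule G {None})"
      unfolding free_bimodule_simps mem_Collect_eq by (rule keys_frag_extend_subset) (use z in auto)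
    moreover have "z = aug ?w"
      by (rule frag_additive_eq[OF z, of "\<lambda>z. z"]) (simp_all add: aug_def frag_extend_diff)
    ultimately show "z \<in> aug ` carrier (free_bimodule G {None})" by blast
  qed
qed

text \<open>The first stage of a contracting homotopy, compatible with the right action only: the
  left factor is spelled out by its chosen word.\<close>

definition contraction :: "('a list set \<times> 'a option \<times> 'a list set \<Rightarrow>\<^sub>0 int) \<Rightarrow> ('a list set \<times> 'a option \<times> 'a list set \<Rightarrow>\<^sub>0 int)" where
  "contraction = frag_extend (\<lambda>(p, x, q). der \<one>\<^bsub>G\<^esub> (word p) q)"

lemma contraction_closed:
  assumes "z \<in> carrier (free_bimodule G {None})"
  shows "contraction z \<in> carrier (free_bimodule G (Some ` A))"
  unfolding free_bimodule_simps mem_Collect_eq contraction_def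
proof (rule keys_frag_extend_subset)
  fix y assume "y \<in> Poly_Mapping.keys z"
  with assms have "y \<in> carrier G \<times> {None} \<times> carrier G" by (auto simp: free_bimodule_simps)
  then obtain p q where "y = (p, None, q)" "p \<in> carrier G" "q \<in> carrier G" by auto
  then show "Poly_Mapping.keys (case y of (p, x, q) \<Rightarrow> der \<one>\<^bsub>G\<^esub> (word p) q) \<subseteq> carrier G \<times> Some ` A \<times> carrier G"
    using keys_der[OF one_closed word_props(1)] by simp
qed

lemma exact_0: "d0 ` carrier (free_bimodule G (Some ` A)) = {z \<in> carrier (free_bimodule G {None}). aug z = 0}"
proof (intro equalityI subsetI)
  fix z assume "z \<in> d0 ` carrier (free_bimodule G (Some ` A))"
  then obtain w where w: "w \<in> carrier (free_bimodule G (Some ` A))" "z = d0 w" by blast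
  then have keys: "Poly_Mapping.keys w \<subseteq> carrier G \<times> Some ` A \<times> carrier G" by (simp add: free_bimodule_simps)
  have "aug (d0 w) = frag_extend (\<lambda>_. 0) w"
    by (rule frag_additive_eq[OF keys])
      (auto simp: aug_def d0_def frag_extend_diff m_assoc cls_closed)
  then have "aug z = 0" using w(2) by (simp add: frag_extend_eq_0)
  with w homD(1)[OF d0_hom w(1)] show "z \<in> {z \<in> carrier (free_bimodule G {None}). aug z = 0}" by simp
next
  fix z assume z: "z \<in> {z \<in> carrier (free_bimodule G {None}). aug z = 0}"
  then have keys: "Poly_Mapping.keys z \<subseteq> carrier G \<times> {None} \<times> carrier G" by (simp add: free_bimodule_simps)
  \<comment> \<open>Modulo boundaries the left factor of a basis element moves into the right one.
    The last term is a section of \<open>aug\<close> that puts everything on the right.\<close>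
  have "z = d0 (contraction z) + frag_extend (\<lambda>y. frag_of (\<one>\<^bsub>G\<^esub>, None, y)) (aug z)"
  proof (rule frag_additive_eq[OF keys, of "\<lambda>z. z"])
    fix y :: "'a list set \<times> 'a option \<times> 'a list set"
    assume "y \<in> carrier G \<times> {None} \<times> carrier G"
    then obtain p q where y: "y = (p, None, q)" "p \<in> carrier G" "q \<in> carrier G" by auto
    then show "frag_of y = d0 (contraction (frag_of y)) + frag_extend (\<lambda>y. frag_of (\<one>\<^bsub>G\<^esub>, None, y)) (aug (frag_of y))"
      using d0_der[OF one_closed y(3) word_props(1)[OF y(2)]] word_props(2)[OF y(2)]
      by (simp add: contraction_def aug_def)
  qed (simp_all add: d0_def contraction_def aug_def frag_extend_diff)
  then have "z = d0 (contraction z)" using z by simp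
  with contraction_closed z show "z \<in> d0 ` carrier (free_bimodule G (Some ` A))" by blast
qed

text \<open>By the product rule, replacing a factor by a congruent one changes the derivative only
  by combinations of derivatives of the relator. Keeping the subgroup \<open>I\<close> arbitrary
  covers both the image of \<open>d1\<close> and, for the empty relator, the zero subgroup.\<close>

lemma der_congruence:
  assumes I: "0 \<in> I" "\<And>a b. a \<in> I \<Longrightarrow> b \<in> I \<Longrightarrow> a + b \<in> I" "\<And>a. a \<in> I \<Longrightarrow> - a \<in> I"
    and rel: "\<And>p q. p \<in> carrier G \<Longrightarrow> q \<in> carrier G \<Longrightarrow> der p r q \<in> I"
    and uv: "(u, v) \<in> C" and pq: "p \<in> carrier G" "q \<in> carrier G"
  shows "der p u q - der p v q \<in> I"
  using uv pq
proof (induction arbitrary: p q rule: generated_congruence.induct)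
  case (gen u v)
  then show ?case using rel by simp
next
  case (refl u)
  then show ?case using I(1) by simp
next
  case (sym u v)
  then have "- (der p u q - der p v q) \<in> I" by (intro I(3)) simp
  then show ?case by simp
next
  case (trans u v w)
  then have "(der p u q - der p v q) + (der p v q - der p w q) \<in> I" by (intro I(2)) simp_all
  then show ?case by simp
next
  case (mult u v u' v')
  have lists: "u \<in> lists A" "v \<in> lists A" "u' \<in> lists A" "v' \<in> lists A"
    using congruence_lists mult.hyps by blast+
  have eq: "cls u = cls v" "cls u' = cls v'" using lists mult.hyps by (simp_all add: cls_eq_iff)
  have "(der p u (cls u' \<otimes>\<^bsub>G\<^esub> q) - der p v (cls u' \<otimes>\<^bsub>G\<^esub> q)) + (der (p \<otimes>\<^bsub>G\<^esub> cls u) u' q - der (p \<otimes>\<^bsub>G\<^esub> cls u) v' q) \<in> I"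
    using mult.IH mult.prems lists by (intro I(2)) (simp_all add: cls_closed)
  moreover have "der p (u @ u') q - der p (v @ v') q =
      (der p u (cls u' \<otimes>\<^bsub>G\<^esub> q) - der p v (cls u' \<otimes>\<^bsub>G\<^esub> q)) + (der (p \<otimes>\<^bsub>G\<^esub> cls u) u' q - der (p \<otimes>\<^bsub>G\<^esub> cls u) v' q)"
    using mult.prems lists eq by (simp add: der_append)
  ultimately show ?case by simp
qed

text \<open>A cycle \<open>z\<close> equals \<open>z - contraction (d0 z)\<close>. On a basis
  element with factors \<open>p\<close>, \<open>a\<close>, \<open>q\<close> this expression compares
  the derivatives of two words for the same element: \<open>word p @ [a]\<close> and the word chosen
  for the product.\<close>

lemma kernel_d0:
  assumes I: "0 \<in> I" "\<And>a b. a \<in> I \<Longrightarrow> b \<in> I \<Longrightarrow> a + b \<in> I" "\<And>a. a \<in> I \<Longrightarrow> - a \<in> I"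
    and rel: "\<And>p q. p \<in> carrier G \<Longrightarrow> q \<in> carrier G \<Longrightarrow> der p r q \<in> I"
    and z: "z \<in> carrier (free_bimodule G (Some ` A))" "d0 z = 0"
  shows "z \<in> I"
proof -
  have "Poly_Mapping.keys z \<subseteq> carrier G \<times> Some ` A \<times> carrier G"
    using z(1) by (simp add: free_bimodule_simps)
  then have "z - contraction (d0 z) \<in> I"
  proof (induction z rule: frag_induction)
    case zero
    show ?case using I(1) by (simp add: d0_def contraction_def)
  next
    case (one y)
    then obtain p a q where y: "y = (p, Some a, q)" "p \<in> carrier G" "a \<in> A" "q \<in> carrier G" by auto
    have a: "[a] \<in> lists A" "cls [a] \<in> carrier G" "p \<otimes>\<^bsub>G\<^esub> cls [a] \<in> carrier G"
      using y by (simp_all add: cls_closed)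
    note p = word_props[OF y(2)] and pa = word_props[OF a(3)]
    have "cls (word p @ [a]) = cls (word (p \<otimes>\<^bsub>G\<^esub> cls [a]))"
      using p pa a cls_mult[OF p(1) a(1)] by simp
    then have "(word p @ [a], word (p \<otimes>\<^bsub>G\<^esub> cls [a])) \<in> C"
      using p(1) pa(1) a(1) by (simp add: cls_eq_iff)
    from der_congruence[OF I rel this one_closed y(4)]
    have mem: "der \<one>\<^bsub>G\<^esub> (word p @ [a]) q - der \<one>\<^bsub>G\<^esub> (word (p \<otimes>\<^bsub>G\<^esub> cls [a])) q \<in> I" by blast
    have der_a: "der \<one>\<^bsub>G\<^esub> (word p @ [a]) q = der \<one>\<^bsub>G\<^esub> (word p) (cls [a] \<otimes>\<^bsub>G\<^esub> q) + frag_of y"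
      using p a y by (simp add: der_append cls_Nil)
    have con: "contraction (d0 (frag_of y)) = der \<one>\<^bsub>G\<^esub> (word (p \<otimes>\<^bsub>G\<^esub> cls [a])) q - der \<one>\<^bsub>G\<^esub> (word p) (cls [a] \<otimes>\<^bsub>G\<^esub> q)"
      by (simp add: y contraction_def d0_def frag_extend_diff)
    show ?case using mem unfolding der_a con by (simp add: algebra_simps)
  next
    case (diff a b)
    then have "(a - contraction (d0 a)) + - (b - contraction (d0 b)) \<in> I" using I by blast
    moreover have "(a - contraction (d0 a)) + - (b - contraction (d0 b)) = a - b - contraction (d0 (a - b))"
      by (simp add: contraction_def d0_def frag_extend_diff)
    ultimately show ?case by (simp only:)
  qed
  then show ?thesis using z(2) by (simp add: contraction_def)
qed

end

section \<open>The resolution attached to the primitive root\<close>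

locale rooted_special_monoid = special_monoid A r + word_order s le
  for A :: "'a set" and r s :: "'a list" and le +
  fixes m :: nat
  assumes relator_eq: "r = concat (replicate m s)" and m_pos: "m > 0" and s_nonempty: "s \<noteq> []"
    and collision_free: "collisions = {}"
begin

lemma s_lists: "s \<in> lists A"
proof -
  obtain n where n: "m = Suc n" using m_pos by (cases m) simp_all
  show ?thesis using relator unfolding relator_eq n by simp
qed

lemma power_lists: "concat (replicate k s) \<in> lists A"
  using s_lists by (induction k) simp_all

definition t :: "'a list set" where
  "t = cls s"

lemma t_closed [simp]: "t \<in> carrier G"
  by (simp add: t_def cls_closed s_lists)

lemma t_pow: "t [^]\<^bsub>G\<^esub> k = cls (concat (replicate k s))"
proof (induction k)
  case 0
  show ?case by (simp add: cls_Nil)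
next
  case (Suc k)
  have "t [^]\<^bsub>G\<^esub> Suc k = t \<otimes>\<^bsub>G\<^esub> t [^]\<^bsub>G\<^esub> k" by (rule nat_pow_Suc2) simp
  then show ?case using Suc by (simp add: t_def cls_mult s_lists power_lists)
qed

lemma t_order: "t [^]\<^bsub>G\<^esub> m = \<one>\<^bsub>G\<^esub>"
  unfolding t_pow relator_eq[symmetric] by (rule cls_relator)

lemma t_pow_mult: "t [^]\<^bsub>G\<^esub> (m * k) = \<one>\<^bsub>G\<^esub>"
  using nat_pow_pow[OF t_closed, of m k] by (simp add: t_order)

lemma t_pow_left_inverse: "(t [^]\<^bsub>G\<^esub> (m - 1)) [^]\<^bsub>G\<^esub> j \<otimes>\<^bsub>G\<^esub> t [^]\<^bsub>G\<^esub> j = \<one>\<^bsub>G\<^esub>"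
  and t_pow_right_inverse: "t [^]\<^bsub>G\<^esub> j \<otimes>\<^bsub>G\<^esub> (t [^]\<^bsub>G\<^esub> (m - 1)) [^]\<^bsub>G\<^esub> j = \<one>\<^bsub>G\<^esub>" for j :: nat
proof -
  have 1: "(m - 1) * j + j = m * j" using m_pos by (cases m) simp_all
  have 2: "j + (m - 1) * j = m * j" using 1 by simp
  show "(t [^]\<^bsub>G\<^esub> (m - 1)) [^]\<^bsub>G\<^esub> j \<otimes>\<^bsub>G\<^esub> t [^]\<^bsub>G\<^esub> j = \<one>\<^bsub>G\<^esub>"
    unfolding nat_pow_pow[OF t_closed] nat_pow_mult[OF t_closed] 1 by (rule t_pow_mult)
  show "t [^]\<^bsub>G\<^esub> j \<otimes>\<^bsub>G\<^esub> (t [^]\<^bsub>G\<^esub> (m - 1)) [^]\<^bsub>G\<^esub> j = \<one>\<^bsub>G\<^esub>"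
    unfolding nat_pow_pow[OF t_closed] nat_pow_mult[OF t_closed] 2 by (rule t_pow_mult)
qed

lemma t_inverse: "t [^]\<^bsub>G\<^esub> (m - 1) \<otimes>\<^bsub>G\<^esub> t = \<one>\<^bsub>G\<^esub>" "t \<otimes>\<^bsub>G\<^esub> t [^]\<^bsub>G\<^esub> (m - 1) = \<one>\<^bsub>G\<^esub>"
  using t_pow_left_inverse[of "Suc 0"] t_pow_right_inverse[of "Suc 0"] by simp_all

text \<open>A prefix of \<open>s\<close> can be completed to \<open>s\<close>, whose class
  \<open>t\<close> is a unit; dually for suffixes on the left. This recovers outer factors once the
  order has fixed the position inside \<open>s\<close>.\<close>

lemma right_cancel:
  assumes "p \<in> carrier G" "p' \<in> carrier G" "i \<le> length s" "p \<otimes>\<^bsub>G\<^esub> cls (take i s) = p' \<otimes>\<^bsub>G\<^esub> cls (take i s)"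
  shows "p = p'"
proof -
  let ?u = "cls (take i s)" and ?v = "cls (drop i s)"
  have c: "?u \<in> carrier G" "?v \<in> carrier G" using take_drop_lists[OF s_lists] by (simp_all add: cls_closed)
  have uv: "?u \<otimes>\<^bsub>G\<^esub> ?v = t" using take_drop_lists[OF s_lists] by (simp add: cls_mult t_def)
  have "p \<otimes>\<^bsub>G\<^esub> t = p' \<otimes>\<^bsub>G\<^esub> t"
    using assms c by (simp flip: uv add: m_assoc[symmetric])
  then have "p \<otimes>\<^bsub>G\<^esub> t \<otimes>\<^bsub>G\<^esub> t [^]\<^bsub>G\<^esub> (m - 1) = p' \<otimes>\<^bsub>G\<^esub> t \<otimes>\<^bsub>G\<^esub> t [^]\<^bsub>G\<^esub> (m - 1)" by simp
  then show ?thesis using assms(1,2) by (simp only: m_assoc t_closed nat_pow_closed t_inverse r_one)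
qed

lemma left_cancel:
  assumes "q \<in> carrier G" "q' \<in> carrier G" "cls (drop i s) \<otimes>\<^bsub>G\<^esub> q = cls (drop i s) \<otimes>\<^bsub>G\<^esub> q'"
  shows "q = q'"
proof -
  let ?u = "cls (take i s)" and ?v = "cls (drop i s)"
  have c: "?u \<in> carrier G" "?v \<in> carrier G" using take_drop_lists[OF s_lists] by (simp_all add: cls_closed)
  have uv: "?u \<otimes>\<^bsub>G\<^esub> ?v = t" using take_drop_lists[OF s_lists] by (simp add: cls_mult t_def)
  have "t \<otimes>\<^bsub>G\<^esub> q = t \<otimes>\<^bsub>G\<^esub> q'"
    using assms c by (simp flip: uv add: m_assoc)
  then have "t [^]\<^bsub>G\<^esub> (m - 1) \<otimes>\<^bsub>G\<^esub> (t \<otimes>\<^bsub>G\<^esub> q) = t [^]\<^bsub>G\<^esub> (m - 1) \<otimes>\<^bsub>G\<^esub> (t \<otimes>\<^bsub>G\<^esub> q')" by simp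
  then show ?thesis using assms(1,2) by (simp only: m_assoc[symmetric] t_closed nat_pow_closed t_inverse l_one)
qed

text \<open>The relator is trivial for \<open>equal\<close> and its derivative is \<open>m\<close>
  times that of \<open>s\<close>; both facts spread through the congruence. The first part brings
  the order to the monoid, the second makes the Fox derivative modulo \<open>m\<close> an invariant
  of its elements.\<close>

lemma congruence_equal:
  "(u, v) \<in> C \<Longrightarrow> equal u v \<and> (\<exists>c. fox [] u - fox [] v = frag_cmul (int m) c)"
proof (induction rule: generated_congruence.induct)
  case (gen u v)
  have "equal (concat (replicate k s)) []" for k
    by (induction k) (use equal_append[OF equal_root] in auto)
  with gen show ?case by (auto simp: relator_eq fox_power)
next
  case (refl u)
  show ?case by (auto intro: exI[of _ 0])
next
  case (sym u v)
  then obtain c where c: "equal u v" "fox [] u - fox [] v = frag_cmul (int m) c" by blast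
  have "fox [] v - fox [] u = - (fox [] u - fox [] v)" by simp
  also have "\<dots> = frag_cmul (int m) (- c)" unfolding c(2) by (rule poly_mapping_eqI) simp
  finally show ?case using c(1) equal_sym by blast
next
  case (trans u v w)
  then obtain c c' where c: "equal u v" "equal v w" "fox [] u - fox [] v = frag_cmul (int m) c"
    "fox [] v - fox [] w = frag_cmul (int m) c'" by blast
  have "fox [] u - fox [] w = (fox [] u - fox [] v) + (fox [] v - fox [] w)" by simp
  also have "\<dots> = frag_cmul (int m) (c + c')" unfolding c frag_cmul_distrib2 ..
  finally show ?case using equal_trans[OF c(1,2)] by blast
next
  case (mult u v u' v')
  then obtain c c' where c: "equal u v" "equal u' v'" "fox [] u - fox [] v = frag_cmul (int m) c"
    "fox [] u' - fox [] v' = frag_cmul (int m) c'" by blast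
  have "translate u (fox [] u' - fox [] v') = fox u u' - fox u v'"
    using translate_fox[of u "[]"] by (simp add: translate_def frag_extend_diff)
  then have "fox u u' - fox u v' = frag_cmul (int m) (translate u c')"
    unfolding c(4) by (simp add: translate_def frag_extend_cmul)
  moreover have "fox [] (u @ u') - fox [] (v @ v') = (fox [] u - fox [] v) + (fox u u' - fox u v')"
    using fox_cong[OF c(1), of v'] by (simp add: fox_append)
  ultimately have "fox [] (u @ u') - fox [] (v @ v') = frag_cmul (int m) (c + translate u c')"
    by (simp add: c(3) frag_cmul_distrib2)
  with equal_append[OF c(1,2)] show ?case by blast
qed

text \<open>The derivative of \<open>s\<close> has a coefficient \<open>1\<close>, so \<open>s\<^sup>j q = q\<close> forces \<open>m\<close> to divide \<open>j\<close>.\<close>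

lemma t_pow_fixes:
  assumes q: "q \<in> carrier G" and eq: "t [^]\<^bsub>G\<^esub> j \<otimes>\<^bsub>G\<^esub> q = q" and j: "j < m"
  shows "j = 0"
proof -
  define w where "w = word q"
  have w: "w \<in> lists A" "cls w = q" using word_props[OF q] by (simp_all add: w_def)
  let ?p = "concat (replicate j s)"
  have "cls (?p @ w) = cls w"
    using eq w power_lists by (simp add: t_pow cls_mult[symmetric])
  moreover have "?p @ w \<in> lists A" using w power_lists by simp
  ultimately have "(?p @ w, w) \<in> C" using cls_eq_iff w(1) by blast
  then obtain c where c: "fox [] (?p @ w) - fox [] w = frag_cmul (int m) c"
    using congruence_equal by blast
  have "equal ?p []" by (induction j) (use equal_append[OF equal_root] in auto)
  then have "fox ?p w = fox [] w" by (rule fox_cong)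
  then have "frag_cmul (int j) (fox [] s) = frag_cmul (int m) c"
    using c by (simp add: fox_append fox_power)
  then have "Poly_Mapping.lookup (frag_cmul (int j) (fox [] s)) (hd s, rep []) = Poly_Mapping.lookup (frag_cmul (int m) c) (hd s, rep [])"
    by simp
  moreover have "Poly_Mapping.lookup (fox [] s) (hd s, rep []) = 1"
  proof -
    \<comment> \<open>Position 0 has the empty prefix; a later occurrence of the first letter with
      trivial prefix would collide with it.\<close>
    have "{i. i < length s \<and> s ! i = hd s \<and> rep ([] @ take i s) = rep []} = {0}"
    proof (intro equalityI subsetI)
      fix i assume i: "i \<in> {i. i < length s \<and> s ! i = hd s \<and> rep ([] @ take i s) = rep []}"
      then have "i = 0 \<or> (i, 0) \<in> collisions"
        using s_nonempty by (auto simp: collisions_def rep_eq_iff hd_conv_nth)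
      with collision_free show "i \<in> {0}" by simp
    qed (use s_nonempty in \<open>simp add: hd_conv_nth\<close>)
    then show ?thesis by (simp add: lookup_fox)
  qed
  ultimately have "int j = int m * Poly_Mapping.lookup c (hd s, rep [])" by simp
  then have "int m dvd int j" by simp
  with j show ?thesis by (auto dest: dvd_imp_le)
qed

definition shift :: "'a list set \<times> 'x \<times> 'a list set \<Rightarrow> 'a list set \<times> 'x \<times> 'a list set" where
  "shift = (\<lambda>(p, x, q). (p \<otimes>\<^bsub>G\<^esub> t, x, t [^]\<^bsub>G\<^esub> (m - 1) \<otimes>\<^bsub>G\<^esub> q))"

lemma shift_pow:
  assumes "p \<in> carrier G" "q \<in> carrier G"
  shows "(shift ^^ j) (p, x, q) = (p \<otimes>\<^bsub>G\<^esub> t [^]\<^bsub>G\<^esub> j, x, (t [^]\<^bsub>G\<^esub> (m - 1)) [^]\<^bsub>G\<^esub> j \<otimes>\<^bsub>G\<^esub> q)"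
proof (induction j)
  case (Suc j)
  have "(t [^]\<^bsub>G\<^esub> (m - 1)) [^]\<^bsub>G\<^esub> Suc j = t [^]\<^bsub>G\<^esub> (m - 1) \<otimes>\<^bsub>G\<^esub> (t [^]\<^bsub>G\<^esub> (m - 1)) [^]\<^bsub>G\<^esub> j"
    by (rule nat_pow_Suc2) simp
  with Suc assms show ?case by (simp add: shift_def m_assoc)
qed (use assms in simp)

sublocale cyclic_action shift "carrier G \<times> X \<times> carrier G" m for X :: "'x set"
proof
  fix y :: "'a list set \<times> 'x \<times> 'a list set" assume "y \<in> carrier G \<times> X \<times> carrier G"
  then obtain p x q where y: "y = (p, x, q)" "p \<in> carrier G" "x \<in> X" "q \<in> carrier G" by auto
  show "shift y \<in> carrier G \<times> X \<times> carrier G" using y by (simp add: shift_def)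
  show "(shift ^^ m) y = y"
    using y shift_pow[OF y(2,4), of m x] t_pow_left_inverse[of m] by (simp add: t_order)
  show "j = 0" if "j < m" "(shift ^^ j) y = y" for j
  proof (rule t_pow_fixes[OF y(4) _ that(1)])
    have "(t [^]\<^bsub>G\<^esub> (m - 1)) [^]\<^bsub>G\<^esub> j \<otimes>\<^bsub>G\<^esub> q = q"
      using that(2) y shift_pow[OF y(2,4), of j x] by simp
    \<comment> \<open>Freeness is read off the right factor alone: multiplying by the power of
      \<open>t\<close> turns its invariance into the hypothesis of
      \<open>t_pow_fixes\<close>.\<close>
    then have "t [^]\<^bsub>G\<^esub> j \<otimes>\<^bsub>G\<^esub> q = t [^]\<^bsub>G\<^esub> j \<otimes>\<^bsub>G\<^esub> ((t [^]\<^bsub>G\<^esub> (m - 1)) [^]\<^bsub>G\<^esub> j \<otimes>\<^bsub>G\<^esub> q)" by simp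
    also have "\<dots> = q" using y(4) t_pow_right_inverse[of j] by (simp add: m_assoc[symmetric])
    finally show "t [^]\<^bsub>G\<^esub> j \<otimes>\<^bsub>G\<^esub> q = q" .
  qed
qed (rule m_pos)

end

section \<open>Injectivity of the derivative of the root, and exactness\<close>

context rooted_special_monoid
begin

text \<open>Absence of collisions concerns prefixes, whereas leading terms of \<open>kappa\<close>
  are compared through suffixes. Equivalent suffixes after the same letter complete both prefixes to
  \<open>s\<close>, and right cancellation makes the prefixes equivalent.\<close>

lemma suffix_distinct:
  assumes ij: "i < length s" "j < length s" "s ! i = s ! j" and eq: "equal (drop (Suc i) s) (drop (Suc j) s)"
  shows "i = j"
proof -
  let ?w = "[s ! i] @ drop (Suc i) s"
  have i: "take i s @ ?w = s" and j: "take j s @ [s ! j] @ drop (Suc j) s = s"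
    using id_take_nth_drop[OF ij(1)] id_take_nth_drop[OF ij(2)] by simp_all
  have "equal (take j s @ ?w) (take j s @ [s ! j] @ drop (Suc j) s)"
    unfolding ij(3) by (intro equal_append equal_refl eq)
  then have "equal (take j s @ ?w) (take i s @ ?w)" unfolding i j .
  then have "equal (take j s) (take i s)" by (simp only: equal_append_right_iff)
  then have "i = j \<or> (j, i) \<in> collisions" using ij by (auto simp: collisions_def)
  with collision_free show ?thesis by simp
qed

definition kappa :: "('a list set \<times> 'a option \<times> 'a list set \<Rightarrow>\<^sub>0 int) \<Rightarrow> ('a list set \<times> 'a option \<times> 'a list set \<Rightarrow>\<^sub>0 int)" where
  "kappa = frag_extend (\<lambda>(p, x, q). der p s q)"

text \<open>Among all terms of \<open>kappa z\<close> with the letter \<open>hd s\<close>, the one with the greatest right-hand component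
  arises in only one way, because distinct occurrences of that letter in \<open>s\<close> are followed by inequivalent
  suffixes.\<close>

lemma kappa_injective:
  assumes z: "z \<in> carrier (free_bimodule G {None})" and kappa: "kappa z = 0"
  shows "z = 0"
proof (rule ccontr)
  assume "z \<noteq> 0"
  then have ne: "Poly_Mapping.keys z \<noteq> {}" by simp
  have keys: "Poly_Mapping.keys z \<subseteq> carrier G \<times> {None} \<times> carrier G" using z by (simp add: free_bimodule_simps)
  let ?I = "{i. i < length s \<and> s ! i = hd s}"
  have "0 \<in> ?I" using s_nonempty by (simp add: hd_conv_nth)
  then have I: "finite ?I" "?I \<noteq> {}" by auto
  have "\<exists>i\<in>?I. \<forall>j\<in>?I. le (drop (Suc j) s) (drop (Suc i) s)"
    by (rule finite_total_max[OF I]) (rule total, erule (1) trans)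
  then obtain i where i: "i < length s" "s ! i = hd s"
    and imax: "\<And>j. j < length s \<Longrightarrow> s ! j = hd s \<Longrightarrow> le (drop (Suc j) s) (drop (Suc i) s)" by blast
  let ?v = "\<lambda>j. drop (Suc j) s"
  \<comment> \<open>The suffix is attached before maximising over right factors, because left
    multiplication by it need not respect \<open>le\<close>.\<close>
  have "\<exists>y\<in>Poly_Mapping.keys z. \<forall>y'\<in>Poly_Mapping.keys z.
      le (?v i @ word (snd (snd y'))) (?v i @ word (snd (snd y)))"
    by (rule finite_total_max[OF finite_keys ne]) (rule total, erule (1) trans)
  then obtain y where y: "y \<in> Poly_Mapping.keys z"
    and ymax: "\<And>y'. y' \<in> Poly_Mapping.keys z \<Longrightarrow> le (?v i @ word (snd (snd y'))) (?v i @ word (snd (snd y)))" by blast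
  obtain p q where pq: "y = (p, None, q)" "p \<in> carrier G" "q \<in> carrier G" using y keys by auto
  let ?T = "(p \<otimes>\<^bsub>G\<^esub> cls (take i s), Some (hd s), cls (?v i) \<otimes>\<^bsub>G\<^esub> q)"
  have unique: "j = i \<and> y' = y"
    if y': "y' \<in> Poly_Mapping.keys z" "y' = (p', x, q')" and j: "j < length s"
      and eq: "(p' \<otimes>\<^bsub>G\<^esub> cls (take j s), Some (s ! j), cls (?v j) \<otimes>\<^bsub>G\<^esub> q') = ?T" for j y' p' x q'
  proof -
    have p'q': "p' \<in> carrier G" "x = None" "q' \<in> carrier G" using y' keys by auto
    have sj: "s ! j = hd s" using eq by simp
    have lists: "?v j \<in> lists A" "?v i \<in> lists A" "word q' \<in> lists A" "word q \<in> lists A"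
      using take_drop_lists[OF s_lists] word_props p'q' pq by simp_all
    have "cls (?v j @ word q') = cls (?v j) \<otimes>\<^bsub>G\<^esub> q'" "cls (?v i @ word q) = cls (?v i) \<otimes>\<^bsub>G\<^esub> q"
      using cls_mult[OF lists(1,3)] cls_mult[OF lists(2,4)] word_props(2)[OF p'q'(3)] word_props(2)[OF pq(3)] by simp_all
    then have "cls (?v j @ word q') = cls (?v i @ word q)" using eq by simp
    then have "(?v j @ word q', ?v i @ word q) \<in> C"
      using lists cls_eq_iff[of "?v j @ word q'" "?v i @ word q"] by simp
    then have e: "equal (?v j @ word q') (?v i @ word q)" using congruence_equal by blast
    have "le (?v i @ word q') (?v i @ word q)" using ymax[OF y'(1)] y'(2) pq(1) by simp
    with e have "le (?v i @ word q') (?v j @ word q')" using trans unfolding equal_def by blast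
    \<comment> \<open>Both words end in \<open>word q'\<close>, which right invariance removes;
      together with the maximality of the suffix at \<open>i\<close> this fixes the
      position.\<close>
    then have "le (?v i) (?v j)" by (simp only: right_iff)
    with imax[OF j sj] have "equal (?v j) (?v i)" by (simp add: equal_def)
    then have ji: "j = i" using suffix_distinct[OF j i(1)] sj i(2) by simp
    \<comment> \<open>The order says nothing more about \<open>p'\<close> and \<open>q'\<close>:
      equality now comes from cancellation in \<open>G\<close> itself.\<close>
    have "p' = p" using right_cancel[OF p'q'(1) pq(2), of i] eq ji i(1) by simp
    moreover have "q' = q" using left_cancel[OF p'q'(3) pq(3), of "Suc i"] eq ji by simp
    ultimately show ?thesis using ji y'(2) p'q'(2) pq(1) by simp
  qed
  have coeff: "Poly_Mapping.lookup ((\<lambda>(p, x, q). der p s q) y') ?T = (if y' = y then 1 else 0)"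
    if y': "y' \<in> Poly_Mapping.keys z" for y'
  proof -
    obtain p' x q' where eq: "y' = (p', x, q')" by (cases y')
    then have p': "p' \<in> carrier G" using y' keys by auto
    have "Poly_Mapping.lookup (der p' s q') ?T =
        (\<Sum>j<length s. if ?T = (p' \<otimes>\<^bsub>G\<^esub> cls (take j s), Some (s ! j), cls (?v j) \<otimes>\<^bsub>G\<^esub> q') then 1 else 0)"
      unfolding der_sum[OF p' s_lists] Poly_Mapping.lookup_sum lookup_frag_of ..
    also have "\<dots> = (\<Sum>j<length s. if j = i then (if y' = y then 1 else 0) else 0)"
    proof (rule sum.cong[OF HOL.refl])
      fix j assume "j \<in> {..<length s}"
      then have j: "j < length s" by simp
      show "(if ?T = (p' \<otimes>\<^bsub>G\<^esub> cls (take j s), Some (s ! j), cls (?v j) \<otimes>\<^bsub>G\<^esub> q') then 1 else 0) =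
          (if j = i then (if y' = y then 1 else 0) else (0::int))"
      proof (cases "?T = (p' \<otimes>\<^bsub>G\<^esub> cls (take j s), Some (s ! j), cls (?v j) \<otimes>\<^bsub>G\<^esub> q')")
        case True
        with unique[OF y' eq j True[symmetric]] show ?thesis by simp
      next
        case False
        have "\<not> (j = i \<and> y' = y)" using False eq pq(1) i(2) by auto
        with False show ?thesis by auto
      qed
    qed
    also have "\<dots> = (if y' = y then 1 else 0)" using i(1) by simp
    finally show ?thesis using eq by simp
  qed
  have "Poly_Mapping.lookup (kappa z) ?T = (\<Sum>y'\<in>Poly_Mapping.keys z. Poly_Mapping.lookup z y' * (if y' = y then 1 else 0))"
    unfolding kappa_def lookup_frag_extend by (rule sum.cong[OF HOL.refl]) (simp only: coeff)
  also have "\<dots> = (\<Sum>y'\<in>Poly_Mapping.keys z. if y' = y then Poly_Mapping.lookup z y' else 0)"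
    by (rule sum.cong) simp_all
  also have "\<dots> = Poly_Mapping.lookup z y" using y by simp
  finally show False using kappa y by (simp add: in_keys_iff)
qed

lemma kappa_hom: "kappa \<in> left_module_hom E (free_bimodule G X) (free_bimodule G (Some ` A))"
  unfolding kappa_def
  by (rule frag_extend_hom_free) (simp_all add: keys_der s_lists der_equivariant)

lemma orbit_sum_hom:
  assumes "X \<subseteq> Y"
  shows "orbit_sum \<in> left_module_hom E (free_bimodule G X) (free_bimodule G Y)"
  unfolding orbit_sum_def
proof (rule frag_extend_hom_free)
  fix p x q assume a: "p \<in> carrier G" "x \<in> X" "q \<in> carrier G"
  show "Poly_Mapping.keys (\<Sum>j<m. frag_of ((shift ^^ j) (p, x, q))) \<subseteq> carrier G \<times> Y \<times> carrier G"
    by (rule keys_sum_frag_of, rule pow_closed) (use a assms in auto)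
  fix k n assume kn: "k \<in> carrier G" "n \<in> carrier G"
  have "(shift ^^ j) (k \<otimes>\<^bsub>G\<^esub> p, x, q \<otimes>\<^bsub>G\<^esub> n) =
      (case (shift ^^ j) (p, x, q) of (p, x, q) \<Rightarrow> (k \<otimes>\<^bsub>G\<^esub> p, x, q \<otimes>\<^bsub>G\<^esub> n))" for j
    using a kn by (simp add: shift_pow m_assoc)
  then show "(\<Sum>j<m. frag_of ((shift ^^ j) (k \<otimes>\<^bsub>G\<^esub> p, x, q \<otimes>\<^bsub>G\<^esub> n))) =
      frag_extend (\<lambda>(p, x, q). frag_of (k \<otimes>\<^bsub>G\<^esub> p, x, q \<otimes>\<^bsub>G\<^esub> n)) (\<Sum>j<m. frag_of ((shift ^^ j) (p, x, q)))"
    by (simp add: frag_extend_sum case_prod_unfold)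
qed

text \<open>Source and target may have different bases, so that in the truncated resolution the same
  map also leads out of the zero module in degree 3.\<close>

lemma difference_hom:
  assumes "X \<subseteq> Y"
  shows "difference \<in> left_module_hom E (free_bimodule G X) (free_bimodule G Y)"
  unfolding difference_def
proof (rule frag_extend_hom_free)
  fix p x q assume a: "p \<in> carrier G" "x \<in> X" "q \<in> carrier G"
  have "shift (p, x, q) \<in> carrier G \<times> Y \<times> carrier G" "(p, x, q) \<in> carrier G \<times> Y \<times> carrier G"
    using a assms by (auto simp: shift_def)
  then show "Poly_Mapping.keys (frag_of (shift (p, x, q)) - frag_of (p, x, q)) \<subseteq> carrier G \<times> Y \<times> carrier G"
    using keys_diff[of "frag_of (shift (p, x, q))" "frag_of (p, x, q)"] by auto
  fix k n assume "k \<in> carrier G" "n \<in> carrier G"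
  with a show "frag_of (shift (k \<otimes>\<^bsub>G\<^esub> p, x, q \<otimes>\<^bsub>G\<^esub> n)) - frag_of (k \<otimes>\<^bsub>G\<^esub> p, x, q \<otimes>\<^bsub>G\<^esub> n) =
      frag_extend (\<lambda>(p, x, q). frag_of (k \<otimes>\<^bsub>G\<^esub> p, x, q \<otimes>\<^bsub>G\<^esub> n)) (frag_of (shift (p, x, q)) - frag_of (p, x, q))"
    by (simp add: frag_extend_diff shift_def m_assoc)
qed

text \<open>The image of the generator is \<open>\<Sum>\<^sub>j s\<^sup>j (der s) s\<^sup>-\<^sup>j\<close>, that is, the derivative of \<open>r\<close> up to the unit \<open>s\<close>.\<close>

definition d1 :: "('a list set \<times> 'a option \<times> 'a list set \<Rightarrow>\<^sub>0 int) \<Rightarrow> ('a list set \<times> 'a option \<times> 'a list set \<Rightarrow>\<^sub>0 int)" where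
  "d1 z = kappa (orbit_sum z)"

lemma d1_hom: "d1 \<in> left_module_hom E (free_bimodule G X) (free_bimodule G (Some ` A))"
proof -
  have "(\<lambda>z. kappa (orbit_sum z)) \<in> left_module_hom E (free_bimodule G X) (free_bimodule G (Some ` A))"
    by (rule left_module_hom_compose[OF orbit_sum_hom[OF subset_refl] kappa_hom])
  then show ?thesis by (simp add: d1_def[abs_def])
qed

lemma der_power:
  assumes "p \<in> carrier G" "q \<in> carrier G"
  shows "der p (concat (replicate k s)) q = (\<Sum>j<k. der (p \<otimes>\<^bsub>G\<^esub> t [^]\<^bsub>G\<^esub> j) s (t [^]\<^bsub>G\<^esub> (k - 1 - j) \<otimes>\<^bsub>G\<^esub> q))"
  using assms(1)
proof (induction k arbitrary: p)
  case (Suc k)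
  have tt: "p \<otimes>\<^bsub>G\<^esub> t \<otimes>\<^bsub>G\<^esub> t [^]\<^bsub>G\<^esub> j = p \<otimes>\<^bsub>G\<^esub> t [^]\<^bsub>G\<^esub> Suc j" for j
    using Suc.prems nat_pow_Suc2[OF t_closed, of j] by (simp add: m_assoc)
  have "der p (concat (replicate (Suc k) s)) q = der p s (t [^]\<^bsub>G\<^esub> k \<otimes>\<^bsub>G\<^esub> q) + der (p \<otimes>\<^bsub>G\<^esub> t) (concat (replicate k s)) q"
    unfolding replicate_Suc concat.simps t_pow
    using der_append[OF Suc.prems assms(2) s_lists power_lists[of k]] by (simp only: t_def)
  also have "der (p \<otimes>\<^bsub>G\<^esub> t) (concat (replicate k s)) q =
      (\<Sum>j<k. der (p \<otimes>\<^bsub>G\<^esub> t \<otimes>\<^bsub>G\<^esub> t [^]\<^bsub>G\<^esub> j) s (t [^]\<^bsub>G\<^esub> (k - 1 - j) \<otimes>\<^bsub>G\<^esub> q))"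
    by (rule Suc.IH) (use Suc.prems in simp)
  also have "der p s (t [^]\<^bsub>G\<^esub> k \<otimes>\<^bsub>G\<^esub> q) + \<dots> =
      (\<Sum>j<Suc k. der (p \<otimes>\<^bsub>G\<^esub> t [^]\<^bsub>G\<^esub> j) s (t [^]\<^bsub>G\<^esub> (Suc k - 1 - j) \<otimes>\<^bsub>G\<^esub> q))"
    unfolding tt sum.lessThan_Suc_shift using Suc.prems by simp
  finally show ?case .
qed simp

lemma der_relator:
  assumes "p \<in> carrier G" "q \<in> carrier G"
  shows "der p r q = d1 (frag_of (p, None, t [^]\<^bsub>G\<^esub> (m - 1) \<otimes>\<^bsub>G\<^esub> q))"
proof -
  have "(t [^]\<^bsub>G\<^esub> (m - 1)) [^]\<^bsub>G\<^esub> j \<otimes>\<^bsub>G\<^esub> (t [^]\<^bsub>G\<^esub> (m - 1) \<otimes>\<^bsub>G\<^esub> q) = t [^]\<^bsub>G\<^esub> (m - 1 - j) \<otimes>\<^bsub>G\<^esub> q" if "j < m" for j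
  proof -
    \<comment> \<open>The norm uses powers of the inverse of \<open>t\<close>, the derivative of the
      relator nonnegative powers; the extra factor in the argument of \<open>d1\<close> makes the
      exponents agree modulo \<open>m\<close>.\<close>
    have "(m - 1) * j + (m - 1) = m * j + (m - 1 - j)"
      using that by (cases m) simp_all
    then have "(t [^]\<^bsub>G\<^esub> (m - 1)) [^]\<^bsub>G\<^esub> j \<otimes>\<^bsub>G\<^esub> t [^]\<^bsub>G\<^esub> (m - 1) = t [^]\<^bsub>G\<^esub> (m * j) \<otimes>\<^bsub>G\<^esub> t [^]\<^bsub>G\<^esub> (m - 1 - j)"
      unfolding nat_pow_pow[OF t_closed] nat_pow_mult[OF t_closed] by simp
    also have "\<dots> = t [^]\<^bsub>G\<^esub> (m - 1 - j)" unfolding t_pow_mult by simp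
    finally show ?thesis using assms by (simp add: m_assoc[symmetric])
  qed
  then have "(\<Sum>j<m. der (p \<otimes>\<^bsub>G\<^esub> t [^]\<^bsub>G\<^esub> j) s ((t [^]\<^bsub>G\<^esub> (m - 1)) [^]\<^bsub>G\<^esub> j \<otimes>\<^bsub>G\<^esub> (t [^]\<^bsub>G\<^esub> (m - 1) \<otimes>\<^bsub>G\<^esub> q))) =
      (\<Sum>j<m. der (p \<otimes>\<^bsub>G\<^esub> t [^]\<^bsub>G\<^esub> j) s (t [^]\<^bsub>G\<^esub> (m - 1 - j) \<otimes>\<^bsub>G\<^esub> q))"
    by (intro sum.cong) simp_all
  also have "\<dots> = der p r q" using der_power[OF assms, of m] by (simp add: relator_eq)
  finally show ?thesis
    using assms by (simp add: d1_def orbit_sum_def kappa_def frag_extend_sum shift_pow)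
qed

lemma d0_d1:
  assumes "z \<in> carrier (free_bimodule G {None})"
  shows "d0 (d1 z) = 0"
proof -
  have keys: "Poly_Mapping.keys z \<subseteq> carrier G \<times> {None} \<times> carrier G" using assms by (simp add: free_bimodule_simps)
  have "d0 (d1 z) = frag_extend (\<lambda>_. 0) z"
  proof (rule frag_additive_eq[OF keys])
    fix y :: "'a list set \<times> 'a option \<times> 'a list set" assume "y \<in> carrier G \<times> {None} \<times> carrier G"
    then obtain p q where y: "y = (p, None, q)" "p \<in> carrier G" "q \<in> carrier G" by auto
    let ?u = "t [^]\<^bsub>G\<^esub> (m - 1)"
    \<comment> \<open>Each summand of the norm has boundary \<open>a (Suc j) - a j\<close>, and the
      telescope closes up because the \<open>m\<close>-th power of \<open>t\<close> is the identity.
      The extra \<open>t\<close> on the right is the class of \<open>s\<close> in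
      \<open>d0_der\<close>.\<close>
    define a :: "nat \<Rightarrow> ('a list set \<times> 'a option \<times> 'a list set) \<Rightarrow>\<^sub>0 int"
      where "a j = frag_of (p \<otimes>\<^bsub>G\<^esub> t [^]\<^bsub>G\<^esub> j, None, t \<otimes>\<^bsub>G\<^esub> (?u [^]\<^bsub>G\<^esub> j \<otimes>\<^bsub>G\<^esub> q))" for j
    have "d0 (der (p \<otimes>\<^bsub>G\<^esub> t [^]\<^bsub>G\<^esub> j) s (?u [^]\<^bsub>G\<^esub> j \<otimes>\<^bsub>G\<^esub> q)) = a (Suc j) - a j" for j
    proof -
      have "t \<otimes>\<^bsub>G\<^esub> ?u [^]\<^bsub>G\<^esub> Suc j = t \<otimes>\<^bsub>G\<^esub> ?u \<otimes>\<^bsub>G\<^esub> ?u [^]\<^bsub>G\<^esub> j"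
        using nat_pow_Suc2[of ?u j] by (simp add: m_assoc)
      also have "\<dots> = ?u [^]\<^bsub>G\<^esub> j" unfolding t_inverse by simp
      finally have "t \<otimes>\<^bsub>G\<^esub> (?u [^]\<^bsub>G\<^esub> Suc j \<otimes>\<^bsub>G\<^esub> q) = ?u [^]\<^bsub>G\<^esub> j \<otimes>\<^bsub>G\<^esub> q"
        using y(3) by (metis m_assoc nat_pow_closed t_closed)
      then have a_Suc: "a (Suc j) = frag_of (p \<otimes>\<^bsub>G\<^esub> t [^]\<^bsub>G\<^esub> j \<otimes>\<^bsub>G\<^esub> t, None, ?u [^]\<^bsub>G\<^esub> j \<otimes>\<^bsub>G\<^esub> q)"
        using y(2) by (simp add: a_def m_assoc)
      have c: "p \<otimes>\<^bsub>G\<^esub> t [^]\<^bsub>G\<^esub> j \<in> carrier G" "?u [^]\<^bsub>G\<^esub> j \<otimes>\<^bsub>G\<^esub> q \<in> carrier G" using y(2,3) by simp_all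
      show ?thesis unfolding a_Suc unfolding a_def by (rule d0_der[OF c s_lists, folded t_def])
    qed
    then have "d0 (d1 (frag_of y)) = (\<Sum>j<m. a (Suc j) - a j)"
      using y(2,3) by (simp add: d1_def orbit_sum_def kappa_def d0_def frag_extend_sum frag_extend_comp shift_pow y(1))
    also have "\<dots> = a m - a 0" by (rule sum_lessThan_telescope)
    also have "\<dots> = 0"
    proof -
      have "?u [^]\<^bsub>G\<^esub> m = \<one>\<^bsub>G\<^esub>"
        using t_pow_left_inverse[of m] by (simp add: t_order)
      then show ?thesis using y(2,3) by (simp add: a_def t_order)
    qed
    finally show "d0 (d1 (frag_of y)) = frag_extend (\<lambda>_. 0) (frag_of y)" by simp
  qed (simp_all add: d1_def d0_def kappa_def orbit_sum_def frag_extend_diff)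
  then show ?thesis by (simp add: frag_extend_eq_0)
qed

lemma exact_1: "d1 ` carrier (free_bimodule G {None}) = {z \<in> carrier (free_bimodule G (Some ` A)). d0 z = 0}"
proof (intro equalityI subsetI)
  fix z assume "z \<in> d1 ` carrier (free_bimodule G {None})"
  then show "z \<in> {z \<in> carrier (free_bimodule G (Some ` A)). d0 z = 0}"
    using d0_d1 homD(1)[OF d1_hom] by auto
next
  fix z assume z: "z \<in> {z \<in> carrier (free_bimodule G (Some ` A)). d0 z = 0}"
  have additive: "d1 (a + b) = d1 a + d1 b" "d1 (- a) = - d1 a" "d1 0 = 0" for a b
    by (simp_all add: d1_def kappa_def orbit_sum_def frag_extend_add frag_extend_minus)
  have closed: "a + b \<in> carrier (free_bimodule G {None})" "- a \<in> carrier (free_bimodule G {None})"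
    "0 \<in> carrier (free_bimodule G {None})"
    if "a \<in> carrier (free_bimodule G {None})" "b \<in> carrier (free_bimodule G {None})" for a b
    using that keys_add[of a b] by (auto simp: free_bimodule_simps)
  show "z \<in> d1 ` carrier (free_bimodule G {None})"
  \<comment> \<open>The subgroup is the image of \<open>d1\<close>; it contains the derivatives of
    the relator by \<open>der_relator\<close>.\<close>
  proof (rule kernel_d0)
    show "0 \<in> d1 ` carrier (free_bimodule G {None})"
      using additive(3) by (intro image_eqI[of _ _ 0]) (simp_all add: free_bimodule_simps)
    show "a + b \<in> d1 ` carrier (free_bimodule G {None})"
      if "a \<in> d1 ` carrier (free_bimodule G {None})" "b \<in> d1 ` carrier (free_bimodule G {None})" for a b
    proof -
      from that obtain a' b' where "a = d1 a'" "a' \<in> carrier (free_bimodule G {None})"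
        "b = d1 b'" "b' \<in> carrier (free_bimodule G {None})" by blast
      then show ?thesis using closed(1) additive(1) by (intro image_eqI[of _ _ "a' + b'"]) simp_all
    qed
    show "- a \<in> d1 ` carrier (free_bimodule G {None})" if "a \<in> d1 ` carrier (free_bimodule G {None})" for a
    proof -
      from that obtain a' where "a = d1 a'" "a' \<in> carrier (free_bimodule G {None})" by blast
      then show ?thesis using closed(2) additive(2) by (intro image_eqI[of _ _ "- a'"]) simp_all
    qed
    show "der p r q \<in> d1 ` carrier (free_bimodule G {None})" if "p \<in> carrier G" "q \<in> carrier G" for p q
      unfolding der_relator[OF that] using that by (intro imageI) (simp add: free_bimodule_simps)
    show "z \<in> carrier (free_bimodule G (Some ` A))" "d0 z = 0" using z by simp_all
  qed
qed

lemma exact_difference: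
  "difference ` carrier (free_bimodule G X) = {z \<in> carrier (free_bimodule G X). orbit_sum z = 0}"
proof (intro equalityI subsetI)
  fix z assume "z \<in> difference ` carrier (free_bimodule G X)"
  then show "z \<in> {z \<in> carrier (free_bimodule G X). orbit_sum z = 0}"
  proof
    fix w assume w: "z = difference w" "w \<in> carrier (free_bimodule G X)"
    then have "orbit_sum z = 0" using orbit_sum_difference[of w X] by (simp add: free_bimodule_simps)
    with w(1) homD(1)[OF difference_hom[OF subset_refl] w(2)]
    show ?thesis by simp
  qed
next
  fix z assume "z \<in> {z \<in> carrier (free_bimodule G X). orbit_sum z = 0}"
  then show "z \<in> difference ` carrier (free_bimodule G X)"
    using kernel_orbit_sum[of z X] by (auto simp: free_bimodule_simps)
qed

lemma exact_orbit_sum: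
  "orbit_sum ` carrier (free_bimodule G X) = {z \<in> carrier (free_bimodule G X). difference z = 0}"
proof (intro equalityI subsetI)
  fix z assume "z \<in> orbit_sum ` carrier (free_bimodule G X)"
  then show "z \<in> {z \<in> carrier (free_bimodule G X). difference z = 0}"
  proof
    fix w assume w: "z = orbit_sum w" "w \<in> carrier (free_bimodule G X)"
    then have "difference z = 0" using difference_orbit_sum[of w X] by (simp add: free_bimodule_simps)
    with w(1) homD(1)[OF orbit_sum_hom[OF subset_refl] w(2)]
    show ?thesis by simp
  qed
next
  fix z assume "z \<in> {z \<in> carrier (free_bimodule G X). difference z = 0}"
  then show "z \<in> orbit_sum ` carrier (free_bimodule G X)"
    using kernel_difference[of z X] by (auto simp: free_bimodule_simps)
qed

lemma d1_eq_zero_iff: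
  assumes "z \<in> carrier (free_bimodule G {None})"
  shows "d1 z = 0 \<longleftrightarrow> orbit_sum z = 0"
  using kappa_injective[OF homD(1)[OF orbit_sum_hom[OF subset_refl] assms]]
  by (auto simp: d1_def kappa_def)

text \<open>Index \<open>n\<close> is the map from degree \<open>n + 1\<close> to degree
  \<open>n\<close>. Since \<open>d1\<close> already contains the norm, the difference map comes next
  and occupies the even indices.\<close>

definition differential :: "nat \<Rightarrow> ('a list set \<times> 'a option \<times> 'a list set \<Rightarrow>\<^sub>0 int) \<Rightarrow> ('a list set \<times> 'a option \<times> 'a list set \<Rightarrow>\<^sub>0 int)" where
  "differential n = (if n = 0 then d0 else if n = 1 then d1 else if even n then difference else orbit_sum)"

lemma periodic_resolution:
  assumes "finite A"
  shows "free_resolution G (\<lambda>n. if n = 1 then Some ` A else {None}) differential aug"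
proof (intro free_resolution.intro free_resolution_axioms.intro monoid_axioms)
  show "countable (carrier G)" by (rule countable_carrier[OF assms])
  fix n :: nat
  let ?X = "\<lambda>n :: nat. if n = 1 then Some ` A else {None}"
  show "finite (?X n)" using assms by simp
  consider "n = 0" | "n = 1" | "n \<ge> 2" by linarith
  then show "differential n \<in> left_module_hom E (free_bimodule G (?X (Suc n))) (free_bimodule G (?X n))"
    by cases (simp_all add: differential_def d0_hom d1_hom difference_hom orbit_sum_hom)
  consider "n = 0" | "n = 1" | "n \<ge> 2" by linarith
  then show "differential (Suc n) ` carrier (free_bimodule G (?X (Suc (Suc n)))) =
      {z \<in> carrier (free_bimodule G (?X (Suc n))). differential n z = 0}"
  proof cases
    case 1
    then show ?thesis by (simp add: differential_def exact_1)
  next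
    case 2
    have "{z \<in> carrier (free_bimodule G {None}). d1 z = 0} = {z \<in> carrier (free_bimodule G {None}). orbit_sum z = 0}"
      using d1_eq_zero_iff by blast
    with 2 show ?thesis by (simp add: differential_def exact_difference)
  next
    case 3
    then show ?thesis by (cases "even n") (simp_all add: differential_def exact_difference exact_orbit_sum)
  qed
qed (simp_all add: aug_hom aug_surj differential_def exact_0)

lemma free_bimodule_empty: "carrier (free_bimodule G {}) = {0}"
  by (auto simp: free_bimodule_simps)

lemma length_two_resolution:
  assumes "finite A" and m: "m = 1"
  shows "free_resolution G (\<lambda>n. if n = 1 then Some ` A else if n \<le> 2 then {None} else {}) differential aug"
proof (intro free_resolution.intro free_resolution_axioms.intro monoid_axioms)
  show "countable (carrier G)" by (rule countable_carrier[OF assms(1)])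
  fix n :: nat
  let ?X = "\<lambda>n :: nat. if n = 1 then Some ` A else if n \<le> 2 then {None} else {}"
  show "finite (?X n)" using assms(1) by simp
  have zero: "differential n 0 = 0" for n
    by (simp add: differential_def d0_def d1_def kappa_def orbit_sum_def difference_def)
  consider "n = 0" | "n = 1" | "n \<ge> 2" by linarith
  then show "differential n \<in> left_module_hom E (free_bimodule G (?X (Suc n))) (free_bimodule G (?X n))"
    by cases (simp_all add: differential_def d0_hom d1_hom difference_hom orbit_sum_hom)
  consider "n = 0" | "n = 1" | "n \<ge> 2" by linarith
  then show "differential (Suc n) ` carrier (free_bimodule G (?X (Suc (Suc n)))) =
      {z \<in> carrier (free_bimodule G (?X (Suc n))). differential n z = 0}"
  proof cases
    case 1
    then show ?thesis by (simp add: differential_def exact_1)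
  next
    case 2
    \<comment> \<open>For \<open>m = 1\<close> the norm is the identity, so \<open>d1\<close> is
      \<open>kappa\<close> and hence injective.\<close>
    have id: "orbit_sum z = z" for z :: "'a list set \<times> 'a option \<times> 'a list set \<Rightarrow>\<^sub>0 int"
    proof -
      have "orbit_sum z = frag_extend frag_of z" unfolding orbit_sum_def by (simp add: m)
      then show ?thesis by (simp flip: frag_expansion)
    qed
    have "{z \<in> carrier (free_bimodule G {None}). d1 z = 0} = {0}"
      using d1_eq_zero_iff unfolding id by (auto simp: free_bimodule_simps d1_def kappa_def id)
    with 2 show ?thesis using zero[of 1] zero[of 2] by (simp add: free_bimodule_empty differential_def numeral_2_eq_2)
  next
    case 3
    then show ?thesis using zero by (auto simp: free_bimodule_empty)
  qed
qed (simp_all add: aug_hom aug_surj differential_def exact_0)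

lemma dvd_augmentation_differential:
  assumes "k \<ge> 2"
  shows "int m dvd augmentation (differential k z)"
proof (cases "even k")
  case True
  have "augmentation (difference z) = augmentation z * 0"
    unfolding difference_def by (rule augmentation_frag_extend[where S = UNIV]) simp_all
  with True assms show ?thesis by (simp add: differential_def)
next
  case False
  have "augmentation (orbit_sum z) = augmentation z * int m"
    unfolding orbit_sum_def by (rule augmentation_frag_extend[where S = UNIV]) (simp_all add: augmentation_sum)
  with False assms show ?thesis by (auto simp: differential_def)
qed

end

section \<open>The empty relator, primitive roots and the conclusion\<close>

lemma (in special_monoid) length_one_resolution:
  assumes "finite A" and r: "r = []"
  shows "free_resolution G (\<lambda>n. if n = 0 then {None} else if n = 1 then Some ` A else {})
    (\<lambda>n. if n = 0 then d0 else (\<lambda>_. 0)) aug"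
proof (intro free_resolution.intro free_resolution_axioms.intro monoid_axioms)
  show "countable (carrier G)" by (rule countable_carrier[OF assms(1)])
  fix n :: nat
  let ?X = "\<lambda>n :: nat. if n = 0 then {None} else if n = 1 then Some ` A else {}"
  show "finite (?X n)" using assms(1) by simp
  have empty: "carrier (free_bimodule G {}) = {0}" by (auto simp: free_bimodule_simps)
  show "(if n = 0 then d0 else (\<lambda>_. 0)) \<in> left_module_hom E (free_bimodule G (?X (Suc n))) (free_bimodule G (?X n))"
  proof (cases n)
    case (Suc k)
    then show ?thesis
      by (intro homI) (simp_all add: free_bimodule_simps smult_free_bimodule frag_extend_eq_0 case_prod_unfold)
  qed (simp add: d0_hom)
  have "z = 0" if "z \<in> carrier (free_bimodule G (Some ` A))" "d0 z = 0" for z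
  proof -
    have "der p w q = 0" if "w = []" for p w q using that by simp
    note der_r = this[OF r]
    \<comment> \<open>The derivative of the empty relator vanishes, so the zero subgroup is an
      admissible choice in \<open>kernel_d0\<close>.\<close>
    have "z \<in> {0}" by (rule kernel_d0) (use that der_r in simp_all)
    then show ?thesis by simp
  qed
  then have "{z \<in> carrier (free_bimodule G (Some ` A)). d0 z = 0} = {0}"
    by (auto simp: free_bimodule_simps d0_def)
  then show "(if Suc n = 0 then d0 else (\<lambda>_. 0)) ` carrier (free_bimodule G (?X (Suc (Suc n)))) =
      {z \<in> carrier (free_bimodule G (?X (Suc n))). (if n = 0 then d0 else (\<lambda>_. 0)) z = 0}"
    by (cases n) (auto simp: empty)
qed (simp_all add: aug_hom aug_surj exact_0)

text \<open>A root of a root is again a root, so one of least length is primitive; a word that is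
  not a proper power is its own root, with \<open>m = 1\<close>.\<close>

lemma primitive_root:
  assumes "r \<noteq> []"
  obtains s m where "r = concat (replicate m s)" "m > 0" "s \<noteq> []" "\<not> proper_power s"
    "proper_power r \<longleftrightarrow> m \<ge> 2"
proof (cases "proper_power r")
  case False
  then show ?thesis using that[of 1 r] assms by simp
next
  case True
  let ?P = "\<lambda>s. s \<noteq> [] \<and> (\<exists>m\<ge>2. r = concat (replicate m s))"
  obtain s0 where "?P s0" using True unfolding proper_power_def by blast
  from ex_has_least_nat[of ?P, OF this, of length]
  obtain s where s: "?P s" and min: "\<And>s'. ?P s' \<Longrightarrow> length s \<le> length s'" by blast
  from s obtain m where m: "m \<ge> 2" "r = concat (replicate m s)" by blast
  have "\<not> proper_power s"
  proof
    assume "proper_power s"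
    then obtain u k where u: "u \<noteq> []" "k \<ge> 2" "s = concat (replicate k u)" unfolding proper_power_def by blast
    have "concat (replicate n (concat (replicate k u))) = concat (replicate (n * k) u)" for n
      by (induction n) (simp_all add: replicate_add)
    then have "r = concat (replicate (m * k) u)" using m(2) u(3) by simp
    moreover have "m * k \<ge> 2" using mult_le_mono[OF m(1) u(2)] by simp
    ultimately have "length s \<le> length u" using min[of u] u(1) by blast
    moreover have "length s = k * length u" unfolding u(3) by (induction k) simp_all
    ultimately have "k * length u \<le> length u" by simp
    with mult_le_mono1[OF u(2), of "length u"] u(1) show False by simp
  qed
  with that[of m s] m s True show ?thesis by simp
qed

theorem theoremB:
  fixes A :: "'a set" and r :: "'a list" and U :: "'u::infinite itself"
  assumes "finite A" and "r \<in> lists A"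
  shows "bi_FP_infinity U (one_relator_monoid A r) \<and>
    (\<not> proper_power r \<longrightarrow> hochschild_dimension U (one_relator_monoid A r) \<le> 2) \<and>
    (proper_power r \<longrightarrow> hochschild_dimension U (one_relator_monoid A r) = \<infinity>)"
proof (cases "r = []")
  case True
  \<comment> \<open>The empty word is not a positive power of a nonempty word, so it falls outside
    the construction from a root; the monoid is free and its resolution stops in degree 1.\<close>
  interpret special_monoid A r by unfold_locales fact
  interpret free_resolution G "\<lambda>n. if n = 0 then {None} else if n = 1 then Some ` A else {}"
    "\<lambda>n. if n = 0 then d0 else (\<lambda>_. 0)" aug
    by (rule length_one_resolution[OF assms(1) True])
  have "\<not> proper_power r" using True by (auto simp: proper_power_def)
  moreover have "hochschild_dimension U G \<le> enat 2" by (rule hochschild_dimension_le) simp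
  ultimately show ?thesis using bi_FP_infinity[of U] by (simp add: numeral_eq_enat)
next
  case False
  then obtain s m where r: "r = concat (replicate m s)" "m > 0" "s \<noteq> []" and prim: "\<not> proper_power s"
    and power: "proper_power r \<longleftrightarrow> m \<ge> 2"
    by (rule primitive_root)
  obtain le where le: "word_order s le" "word_order.collisions s le = {}"
    by (rule collision_free_word_order[OF prim])
  interpret rooted_special_monoid A r s le m
    by (intro rooted_special_monoid.intro special_monoid.intro rooted_special_monoid_axioms.intro assms le r)
  show ?thesis
  proof (cases "m = 1")
    case True
    interpret free_resolution G "\<lambda>n. if n = 1 then Some ` A else if n \<le> 2 then {None} else {}" differential aug
      by (rule length_two_resolution[OF assms(1) True])
    have "hochschild_dimension U G \<le> enat 2" by (rule hochschild_dimension_le) simp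
    with True power show ?thesis using bi_FP_infinity[of U] by (simp add: numeral_eq_enat)
  next
    case False
    interpret free_resolution G "\<lambda>n. if n = 1 then Some ` A else {None}" differential aug
      by (rule periodic_resolution[OF assms(1)])
    have "m \<ge> 2" using False r(2) by simp
    \<comment> \<open>From degree 2 on every module has rank one and every differential has
      augmentation divisible by \<open>m\<close>, which is not a unit.\<close>
    moreover have "hochschild_dimension U G = \<infinity>"
      by (rule hochschild_dimension_infinite[where l = 2 and m = "int m" and x = None])
        (use \<open>m \<ge> 2\<close> dvd_augmentation_differential in auto)
    ultimately show ?thesis using power bi_FP_infinity[of U] by simp
  qed
qed

end
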